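(* Put $\vec\alpha=(\alpha,\beta,\gamma)$, $h(y,z,\vec\alpha)=\alpha-\beta$ and $\vec\Pi(z,u,\vec\alpha)=(\Pi^1,\Pi^2,\Pi^{12})(z,u,\vec\alpha)$. Define recursively $R^1(y,z,\vec\alpha)=0$, $S^1(y,z,\vec\alpha)=1$ and, for $k\ge 1$, $$R^{k+1}(y,z,\vec\alpha)=(1-\mathbb I_{\mathcal R_k}(y,z,\vec\alpha))\Big(p_1\int_{\mathbb E}R^k(z,u,\vec\Pi(z,u,\vec\alpha))f^0_z(u)\mu(du)+q_1\int_{\mathbb E}S^k(z,u,\vec\Pi(z,u,\vec\alpha))f^1_z(u)\mu(du)\Big),$$ $$S^{k+1}(y,z,\vec\alpha)=\mathbb I_{\mathcal R_k}(y,z,\vec\alpha)+(1-\mathbb I_{\mathcal R_k}(y,z,\vec\alpha))\,p_2\int_{\mathbb E}S^k(z,u,\vec\Pi(z,u,\vec\alpha))f^1_z(u)\mu(du),$$ where $$\mathcal R_k=\{(y,z,\vec\alpha):\ h(y,z,\vec\alpha)\ge \mathbf T_x\mathbf Q_x^{k-1}h(y,z,\vec\alpha)\}$$ $$=\Big\{(y,z,\vec\alpha):\ \alpha-\beta\ge(1-\alpha-\gamma)\Big[p_1\int_{\mathbb E}R^k(z,u,\vec\Pi(z,u,\vec\alpha))f^0_z(u)\mu(du)+q_1\int_{\mathbb E}S^k(z,u,\vec\Pi(z,u,\vec\alpha))f^1_z(u)\mu(du)\Big]+(\alpha-\beta)p_2\int_{\mathbb E}S^k(z,u,\vec\Pi(z,u,\vec\alpha))f^1_z(u)\mu(du)\Big\}.$$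 Let $R^*=\lim_{k\to\infty}R^k$, $S^*=\lim_{k\to\infty}S^k$ and $$B^*=\Big\{(y,z,\vec\alpha):\ \alpha-\beta\ge(1-\alpha-\gamma)\Big[p_1\int_{\mathbb E}R^*(z,u,\vec\Pi(z,u,\vec\alpha))f^0_z(u)\mu(du)+q_1\int_{\mathbb E}S^*(z,u,\vec\Pi(z,u,\vec\alpha))f^1_z(u)\mu(du)\Big]+(\alpha-\beta)p_2\int_{\mathbb E}S^*(z,u,\vec\Pi(z,u,\vec\alpha))f^1_z(u)\mu(du)\Big\}.$$ (a) The solution of the optimal stopping problem for the process $(X_{n-1},X_n,\vec\Pi_n)$ with payoff function $h$ is given by $$\tau_0^*=\inf\{n\ge1:\ (X_{n-1},X_n,\vec\Pi_n)\in B^*\}.$$ (b) The optimal value $V(x)=\sup_{\tau\in\mathcal S}\mathbf P_x(\tau<\infty,\ \theta_1\le\tau<\theta_2)$ is given by $$V(x)=\max\{p_2(1-\pi)\rho,\,V_0(x)\},$$ where, with $\vec\pi=(\pi,\rho\pi,\rho(1-\pi))$, $$V_0(x)=(1-\pi)(1-\rho)\Big[p_1\int_{\mathbb E}R^*(x,u,\vec\Pi(x,u,\vec\pi))f^0_x(u)\mu(du)+q_1\int_{\mathbb E}S^*(x,u,\vec\Pi(x,u,\vec\pi))f^1_x(u)\mu(du)\Big]+\pi(1-\rho)p_2\int_{\mathbb E}S^*(x,u,\vec\Pi(x,u,\vec\pi))f^1_x(u)\mu(du),$$ and the optimal stopping time is $\tau^\star=0\cdot\mathbb I_{\{p_2(1-\pi)\rho\ge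 V_0(x)\}}+\tau_0^*\,\mathbb I_{\{p_2(1-\pi)\rho<V_0(x)\}}$, i.e. $\tau^\star=0$ if $p_2(1-\pi)\rho\ge V_0(x)$ and $\tau^\star=\tau_0^*$ otherwise.
   Context: Model. $\mathbb N=\{0,1,2,\dots\}$; $\mathbb E$ is a Borel subset of $\mathbb R$ with Borel $\sigma$-field $\mathcal B$ and a ($\sigma$-additive) measure $\mu$. For $i=0,1,2$, $f^i_x(y)$ ($x,y\in\mathbb E$) are known, different transition densities with respect to $\mu$ with $f_x^i(y)/f_x^{(i+1)\bmod 3}(y)<\infty$ for all $x,y$. Parameters: $\pi,\rho\in[0,1]$, $p_1,p_2\in(0,1)$, $q_i=1-p_i$. The unobservable random variables $\theta_1\le\theta_2$ with values in $\mathbb N$ satisfy $\mathbf P(\theta_1=0)=\pi$, $\mathbf P(\theta_1=j)=(1-\pi)p_1^{j-1}q_1$ for $j\ge1$; $\mathbf P(\theta_2=j\mid\theta_1=j)=\rho$, $\mathbf P(\theta_2=k\mid\theta_1=j)=(1-\rho)p_2^{k-j-1}q_2$ for $k>j$. The observed process $(X_n)_{n\in\mathbb N}$ is obtained by switching between three Markov processes: under $\mathbf P_x$, $X_0=x$, and given $\theta_1=j,\theta_2=k$ the process is Markov, with transition density from $X_{s-1}$ to $X_s$ ($s\ge1$) equal to $f^0$ if $s<j$, $f^1$ if $j\le s<k$, $f^2$ if $s\ge k$. $\mathcal F_n=\sigma(X_0,\dots,X_n)$; $\mathcal S$ is the set of all stopping times with respect to $(\mathcal F_n)_{n\ge 0}$.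 A posteriori processes: $\Pi^i_n=\mathbf P_x(\theta_i\le n\mid\mathcal F_n)$ ($i=1,2$), $\Pi^{12}_n=\mathbf P_x(\theta_1=\theta_2>n\mid\mathcal F_n)$, $\vec\Pi_n=(\Pi^1_n,\Pi^2_n,\Pi^{12}_n)$. Functions: $\mathbf H(x,y,\alpha,\beta,\gamma)=(1-\alpha)p_1f^0_x(y)+[p_2(\alpha-\beta)+q_1(1-\alpha-\gamma)]f^1_x(y)+[q_2\alpha+p_2\beta+q_1\gamma]f^2_x(y)$, and $\Pi^1(x,y,\alpha,\beta,\gamma)=1-\frac{p_1(1-\alpha)f^0_x(y)}{\mathbf H(x,y,\alpha,\beta,\gamma)}$, $\Pi^2(x,y,\alpha,\beta,\gamma)=\frac{(q_2\alpha+p_2\beta+q_1\gamma)f^2_x(y)}{\mathbf H(x,y,\alpha,\beta,\gamma)}$, $\Pi^{12}(x,y,\alpha,\beta,\gamma)=\frac{p_1\gamma f^0_x(y)}{\mathbf H(x,y,\alpha,\beta,\gamma)}$. Operators: for a Borel function $v:\mathbb E^2\times[0,1]^3\to[0,1]$, $\mathbf T_xv(y,z,\vec\alpha)=\mathbf E_x(v(X_n,X_{n+1},\vec\Pi_{n+1})\mid X_{n-1}=y,X_n=z,\vec\Pi_n=\vec\alpha)$ and $\mathbf Q_xv=\max\{v,\mathbf T_xv\}$; $\mathbf Q_x^k$ is the $k$-th iterate of $\mathbf Q_x$. $\mathbb I_A$ denotes the indicator function of the set $A$.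
   Formalization: In (b), the constant p_2(1-π)ρ in V(x) and τ* is replaced by π(1-ρ), the success probability of stopping at 0; as printed it fails for ρ=1, π<1, where V(x)=0 but p_2(1-π)ρ>0. *)

theory Defs
  imports "HOL-Probability.Probability"
begin

text \<open>
  The measure \<open>\<mu>\<close> on \<open>\<bbbE>\<close> is not assumed to be \<open>\<sigma>\<close>-finite, so the last conjunct (the density
  defines a Markov kernel) is part of what it means to be a transition density; for
  \<open>\<sigma>\<close>-finite \<open>\<mu>\<close> its measurability part follows from joint measurability.
\<close>

definition transition_density :: "real measure \<Rightarrow> (real \<Rightarrow> real \<Rightarrow> real) \<Rightarrow> bool" where
  "transition_density \<mu> g \<longleftrightarrow>
     (\<forall>x\<in>space \<mu>. \<forall>y\<in>space \<mu>. 0 \<le> g x y) \<and>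
     case_prod g \<in> borel_measurable (\<mu> \<Otimes>\<^sub>M \<mu>) \<and>
     (\<lambda>x. density \<mu> (\<lambda>y. ennreal (g x y))) \<in> \<mu> \<rightarrow>\<^sub>M prob_algebra \<mu>"

definition regime :: "nat \<Rightarrow> nat \<Rightarrow> nat \<Rightarrow> nat" where
  "regime j k s = (if s < j then 0 else if s < k then 1 else 2)"

text \<open>
  \<open>hist M X (enat n)\<close> is \<open>\<F>\<^sub>n = \<sigma>(X\<^sub>0, \<dots>, X\<^sub>n)\<close> and \<open>hist M X \<infinity>\<close> is generated by all the \<open>X\<^sub>i\<close>.
  Time is indexed by \<^typ>\<open>enat\<close> so that stopping times may take the value \<open>\<infinity>\<close>.
\<close>

definition hist :: "'a measure \<Rightarrow> (nat \<Rightarrow> 'a \<Rightarrow> real) \<Rightarrow> enat \<Rightarrow> 'a measure" where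
  "hist M X t = sigma (space M) {X i -` B \<inter> space M | i B. enat i \<le> t \<and> B \<in> sets borel}"

definition stopping_times :: "'a measure \<Rightarrow> (nat \<Rightarrow> 'a \<Rightarrow> real) \<Rightarrow> ('a \<Rightarrow> enat) set" where
  "stopping_times M X = {\<tau>. stopping_time (hist M X) \<tau>}"

text \<open>
  The probability space \<open>M\<close> plays the role of \<open>\<^bold>P\<^sub>x\<close>. The ratio condition is read with
  \<open>0 / 0 = 0\<close>, which is what division on \<^typ>\<open>ennreal\<close> yields, while \<open>a / 0 = \<infinity>\<close> for \<open>a > 0\<close>.
  Conditional statements are only imposed for conditioning events of positive probability;
  \<open>uniform_measure M A\<close> is \<open>M\<close> conditioned on \<open>A\<close>.
\<close>

locale switching_model = prob_space M
  for M :: "'a measure"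
    and E :: "real set" and \<mu> :: "real measure" and f :: "nat \<Rightarrow> real \<Rightarrow> real \<Rightarrow> real"
    and \<pi> \<rho> p1 p2 x :: real
    and \<theta>1 \<theta>2 :: "'a \<Rightarrow> nat" and X :: "nat \<Rightarrow> 'a \<Rightarrow> real" +
  assumes E_borel: "E \<in> sets borel"
    and sets_mu: "sets \<mu> = sets (restrict_space borel E)"
    and densities: "i < 3 \<Longrightarrow> transition_density \<mu> (f i)"
    and densities_different:
      "i < 3 \<Longrightarrow> j < 3 \<Longrightarrow> i \<noteq> j \<Longrightarrow> \<exists>y\<in>E. \<exists>z\<in>E. f i y z \<noteq> f j y z"
    and ratio_finite:
      "i < 3 \<Longrightarrow> y \<in> E \<Longrightarrow> z \<in> E \<Longrightarrow>
         ennreal (f i y z) / ennreal (f ((i + 1) mod 3) y z) < \<infinity>"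
    and pi_range: "0 \<le> \<pi>" "\<pi> \<le> 1"
    and rho_range: "0 \<le> \<rho>" "\<rho> \<le> 1"
    and p1_range: "0 < p1" "p1 < 1"
    and p2_range: "0 < p2" "p2 < 1"
    and x_in_E: "x \<in> E"
    and theta_measurable: "\<theta>1 \<in> M \<rightarrow>\<^sub>M count_space UNIV" "\<theta>2 \<in> M \<rightarrow>\<^sub>M count_space UNIV"
    and theta_le: "\<omega> \<in> space M \<Longrightarrow> \<theta>1 \<omega> \<le> \<theta>2 \<omega>"
    and theta1_zero: "\<P>(\<omega> in M. \<theta>1 \<omega> = 0) = \<pi>"
    and theta1_pos: "1 \<le> j \<Longrightarrow> \<P>(\<omega> in M. \<theta>1 \<omega> = j) = (1 - \<pi>) * p1 ^ (j - 1) * (1 - p1)"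
    and theta2_eq:
      "\<P>(\<omega> in M. \<theta>1 \<omega> = j) \<noteq> 0 \<Longrightarrow> \<P>(\<omega> in M. \<theta>2 \<omega> = j \<bar> \<theta>1 \<omega> = j) = \<rho>"
    and theta2_gt:
      "\<P>(\<omega> in M. \<theta>1 \<omega> = j) \<noteq> 0 \<Longrightarrow> j < k \<Longrightarrow>
         \<P>(\<omega> in M. \<theta>2 \<omega> = k \<bar> \<theta>1 \<omega> = j) = (1 - \<rho>) * p2 ^ (k - j - 1) * (1 - p2)"
    and X_measurable: "X n \<in> M \<rightarrow>\<^sub>M \<mu>"
    and X_zero: "AE \<omega> in M. X 0 \<omega> = x"
    and X_markov:
      "\<P>(\<omega> in M. \<theta>1 \<omega> = j \<and> \<theta>2 \<omega> = k) \<noteq> 0 \<Longrightarrow> 1 \<le> s \<Longrightarrow> B \<in> sets \<mu> \<Longrightarrow>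
         AE \<omega> in uniform_measure M {\<omega> \<in> space M. \<theta>1 \<omega> = j \<and> \<theta>2 \<omega> = k}.
           real_cond_exp (uniform_measure M {\<omega> \<in> space M. \<theta>1 \<omega> = j \<and> \<theta>2 \<omega> = k})
             (hist M X (enat (s - 1))) (indicator (X s -` B \<inter> space M)) \<omega>
           = (LINT u:B|\<mu>. f (regime j k s) (X (s - 1) \<omega>) u)"

type_synonym posterior = "real \<times> real \<times> real"
type_synonym state = "real \<times> real \<times> posterior"

definition Post :: "'a measure \<Rightarrow> ('a \<Rightarrow> nat) \<Rightarrow> (nat \<Rightarrow> 'a \<Rightarrow> real) \<Rightarrow> nat \<Rightarrow> 'a \<Rightarrow> real" where
  "Post M \<theta> X n = real_cond_exp M (hist M X (enat n)) (indicator {\<omega> \<in> space M. \<theta> \<omega> \<le> n})"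

definition Post12 ::
    "'a measure \<Rightarrow> ('a \<Rightarrow> nat) \<Rightarrow> ('a \<Rightarrow> nat) \<Rightarrow> (nat \<Rightarrow> 'a \<Rightarrow> real) \<Rightarrow> nat \<Rightarrow> 'a \<Rightarrow> real" where
  "Post12 M \<theta>1 \<theta>2 X n = real_cond_exp M (hist M X (enat n))
     (indicator {\<omega> \<in> space M. \<theta>1 \<omega> = \<theta>2 \<omega> \<and> n < \<theta>1 \<omega>})"

text \<open>The process \<open>(X\<^bsub>n-1\<^esub>, X\<^sub>n, \<Pi>\<^sub>n)\<close>, meaningful for \<open>n \<ge> 1\<close>.\<close>

definition \<xi> ::
    "'a measure \<Rightarrow> ('a \<Rightarrow> nat) \<Rightarrow> ('a \<Rightarrow> nat) \<Rightarrow> (nat \<Rightarrow> 'a \<Rightarrow> real) \<Rightarrow> nat \<Rightarrow> 'a \<Rightarrow> state" where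
  "\<xi> M \<theta>1 \<theta>2 X n \<omega> =
     (X (n - 1) \<omega>, X n \<omega>, Post M \<theta>1 X n \<omega>, Post M \<theta>2 X n \<omega>, Post12 M \<theta>1 \<theta>2 X n \<omega>)"

text \<open>
  The payoff \<open>h\<close> takes values in \<open>[-1,1]\<close> on the cube (and in \<open>[0,1]\<close> only where
  \<open>\<beta> \<le> \<alpha>\<close>), hence the range \<open>[-1,1]\<close> here. Off \<open>\<bbbE>\<^sup>2 \<times> [0,1]\<^sup>3\<close> the values are irrelevant, only Borel
  measurability is required.
\<close>

definition payoff_space :: "real set \<Rightarrow> (state \<Rightarrow> real) set" where
  "payoff_space E = {v \<in> borel_measurable borel.
     \<forall>s \<in> E \<times> E \<times> {0..1} \<times> {0..1} \<times> {0..1}. \<bar>v s\<bar> \<le> 1}"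

text \<open>
  A conditional expectation given \<open>X\<^bsub>n-1\<^esub> = y\<close>, \<open>X\<^sub>n = z\<close>, \<open>\<Pi>\<^sub>n = \<alpha>\<close> is determined as a function of
  \<open>(y, z, \<alpha>)\<close> only up to null sets of the laws of the \<open>(X\<^bsub>n-1\<^esub>, X\<^sub>n, \<Pi>\<^sub>n)\<close>; the following predicate
  describes the operators \<open>T\<close> that select a version, common to all \<open>n \<ge> 1\<close>, for every \<open>v\<close>.
\<close>

definition is_T_version :: "'a measure \<Rightarrow> real set \<Rightarrow> (nat \<Rightarrow> 'a \<Rightarrow> state) \<Rightarrow>
    ((state \<Rightarrow> real) \<Rightarrow> state \<Rightarrow> real) \<Rightarrow> bool" where
  "is_T_version M E Z T \<longleftrightarrow> (\<forall>v \<in> payoff_space E. T v \<in> payoff_space E \<and>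
     (\<forall>n\<ge>1. AE \<omega> in M. T v (Z n \<omega>) =
        real_cond_exp M (vimage_algebra (space M) (Z n) borel) (\<lambda>\<omega>. v (Z (n + 1) \<omega>)) \<omega>))"

definition Q_op :: "((state \<Rightarrow> real) \<Rightarrow> state \<Rightarrow> real) \<Rightarrow> (state \<Rightarrow> real) \<Rightarrow> state \<Rightarrow> real" where
  "Q_op T v = (\<lambda>s. max (v s) (T v s))"

fun payoff_h :: "state \<Rightarrow> real" where
  "payoff_h (y, z, \<alpha>, \<beta>, \<gamma>) = \<alpha> - \<beta>"

text \<open>
  The set of values of the a posteriori process: if \<open>(\<alpha>, \<beta>, \<gamma>)\<close> are the probabilities of
  \<open>\<theta>\<^sub>1 \<le> n\<close>, \<open>\<theta>\<^sub>2 \<le> n\<close> and \<open>\<theta>\<^sub>1 = \<theta>\<^sub>2 > n\<close>, then \<open>\<alpha> - \<beta>\<close> and \<open>1 - \<alpha> - \<gamma>\<close> are those of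
  \<open>\<theta>\<^sub>1 \<le> n < \<theta>\<^sub>2\<close> and \<open>n < \<theta>\<^sub>1 < \<theta>\<^sub>2\<close>. On the rest of the cube \<open>Hfun\<close> below may vanish or be negative.
\<close>

definition posterior_domain :: "posterior set" where
  "posterior_domain = {(\<alpha>, \<beta>, \<gamma>). 0 \<le> \<beta> \<and> \<beta> \<le> \<alpha> \<and> 0 \<le> \<gamma> \<and> \<alpha> + \<gamma> \<le> 1}"

context
  fixes \<mu> :: "real measure" and f :: "nat \<Rightarrow> real \<Rightarrow> real \<Rightarrow> real" and p1 p2 :: real
begin

fun Hfun :: "real \<Rightarrow> real \<Rightarrow> posterior \<Rightarrow> real" where
  "Hfun x y (\<alpha>, \<beta>, \<gamma>) =
     (1 - \<alpha>) * p1 * f 0 x y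
     + (p2 * (\<alpha> - \<beta>) + (1 - p1) * (1 - \<alpha> - \<gamma>)) * f 1 x y
     + ((1 - p2) * \<alpha> + p2 * \<beta> + (1 - p1) * \<gamma>) * f 2 x y"

fun Pi_map :: "real \<Rightarrow> real \<Rightarrow> posterior \<Rightarrow> posterior" where
  "Pi_map x y (\<alpha>, \<beta>, \<gamma>) =
     (1 - p1 * (1 - \<alpha>) * f 0 x y / Hfun x y (\<alpha>, \<beta>, \<gamma>),
      ((1 - p2) * \<alpha> + p2 * \<beta> + (1 - p1) * \<gamma>) * f 2 x y / Hfun x y (\<alpha>, \<beta>, \<gamma>),
      p1 * \<gamma> * f 0 x y / Hfun x y (\<alpha>, \<beta>, \<gamma>))"

definition step_int :: "nat \<Rightarrow> (state \<Rightarrow> real) \<Rightarrow> real \<Rightarrow> posterior \<Rightarrow> real" where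
  "step_int i g z a = (\<integral>u. g (z, u, Pi_map z u a) * f i z u \<partial>\<mu>)"

definition stop_set :: "(state \<Rightarrow> real) \<Rightarrow> (state \<Rightarrow> real) \<Rightarrow> state set" where
  "stop_set R S = {(y, z, \<alpha>, \<beta>, \<gamma>). \<alpha> - \<beta> \<ge>
     (1 - \<alpha> - \<gamma>) * (p1 * step_int 0 R z (\<alpha>, \<beta>, \<gamma>) + (1 - p1) * step_int 1 S z (\<alpha>, \<beta>, \<gamma>))
     + (\<alpha> - \<beta>) * p2 * step_int 1 S z (\<alpha>, \<beta>, \<gamma>)}"

text \<open>Indices are shifted by one: \<open>RS n\<close> is the pair \<open>(R\<^sup>k, S\<^sup>k)\<close> with \<open>k = n + 1\<close>.\<close>

primrec RS :: "nat \<Rightarrow> (state \<Rightarrow> real) \<times> (state \<Rightarrow> real)" where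
  "RS 0 = (\<lambda>_. 0, \<lambda>_. 1)"
| "RS (Suc n) = (let (R, S) = RS n; D = stop_set R S in
     (\<lambda>(y, z, a). (1 - indicator D (y, z, a)) *
        (p1 * step_int 0 R z a + (1 - p1) * step_int 1 S z a),
      \<lambda>(y, z, a). indicator D (y, z, a) +
        (1 - indicator D (y, z, a)) * (p2 * step_int 1 S z a)))"

definition R_seq :: "nat \<Rightarrow> state \<Rightarrow> real" where "R_seq n = fst (RS n)"
definition S_seq :: "nat \<Rightarrow> state \<Rightarrow> real" where "S_seq n = snd (RS n)"

definition R_lim :: "state \<Rightarrow> real" where "R_lim s = lim (\<lambda>n. R_seq n s)"
definition S_lim :: "state \<Rightarrow> real" where "S_lim s = lim (\<lambda>n. S_seq n s)"

definition B_star :: "state set" where "B_star = stop_set R_lim S_lim"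

definition V0 :: "real \<Rightarrow> real \<Rightarrow> real \<Rightarrow> real" where
  "V0 \<pi> \<rho> x = (let a = (\<pi>, \<rho> * \<pi>, \<rho> * (1 - \<pi>)) in
     (1 - \<pi>) * (1 - \<rho>) * (p1 * step_int 0 R_lim x a + (1 - p1) * step_int 1 S_lim x a)
     + \<pi> * (1 - \<rho>) * p2 * step_int 1 S_lim x a)"

end

definition first_entry :: "(nat \<Rightarrow> 'a \<Rightarrow> state) \<Rightarrow> state set \<Rightarrow> 'a \<Rightarrow> enat" where
  "first_entry Z B \<omega> = (INF n \<in> {n. 1 \<le> n \<and> Z n \<omega> \<in> B}. enat n)"

text \<open>Nothing is paid if one never stops, in accordance with the event \<open>\<tau> < \<infinity>\<close> in \<open>success_prob\<close>.\<close>

definition expected_payoff ::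
    "'a measure \<Rightarrow> (nat \<Rightarrow> 'a \<Rightarrow> state) \<Rightarrow> (state \<Rightarrow> real) \<Rightarrow> ('a \<Rightarrow> enat) \<Rightarrow> real" where
  "expected_payoff M Z g \<tau> =
     (\<integral>\<omega>. (case \<tau> \<omega> of enat n \<Rightarrow> g (Z n \<omega>) | \<infinity> \<Rightarrow> 0) \<partial>M)"

definition success_prob ::
    "'a measure \<Rightarrow> ('a \<Rightarrow> nat) \<Rightarrow> ('a \<Rightarrow> nat) \<Rightarrow> ('a \<Rightarrow> enat) \<Rightarrow> real" where
  "success_prob M \<theta>1 \<theta>2 \<tau> =
     \<P>(\<omega> in M. \<tau> \<omega> < \<infinity> \<and> enat (\<theta>1 \<omega>) \<le> \<tau> \<omega> \<and> \<tau> \<omega> < enat (\<theta>2 \<omega>))"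

definition is_optimal :: "'b set \<Rightarrow> ('b \<Rightarrow> real) \<Rightarrow> 'b \<Rightarrow> bool" where
  "is_optimal C J \<tau> \<longleftrightarrow> \<tau> \<in> C \<and> (\<forall>\<sigma>\<in>C. J \<sigma> \<le> J \<tau>)"

text \<open>
  Stopping at time 0 succeeds with probability
  \<open>\<^bold>P\<^sub>x(\<theta>\<^sub>1 \<le> 0 < \<theta>\<^sub>2) = h(\<pi>, \<rho>\<pi>, \<rho>(1-\<pi>)) = \<pi>(1-\<rho>)\<close>, and this is the quantity to be compared with \<open>V0\<close>.
  The source prints \<open>p\<^sub>2(1-\<pi>)\<rho>\<close> in its place, which cannot be meant: for \<open>\<rho> = 1\<close> one has
  \<open>\<theta>\<^sub>1 = \<theta>\<^sub>2\<close> almost surely, so the optimal value is 0, but \<open>p\<^sub>2(1-\<pi>)\<rho> > 0\<close> unless \<open>\<pi> = 1\<close>.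
\<close>

definition opt_value :: "'a measure \<Rightarrow> ('a \<Rightarrow> nat) \<Rightarrow> ('a \<Rightarrow> nat) \<Rightarrow> (nat \<Rightarrow> 'a \<Rightarrow> real) \<Rightarrow> real" where
  "opt_value M \<theta>1 \<theta>2 X = (SUP \<tau>\<in>stopping_times M X. success_prob M \<theta>1 \<theta>2 \<tau>)"

end

theory Submission
  imports Defs
begin

text \<open>
  The law of \<open>X\<^sub>0, \<dots>, X\<^sub>n\<close> given \<open>(\<theta>\<^sub>1, \<theta>\<^sub>2)\<close> depends only on the regimes up to time \<open>n\<close>, so the hidden
  state evolves independently of the observed past and Bayes' formula gives the filter
  \<open>\<Pi>\<^sub>n\<^sub>+\<^sub>1 = \<Pi>(X\<^sub>n, X\<^sub>n\<^sub>+\<^sub>1, \<Pi>\<^sub>n)\<close>; hence the state process is Markov. The functions of the form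
  \<open>(1 - \<alpha> - \<gamma>) R + (\<alpha> - \<beta>) S\<close> are stable under \<open>\<^bold>Q\<close>, which turns the iteration of \<open>\<^bold>Q\<close> into the
  recursion for \<open>(R\<^sup>k, S\<^sup>k)\<close>. In the limit this yields \<open>V = max h (\<^bold>T V)\<close>, and \<open>V\<close> stopped at the first
  entry into \<open>{h \<ge> \<^bold>T V}\<close> is a martingale. Since \<open>V \<le> 1 - \<Pi>\<^sup>2\<^sub>n\<close> and \<open>\<theta>\<^sub>2\<close> is finite, nothing is lost at
  infinity, so the first entry time is optimal among stopping times \<open>\<ge> 1\<close>. As \<open>X\<^sub>0\<close> is constant, a
  stopping time is almost surely \<open>0\<close> or almost surely \<open>\<ge> 1\<close>.
\<close>

text \<open>The linear form comes from conditioning on the hidden state. At time n success is still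
  possible only if n < \<theta>1 < \<theta>2, with posterior weight 1 - \<alpha> - \<gamma>, or if
  \<theta>1 \<le> n < \<theta>2, with weight \<alpha> - \<beta>; \<open>R\<close> and
  \<open>S\<close> are the success probabilities of the current rule in these two cases. This is why
  \<gamma> is tracked: it separates off the simultaneous changes, which can never lead to success.
  The new weights multiplied by \<open>Hfun\<close> are multiples of f0 and of f1, so the
  denominator of the filter cancels. It may vanish, but the cyclic ratio condition then forces all
  three densities to vanish as well, and the default value of the quotient does no harm. Increasing
  values do not give convergence of \<open>R\<close> and \<open>S\<close> separately. For these the
  stopping sets are shown to shrink, and \<open>R\<close> is written as a difference of two
  decreasing probabilities. As \<mu> need not be \<sigma>-finite, joint laws are built from the
  transition kernels and compared on rectangles.\<close>

lemma borel_measurable_integral_kernel: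
  fixes g :: "'a \<Rightarrow> 'b \<Rightarrow> real"
  assumes [measurable]: "case_prod g \<in> borel_measurable (N \<Otimes>\<^sub>M L)"
    and K[measurable]: "K \<in> N \<rightarrow>\<^sub>M subprob_algebra L"
  shows "(\<lambda>x. \<integral>u. g x u \<partial>K x) \<in> borel_measurable N"
proof -
  note measurable_distr2[measurable]
  \<comment> \<open>Pushing \<open>K x\<close> forward along the map from y to (x, y) makes the
    integrand the fixed function \<open>case_prod g\<close>, so that only the measure depends on
    x.\<close>
  have "(\<lambda>x. integral\<^sup>L (distr (K x) (N \<Otimes>\<^sub>M L) (\<lambda>y. (x, y))) (case_prod g)) \<in> borel_measurable N"
    by measurable
  then show ?thesis
  proof (rule measurable_cong[THEN iffD1, rotated])
    fix x assume x: "x \<in> space N"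
    have [measurable_cong]: "sets (K x) = sets L"
      using sets_kernel[OF K x] .
    show "integral\<^sup>L (distr (K x) (N \<Otimes>\<^sub>M L) (Pair x)) (case_prod g) = (\<integral>u. g x u \<partial>K x)"
      using x by (subst integral_distr) auto
  qed
qed

lemmas real_measurable = borel_measurable_add borel_measurable_times borel_measurable_diff
  borel_measurable_divide borel_measurable_const

lemma borel_measurable_fst_comp:
  fixes g :: "'a \<Rightarrow> 'b::topological_space \<times> 'c::topological_space"
  assumes "g \<in> borel_measurable N"
  shows "(\<lambda>x. fst (g x)) \<in> borel_measurable N"
  by (rule measurable_compose[OF assms borel_measurable_continuous_onI]) (intro continuous_intros)

lemma borel_measurable_snd_comp:
  fixes g :: "'a \<Rightarrow> 'b::topological_space \<times> 'c::topological_space"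
  assumes "g \<in> borel_measurable N"
  shows "(\<lambda>x. snd (g x)) \<in> borel_measurable N"
  by (rule measurable_compose[OF assms borel_measurable_continuous_onI]) (intro continuous_intros)

section \<open>The recursion for \<open>R\<close> and \<open>S\<close>\<close>

text \<open>The part of the model without a probability space: everything about the recursion is a
  pointwise statement about densities and states.\<close>

locale switching_kernels =
  fixes E :: "real set" and \<mu> :: "real measure" and f :: "nat \<Rightarrow> real \<Rightarrow> real \<Rightarrow> real"
    and p1 p2 :: real
  assumes E_borel: "E \<in> sets borel"
    and sets_mu: "sets \<mu> = sets (restrict_space borel E)"
    and densities: "i < 3 \<Longrightarrow> transition_density \<mu> (f i)"
    and ratio_finite:
      "i < 3 \<Longrightarrow> y \<in> E \<Longrightarrow> z \<in> E \<Longrightarrow>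
         ennreal (f i y z) / ennreal (f ((i + 1) mod 3) y z) < \<infinity>"
    and p1_range: "0 < p1" "p1 < 1"
    and p2_range: "0 < p2" "p2 < 1"
begin

abbreviation "H \<equiv> Hfun f p1 p2"
abbreviation "Pim \<equiv> Pi_map f p1 p2"
abbreviation "stepi \<equiv> step_int \<mu> f p1 p2"
abbreviation "Dset \<equiv> stop_set \<mu> f p1 p2"
abbreviation "Rk \<equiv> R_seq \<mu> f p1 p2"
abbreviation "Sk \<equiv> S_seq \<mu> f p1 p2"
abbreviation "Rl \<equiv> R_lim \<mu> f p1 p2"
abbreviation "Sl \<equiv> S_lim \<mu> f p1 p2"
abbreviation "Bst \<equiv> B_star \<mu> f p1 p2"

text \<open>Turns integrals against \<open>f i z\<close> into expectations under a probability
  measure, where bounded measurable functions are integrable and measurability in the starting point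
  z is available.\<close>

definition K :: "nat \<Rightarrow> real \<Rightarrow> real measure" where
  "K i z = density \<mu> (\<lambda>u. ennreal (f i z u))"

text \<open>The densities are measurable on E only, so functions of the state are measured relative
  to \<mu> in the two observation coordinates.\<close>

definition SM :: "state measure" where
  "SM = \<mu> \<Otimes>\<^sub>M (\<mu> \<Otimes>\<^sub>M borel)"

text \<open>Bounds are claimed here only, since elsewhere the coefficients of \<open>H\<close> may
  be negative. The filter step does not leave the set (\<open>Dom_next\<close>), and the state
  process lies in it almost surely (\<open>Z_dom\<close>).\<close>

definition Dom :: "state set" where
  "Dom = E \<times> E \<times> posterior_domain"

section \<open>Transition kernels and joint measurability\<close>

lemma space_mu [simp]: "space \<mu> = E"
  using sets_eq_imp_space_eq[OF sets_mu] by (simp add: space_restrict_space)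

lemma id_borel_mu: "(\<lambda>x. x) \<in> \<mu> \<rightarrow>\<^sub>M borel"
  by (rule measurableI) (auto simp: sets_mu sets_restrict_space Int_commute)

lemma mu_to_borel: "g \<in> N \<rightarrow>\<^sub>M \<mu> \<Longrightarrow> g \<in> N \<rightarrow>\<^sub>M borel"
  by (rule measurable_compose[OF _ id_borel_mu])

lemma f_nonneg: "i < 3 \<Longrightarrow> z \<in> E \<Longrightarrow> u \<in> E \<Longrightarrow> 0 \<le> f i z u"
  using densities[of i] by (auto simp: transition_density_def)

lemma f_measurable:
  assumes "i < 3" "g \<in> N \<rightarrow>\<^sub>M \<mu>" "h \<in> N \<rightarrow>\<^sub>M \<mu>"
  shows "(\<lambda>x. f i (g x) (h x)) \<in> borel_measurable N"
proof -
  have [measurable]: "case_prod (f i) \<in> borel_measurable (\<mu> \<Otimes>\<^sub>M \<mu>)"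
    using densities[of i] assms by (auto simp: transition_density_def)
  have "(\<lambda>x. case_prod (f i) (g x, h x)) \<in> borel_measurable N"
    using assms(2,3) by measurable
  then show ?thesis by simp
qed

lemma K_prob_algebra: "i < 3 \<Longrightarrow> K i \<in> \<mu> \<rightarrow>\<^sub>M prob_algebra \<mu>"
  using densities[of i] by (auto simp: transition_density_def K_def[abs_def])

lemma K_measurable: "i < 3 \<Longrightarrow> K i \<in> \<mu> \<rightarrow>\<^sub>M subprob_algebra \<mu>"
  using K_prob_algebra measurable_prob_algebraD by blast

lemma sets_K [simp, measurable_cong]: "sets (K i z) = sets \<mu>"
  by (simp add: K_def)

lemma space_K [simp]: "space (K i z) = E"
  by (simp add: K_def)

lemma prob_space_K: "i < 3 \<Longrightarrow> z \<in> E \<Longrightarrow> prob_space (K i z)"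
  using measurable_space[OF K_prob_algebra, of i z] by (simp add: space_prob_algebra)

lemma f_section: "i < 3 \<Longrightarrow> z \<in> E \<Longrightarrow> f i z \<in> borel_measurable \<mu>"
  by (rule f_measurable[of i "\<lambda>_. z" \<mu> "\<lambda>u. u"]) (assumption | rule measurable_const measurable_ident_sets[OF refl] | simp only: space_mu)+

lemma
  fixes g :: "real \<Rightarrow> real"
  assumes "i < 3" "z \<in> E" and g: "g \<in> borel_measurable \<mu>"
  shows integral_K: "(\<integral>u. g u \<partial>K i z) = (\<integral>u. g u * f i z u \<partial>\<mu>)"
    and integrable_K: "integrable (K i z) g \<longleftrightarrow> integrable \<mu> (\<lambda>u. g u * f i z u)"
proof -
  have m: "f i z \<in> borel_measurable \<mu>" using assms f_section by blast
  have ae: "AE u in \<mu>. 0 \<le> f i z u"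
    by (rule AE_I2) (simp add: f_nonneg assms)
  show "(\<integral>u. g u \<partial>K i z) = (\<integral>u. g u * f i z u \<partial>\<mu>)"
    unfolding K_def using integral_density[OF g m ae] by (simp add: mult.commute)
  show "integrable (K i z) g \<longleftrightarrow> integrable \<mu> (\<lambda>u. g u * f i z u)"
    unfolding K_def using integrable_density[OF g m ae] by (simp add: mult.commute)
qed

lemma nn_integral_K:
  assumes "i < 3" "z \<in> E" and [measurable]: "g \<in> borel_measurable \<mu>"
  shows "(\<integral>\<^sup>+u. g u \<partial>K i z) = (\<integral>\<^sup>+u. ennreal (f i z u) * g u \<partial>\<mu>)"
proof -
  have [measurable]: "f i z \<in> borel_measurable \<mu>" using assms f_section by blast
  show ?thesis
    unfolding K_def by (subst nn_integral_density) auto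
qed

lemma Hfun_alt: "H z u a = (1 - fst a) * p1 * f 0 z u
     + (p2 * (fst a - fst (snd a)) + (1 - p1) * (1 - fst a - snd (snd a))) * f 1 z u
     + ((1 - p2) * fst a + p2 * fst (snd a) + (1 - p1) * snd (snd a)) * f 2 z u"
  by (cases a) simp

lemma Pi_map_alt: "Pim z u a = (1 - p1 * (1 - fst a) * f 0 z u / H z u a,
      ((1 - p2) * fst a + p2 * fst (snd a) + (1 - p1) * snd (snd a)) * f 2 z u / H z u a,
      p1 * snd (snd a) * f 0 z u / H z u a)"
  by (cases a) simp

lemma H_measurable:
  assumes "g \<in> N \<rightarrow>\<^sub>M \<mu>" "h \<in> N \<rightarrow>\<^sub>M \<mu>" "k \<in> N \<rightarrow>\<^sub>M borel"
  shows "(\<lambda>x. H (g x) (h x) (k x)) \<in> borel_measurable N"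
  unfolding Hfun_alt
  by (intro real_measurable
      borel_measurable_fst_comp borel_measurable_snd_comp f_measurable assms) simp_all

lemma Pi_measurable:
  assumes "g \<in> N \<rightarrow>\<^sub>M \<mu>" "h \<in> N \<rightarrow>\<^sub>M \<mu>" "k \<in> N \<rightarrow>\<^sub>M borel"
  shows "(\<lambda>x. Pim (g x) (h x) (k x)) \<in> borel_measurable N"
  unfolding Pi_map_alt
  by (intro borel_measurable_Pair real_measurable borel_measurable_fst_comp borel_measurable_snd_comp
      f_measurable H_measurable assms) simp_all

lemma SM_Pair:
  assumes [measurable]: "g \<in> N \<rightarrow>\<^sub>M \<mu>" "h \<in> N \<rightarrow>\<^sub>M \<mu>" "k \<in> N \<rightarrow>\<^sub>M borel"
  shows "(\<lambda>x. (g x, h x, k x)) \<in> N \<rightarrow>\<^sub>M SM"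
  unfolding SM_def by measurable

lemma SM_proj:
  "fst \<in> SM \<rightarrow>\<^sub>M \<mu>" "(\<lambda>s. fst (snd s)) \<in> SM \<rightarrow>\<^sub>M \<mu>" "(\<lambda>s. snd (snd s)) \<in> SM \<rightarrow>\<^sub>M borel"
  unfolding SM_def by measurable

lemma space_SM [simp]: "space SM = E \<times> E \<times> UNIV"
  by (simp add: SM_def space_pair_measure)

lemma SM_comp:
  assumes "v \<in> borel_measurable SM" "g \<in> N \<rightarrow>\<^sub>M \<mu>" "h \<in> N \<rightarrow>\<^sub>M \<mu>" "k \<in> N \<rightarrow>\<^sub>M borel"
  shows "(\<lambda>x. v (g x, h x, k x)) \<in> borel_measurable N"
  using measurable_compose[OF SM_Pair[OF assms(2-4)] assms(1)] .

lemma section_measurable: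
  assumes v: "v \<in> borel_measurable SM" "z \<in> E"
  shows "(\<lambda>u. v (z, u, Pim z u a)) \<in> borel_measurable \<mu>"
  using assms by (intro SM_comp[OF v(1)] Pi_measurable measurable_const measurable_ident_sets) auto

lemma step_int_K:
  assumes "i < 3" "z \<in> E" "g \<in> borel_measurable SM"
  shows "stepi i g z a = (\<integral>u. g (z, u, Pim z u a) \<partial>K i z)"
  using assms integral_K[OF assms(1,2) section_measurable[OF assms(3,2)]]
  by (simp add: step_int_def)

lemma step_int_measurable:
  assumes i: "i < 3" and g[measurable]: "g \<in> borel_measurable SM"
  shows "(\<lambda>s. stepi i g (fst (snd s)) (snd (snd s))) \<in> borel_measurable SM"
proof -
  have "(\<lambda>s. \<integral>u. g (fst (snd s), u, Pim (fst (snd s)) u (snd (snd s))) \<partial>K i (fst (snd s)))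
     \<in> borel_measurable SM"
  proof (rule borel_measurable_integral_kernel)
    show "(\<lambda>s. K i (fst (snd s))) \<in> SM \<rightarrow>\<^sub>M subprob_algebra \<mu>"
      by (rule measurable_compose[OF SM_proj(2) K_measurable[OF i]])
    show "(\<lambda>(s, u). g (fst (snd s), u, Pim (fst (snd s)) u (snd (snd s))))
       \<in> borel_measurable (SM \<Otimes>\<^sub>M \<mu>)"
      unfolding split_beta'
      by (intro SM_comp[OF g] Pi_measurable measurable_snd
          measurable_compose[OF measurable_fst SM_proj(2)] measurable_compose[OF measurable_fst SM_proj(3)])
  qed
  then show ?thesis
    by (rule measurable_cong[THEN iffD1, rotated]) (auto simp: step_int_K i)
qed

section \<open>The filter step: predicted weights and Bayes' formula\<close>

definition c0 :: "posterior \<Rightarrow> real" where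
  "c0 a = (1 - fst a) * p1"
definition c1 :: "posterior \<Rightarrow> real" where
  "c1 a = p2 * (fst a - fst (snd a)) + (1 - p1) * (1 - fst a - snd (snd a))"
definition c2 :: "posterior \<Rightarrow> real" where
  "c2 a = (1 - p2) * fst a + p2 * fst (snd a) + (1 - p1) * snd (snd a)"

text \<open>If a is the posterior at time n, then \<open>c0\<close>, \<open>c1\<close>,
  \<open>c2\<close> are the probabilities of no change, one change and both changes by time n + 1.
  Hence \<open>H\<close> is the predictive density of the next observation.\<close>

lemma H_eq: "H z u a = c0 a * f 0 z u + c1 a * f 1 z u + c2 a * f 2 z u"
  by (simp add: Hfun_alt c0_def c1_def c2_def)

lemma c_nonneg:
  assumes "a \<in> posterior_domain"
  shows "0 \<le> c0 a" "0 \<le> c1 a" "0 \<le> c2 a"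
  using assms p1_range p2_range
  by (auto simp: posterior_domain_def c0_def c1_def c2_def)

lemma c_sum: "c0 a + c1 a + c2 a = 1"
  by (simp add: c0_def c1_def c2_def algebra_simps)

lemma f_pos_next:
  assumes "i < 3" "z \<in> E" "u \<in> E" "0 < f i z u"
  shows "0 < f ((i + 1) mod 3) z u"
proof (rule ccontr)
  assume "\<not> 0 < f ((i + 1) mod 3) z u"
  then have "ennreal (f ((i + 1) mod 3) z u) = 0"
    by (simp add: ennreal_neg)
  with ratio_finite[OF assms(1-3)] assms(4) show False
    by (simp add: ennreal_divide_eq_top_iff less_top[symmetric])
qed

text \<open>A positive numerator with finite ratio forces a positive denominator. Going once round
  the cycle 0, 1, 2, 0 shows that the three densities have the same zeros.\<close>

lemma f_pos_iff:
  assumes "z \<in> E" "u \<in> E"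
  shows "0 < f 1 z u \<longleftrightarrow> 0 < f 0 z u" "0 < f 2 z u \<longleftrightarrow> 0 < f 0 z u"
  using f_pos_next[of 0 z u] f_pos_next[of 1 z u] f_pos_next[of 2 z u] assms by (auto simp: numeral_2_eq_2)

lemma H_nonneg:
  assumes "a \<in> posterior_domain" "z \<in> E" "u \<in> E"
  shows "0 \<le> H z u a"
  unfolding H_eq using c_nonneg[OF assms(1)] f_nonneg assms by (intro add_nonneg_nonneg mult_nonneg_nonneg) auto

text \<open>If one density were positive, all three would be; a vanishing combination with
  nonnegative coefficients would then have only zero coefficients, but these sum to 1.\<close>

lemma H_zero:
  assumes a: "a \<in> posterior_domain" and zu: "z \<in> E" "u \<in> E" and H: "H z u a = 0" and i: "i < 3"
  shows "f i z u = 0"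
proof (rule ccontr)
  assume "f i z u \<noteq> 0"
  with f_nonneg[OF i zu] have "0 < f i z u" by simp
  with f_pos_iff[OF zu] i have p: "0 < f 0 z u" "0 < f 1 z u" "0 < f 2 z u"
    by (auto simp: less_Suc_eq numeral_eq_Suc)
  have "c0 a * f 0 z u = 0 \<and> c1 a * f 1 z u = 0 \<and> c2 a * f 2 z u = 0"
    using H c_nonneg[OF a] p unfolding H_eq
    by (smt (verit) mult_nonneg_nonneg)
  with p have "c0 a + c1 a + c2 a = 0" by simp
  with c_sum[of a] show False by simp
qed

lemma Pi_eq: "Pim z u a = (1 - c0 a * f 0 z u / H z u a, c2 a * f 2 z u / H z u a,
    p1 * snd (snd a) * f 0 z u / H z u a)"
  by (simp add: Pi_map_alt c0_def c2_def mult.commute)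

text \<open>Bayes' formula with the denominator cleared. Where \<open>H\<close> vanishes, the
  right-hand sides vanish by \<open>H_zero\<close>, so the identities hold without exception. The
  last one is what remains of \<open>H\<close> after the parts for no change and both changes are
  taken away.\<close>

lemma
  assumes a: "(\<alpha>, \<beta>, \<gamma>) \<in> posterior_domain" and zu: "z \<in> E" "u \<in> E"
    and P: "Pim z u (\<alpha>, \<beta>, \<gamma>) = (\<alpha>', \<beta>', \<gamma>')"
  shows Pi_H0: "(1 - \<alpha>') * H z u (\<alpha>, \<beta>, \<gamma>) = p1 * (1 - \<alpha>) * f 0 z u"
    and Pi_H2: "\<beta>' * H z u (\<alpha>, \<beta>, \<gamma>) = c2 (\<alpha>, \<beta>, \<gamma>) * f 2 z u"
    and Pi_H12: "\<gamma>' * H z u (\<alpha>, \<beta>, \<gamma>) = p1 * \<gamma> * f 0 z u"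
    and Pi_H1: "(\<alpha>' - \<beta>') * H z u (\<alpha>, \<beta>, \<gamma>) = c1 (\<alpha>, \<beta>, \<gamma>) * f 1 z u"
proof -
  let ?a = "(\<alpha>, \<beta>, \<gamma>)"
  have z: "f 0 z u = 0 \<and> f 1 z u = 0 \<and> f 2 z u = 0" if "H z u ?a = 0"
    using H_zero[OF a zu that] by simp
  have e: "\<alpha>' = 1 - c0 ?a * f 0 z u / H z u ?a" "\<beta>' = c2 ?a * f 2 z u / H z u ?a"
    "\<gamma>' = p1 * \<gamma> * f 0 z u / H z u ?a"
    using P unfolding Pi_eq by simp_all
  show 0: "(1 - \<alpha>') * H z u ?a = p1 * (1 - \<alpha>) * f 0 z u"
    using z unfolding e by (cases "H z u ?a = 0") (simp_all del: Hfun.simps add: c0_def)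
  show 2: "\<beta>' * H z u ?a = c2 ?a * f 2 z u"
    using z unfolding e by (cases "H z u ?a = 0") (simp_all del: Hfun.simps)
  show "\<gamma>' * H z u ?a = p1 * \<gamma> * f 0 z u"
    using z unfolding e by (cases "H z u ?a = 0") (simp_all del: Hfun.simps)
  have "(\<alpha>' - \<beta>') * H z u ?a = H z u ?a - (1 - \<alpha>') * H z u ?a - \<beta>' * H z u ?a"
    by (simp add: algebra_simps del: Hfun.simps)
  then show "(\<alpha>' - \<beta>') * H z u ?a = c1 ?a * f 1 z u"
    unfolding 0 2 unfolding H_eq by (simp add: c0_def)
qed

text \<open>Each inequality that defines the domain becomes, after multiplication by
  \<open>H\<close>, the nonnegativity of a weight times a density.\<close>

lemma Pi_dom:
  assumes a: "a \<in> posterior_domain" and zu: "z \<in> E" "u \<in> E"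
  shows "Pim z u a \<in> posterior_domain"
proof (cases "H z u a = 0")
  \<comment> \<open>Division by zero yields the posterior (1, 0, 0), which lies in the
    domain.\<close>
  case True
  then show ?thesis by (simp add: Pi_eq posterior_domain_def)
next
  case False
  obtain \<alpha> \<beta> \<gamma> where aa: "a = (\<alpha>, \<beta>, \<gamma>)" by (cases a)
  obtain \<alpha>' \<beta>' \<gamma>' where P: "Pim z u a = (\<alpha>', \<beta>', \<gamma>')" by (cases "Pim z u a")
  have H: "0 < H z u a" using False H_nonneg[OF assms] by simp
  note r = Pi_H0[OF a[unfolded aa] zu P[unfolded aa], folded aa] Pi_H2[OF a[unfolded aa] zu P[unfolded aa], folded aa]
    Pi_H12[OF a[unfolded aa] zu P[unfolded aa], folded aa] Pi_H1[OF a[unfolded aa] zu P[unfolded aa], folded aa]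
  have f: "0 \<le> f 0 z u" "0 \<le> f 1 z u" "0 \<le> f 2 z u" using f_nonneg zu by auto
  have "0 \<le> \<beta>' * H z u a" "0 \<le> \<gamma>' * H z u a" "0 \<le> (\<alpha>' - \<beta>') * H z u a"
    unfolding r using c_nonneg[OF a] f p1_range a by (auto simp: posterior_domain_def aa)
  moreover have "(1 - \<alpha>' - \<gamma>') * H z u a = p1 * (1 - \<alpha> - \<gamma>) * f 0 z u"
    using r by (simp add: algebra_simps)
  moreover have "0 \<le> p1 * (1 - \<alpha> - \<gamma>) * f 0 z u"
    using f p1_range a by (auto simp: posterior_domain_def aa)
  ultimately have "0 \<le> \<beta>' * H z u a" "0 \<le> \<gamma>' * H z u a" "0 \<le> (\<alpha>' - \<beta>') * H z u a"
    "0 \<le> (1 - \<alpha>' - \<gamma>') * H z u a" by simp_all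
  then show ?thesis
    using H by (auto simp: P posterior_domain_def zero_le_mult_iff)
qed

lemma dom_cube: "a \<in> posterior_domain \<Longrightarrow> a \<in> {0..1} \<times> {0..1} \<times> {0..1}"
  by (auto simp: posterior_domain_def)

lemma Dom_next: "(y, z, a) \<in> Dom \<Longrightarrow> u \<in> E \<Longrightarrow> (z, u, Pim z u a) \<in> Dom"
  by (auto simp: Dom_def Pi_dom)

section \<open>One-step integrals: integrability, bounds, order\<close>

lemma integrable_step:
  fixes g :: "state \<Rightarrow> real"
  assumes s: "(y, z, a) \<in> Dom" and g: "g \<in> borel_measurable SM" "\<And>s. s \<in> Dom \<Longrightarrow> \<bar>g s\<bar> \<le> 1" and i: "i < 3"
  shows "integrable (K i z) (\<lambda>u. g (z, u, Pim z u a))"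
proof -
  have z: "z \<in> E" using s by (auto simp: Dom_def)
  interpret K: prob_space "K i z" by (rule prob_space_K[OF i z])
  show ?thesis
  proof (rule K.integrable_const_bound[where B=1])
    show "(\<lambda>u. g (z, u, Pim z u a)) \<in> borel_measurable (K i z)"
      using section_measurable[OF g(1) z, of a] by (simp add: measurable_cong_sets[OF sets_K refl])
    show "AE u in K i z. norm (g (z, u, Pim z u a)) \<le> 1"
      using g(2)[OF Dom_next[OF s]] by (intro AE_I2) simp
  qed
qed

lemma integrable_step_mu:
  fixes g :: "state \<Rightarrow> real"
  assumes s: "(y, z, a) \<in> Dom" and g: "g \<in> borel_measurable SM" "\<And>s. s \<in> Dom \<Longrightarrow> \<bar>g s\<bar> \<le> 1" and i: "i < 3"
  shows "integrable \<mu> (\<lambda>u. g (z, u, Pim z u a) * f i z u)"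
  using integrable_step[OF assms] integrable_K[OF i _ section_measurable[OF g(1)]] s
  by (auto simp: Dom_def)

lemma step_int_bounds:
  fixes g :: "state \<Rightarrow> real"
  assumes s: "(y, z, a) \<in> Dom" and g: "g \<in> borel_measurable SM" "\<And>s. s \<in> Dom \<Longrightarrow> 0 \<le> g s \<and> g s \<le> 1"
    and i: "i < 3"
  shows "0 \<le> stepi i g z a" "stepi i g z a \<le> 1"
proof -
  have z: "z \<in> E" using s by (auto simp: Dom_def)
  interpret K: prob_space "K i z" by (rule prob_space_K[OF i z])
  have int: "integrable (K i z) (\<lambda>u. g (z, u, Pim z u a))"
    using g by (intro integrable_step[OF s] i) (auto simp: abs_le_iff intro: order_trans)
  have b: "0 \<le> g (z, u, Pim z u a) \<and> g (z, u, Pim z u a) \<le> 1" if "u \<in> E" for u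
    using g(2)[OF Dom_next[OF s that]] .
  show "0 \<le> stepi i g z a"
    unfolding step_int_K[OF i z g(1)] using b by (intro integral_nonneg_AE AE_I2) simp
  show "stepi i g z a \<le> 1"
    unfolding step_int_K[OF i z g(1)] using b int by (intro K.integral_le_const AE_I2) simp_all
qed

lemma step_int_mono:
  fixes g h :: "state \<Rightarrow> real"
  assumes s: "(y, z, a) \<in> Dom" and i: "i < 3"
    and g: "g \<in> borel_measurable SM" "\<And>s. s \<in> Dom \<Longrightarrow> \<bar>g s\<bar> \<le> 1"
    and h: "h \<in> borel_measurable SM" "\<And>s. s \<in> Dom \<Longrightarrow> \<bar>h s\<bar> \<le> 1"
    and le: "\<And>s. s \<in> Dom \<Longrightarrow> g s \<le> h s"
  shows "stepi i g z a \<le> stepi i h z a"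
proof -
  have z: "z \<in> E" using s by (auto simp: Dom_def)
  show ?thesis
    unfolding step_int_K[OF i z g(1)] step_int_K[OF i z h(1)]
    using integrable_step[OF s g i] integrable_step[OF s h i] le[OF Dom_next[OF s]]
    by (intro integral_mono) simp_all
qed

lemma step_int_add:
  fixes g h :: "state \<Rightarrow> real"
  assumes s: "(y, z, a) \<in> Dom" and i: "i < 3"
    and g: "g \<in> borel_measurable SM" "\<And>s. s \<in> Dom \<Longrightarrow> \<bar>g s\<bar> \<le> 1"
    and h: "h \<in> borel_measurable SM" "\<And>s. s \<in> Dom \<Longrightarrow> \<bar>h s\<bar> \<le> 1"
  shows "stepi i (\<lambda>s. g s + h s) z a = stepi i g z a + stepi i h z a"
  using integrable_step_mu[OF s g i] integrable_step_mu[OF s h i]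
  by (simp add: step_int_def distrib_right)

section \<open>Continuation values and the linear form\<close>

definition cont :: "(state \<Rightarrow> real) \<Rightarrow> (state \<Rightarrow> real) \<Rightarrow> state \<Rightarrow> real" where
  "cont R S = (\<lambda>(y, z, \<alpha>, \<beta>, \<gamma>).
     (1 - \<alpha> - \<gamma>) * (p1 * stepi 0 R z (\<alpha>, \<beta>, \<gamma>) + (1 - p1) * stepi 1 S z (\<alpha>, \<beta>, \<gamma>))
     + (\<alpha> - \<beta>) * p2 * stepi 1 S z (\<alpha>, \<beta>, \<gamma>))"

text \<open>Total probability over the two hidden situations in which success is still possible; the
  other two, both changes past or a simultaneous change ahead, contribute zero.\<close>

definition val :: "(state \<Rightarrow> real) \<Rightarrow> (state \<Rightarrow> real) \<Rightarrow> state \<Rightarrow> real" where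
  "val R S = (\<lambda>s. case s of (y, z, \<alpha>, \<beta>, \<gamma>) \<Rightarrow> (1 - \<alpha> - \<gamma>) * R s + (\<alpha> - \<beta>) * S s)"

text \<open>A pointwise version of the operator T, written as a mixture of three expectations so
  that each can be handled under a probability kernel. \<open>Tc_eq\<close> gives the form with the
  predictive density.\<close>

definition Tc :: "(state \<Rightarrow> real) \<Rightarrow> state \<Rightarrow> real" where
  "Tc v = (\<lambda>(y, z, a). c0 a * stepi 0 v z a + c1 a * stepi 1 v z a + c2 a * stepi 2 v z a)"

lemma mem_stop_set: "s \<in> Dset R S \<longleftrightarrow> cont R S s \<le> payoff_h s"
  by (cases s) (simp add: stop_set_def cont_def)

lemma SM_coords:
  "(\<lambda>s. fst (snd (snd s))) \<in> borel_measurable SM"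
  "(\<lambda>s. fst (snd (snd (snd s)))) \<in> borel_measurable SM"
  "(\<lambda>s. snd (snd (snd (snd s)))) \<in> borel_measurable SM"
  by (intro borel_measurable_fst_comp borel_measurable_snd_comp SM_proj)+

lemma val_measurable:
  assumes "R \<in> borel_measurable SM" "S \<in> borel_measurable SM"
  shows "val R S \<in> borel_measurable SM"
proof -
  have "val R S = (\<lambda>s. (1 - fst (snd (snd s)) - snd (snd (snd (snd s)))) * R s
      + (fst (snd (snd s)) - fst (snd (snd (snd s)))) * S s)"
    by (auto simp: val_def)
  then show ?thesis
    by (auto intro!: real_measurable
        SM_coords assms)
qed

lemma val_abs:
  assumes s: "s \<in> Dom" and "\<bar>R s\<bar> \<le> 1" "\<bar>S s\<bar> \<le> 1"
  shows "\<bar>val R S s\<bar> \<le> 1"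
proof -
  obtain y z \<alpha> \<beta> \<gamma> where sa: "s = (y, z, \<alpha>, \<beta>, \<gamma>)" by (cases s)
  have d: "0 \<le> 1 - \<alpha> - \<gamma>" "0 \<le> \<alpha> - \<beta>" "0 \<le> \<gamma>" "0 \<le> \<beta>"
    using s by (auto simp: sa Dom_def posterior_domain_def)
  have "\<bar>val R S s\<bar> \<le> (1 - \<alpha> - \<gamma>) * \<bar>R s\<bar> + (\<alpha> - \<beta>) * \<bar>S s\<bar>"
    using d abs_triangle_ineq[of "(1 - \<alpha> - \<gamma>) * R s" "(\<alpha> - \<beta>) * S s"]
    by (simp add: sa val_def abs_mult)
  also have "\<dots> \<le> (1 - \<alpha> - \<gamma>) * 1 + (\<alpha> - \<beta>) * 1"
    using d assms(2,3) by (intro add_mono mult_left_mono)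
  finally show ?thesis using d by simp
qed

lemma integrable_Tc:
  fixes v :: "state \<Rightarrow> real"
  assumes s: "(y, z, a) \<in> Dom" and v: "v \<in> borel_measurable SM" "\<And>s. s \<in> Dom \<Longrightarrow> \<bar>v s\<bar> \<le> 1"
  shows "integrable \<mu> (\<lambda>u. v (z, u, Pim z u a) * H z u a)"
proof -
  have "integrable \<mu> (\<lambda>u. c0 a * (v (z, u, Pim z u a) * f 0 z u) + c1 a * (v (z, u, Pim z u a) * f 1 z u)
      + c2 a * (v (z, u, Pim z u a) * f 2 z u))"
    by (intro Bochner_Integration.integrable_add integrable_mult_right integrable_step_mu[OF s v]) simp_all
  then show ?thesis by (simp add: H_eq algebra_simps)
qed

lemma Tc_eq:
  fixes v :: "state \<Rightarrow> real"
  assumes s: "(y, z, a) \<in> Dom" and v: "v \<in> borel_measurable SM" "\<And>s. s \<in> Dom \<Longrightarrow> \<bar>v s\<bar> \<le> 1"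
  shows "Tc v (y, z, a) = (\<integral>u. v (z, u, Pim z u a) * H z u a \<partial>\<mu>)"
proof -
  have "(\<integral>u. v (z, u, Pim z u a) * H z u a \<partial>\<mu>) = (\<integral>u. c0 a * (v (z, u, Pim z u a) * f 0 z u)
      + c1 a * (v (z, u, Pim z u a) * f 1 z u) + c2 a * (v (z, u, Pim z u a) * f 2 z u) \<partial>\<mu>)"
    unfolding H_eq by (intro Bochner_Integration.integral_cong refl) (simp add: algebra_simps)
  also have "\<dots> = Tc v (y, z, a)"
    using integrable_step_mu[OF s v, of 0] integrable_step_mu[OF s v, of 1] integrable_step_mu[OF s v, of 2]
    by (simp add: Tc_def step_int_def)
  finally show ?thesis ..
qed

lemma Tc_measurable:
  assumes "v \<in> borel_measurable SM"
  shows "Tc v \<in> borel_measurable SM"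
proof -
  have "Tc v = (\<lambda>s. c0 (snd (snd s)) * stepi 0 v (fst (snd s)) (snd (snd s))
      + c1 (snd (snd s)) * stepi 1 v (fst (snd s)) (snd (snd s))
      + c2 (snd (snd s)) * stepi 2 v (fst (snd s)) (snd (snd s)))"
    by (auto simp: Tc_def)
  then show ?thesis
    unfolding c0_def c1_def c2_def
    by (simp only:) (intro real_measurable SM_coords step_int_measurable assms; simp)
qed

lemma Tc_mono:
  fixes g h :: "state \<Rightarrow> real"
  assumes s: "s \<in> Dom"
    and g: "g \<in> borel_measurable SM" "\<And>s. s \<in> Dom \<Longrightarrow> \<bar>g s\<bar> \<le> 1"
    and h: "h \<in> borel_measurable SM" "\<And>s. s \<in> Dom \<Longrightarrow> \<bar>h s\<bar> \<le> 1"
    and le: "\<And>s. s \<in> Dom \<Longrightarrow> g s \<le> h s"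
  shows "Tc g s \<le> Tc h s"
proof -
  obtain y z a where sa: "s = (y, z, a)" by (cases s)
  note s = s[unfolded sa]
  have az: "a \<in> posterior_domain" "z \<in> E" using s by (auto simp: Dom_def)
  have eqs: "Tc g s = (\<integral>u. g (z, u, Pim z u a) * H z u a \<partial>\<mu>)"
    "Tc h s = (\<integral>u. h (z, u, Pim z u a) * H z u a \<partial>\<mu>)"
    unfolding sa by (rule Tc_eq[OF s g]; assumption) (rule Tc_eq[OF s h])
  show ?thesis
    unfolding eqs using az
    by (intro integral_mono integrable_Tc[OF s g] integrable_Tc[OF s h] mult_right_mono)
       (auto intro!: le Dom_next[OF s] H_nonneg)
qed

lemma Tc_one: "s \<in> Dom \<Longrightarrow> Tc (\<lambda>_. 1) s = 1"
proof -
  assume s': "s \<in> Dom"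
  obtain y z a where sa: "s = (y, z, a)" by (cases s)
  note s = s'[unfolded sa]
  then have z: "z \<in> E" by (auto simp: Dom_def)
  have i: "integrable \<mu> (f i z)" "(\<integral>u. f i z u \<partial>\<mu>) = 1" if "i < 3" for i
  proof -
    interpret K: prob_space "K i z" by (rule prob_space_K[OF that z])
    show "integrable \<mu> (f i z)" using integrable_K[OF that z, of "\<lambda>_. 1"] by simp
    show "(\<integral>u. f i z u \<partial>\<mu>) = 1" using integral_K[OF that z, of "\<lambda>_. 1"] K.prob_space by simp
  qed
  show ?thesis
    unfolding Tc_def sa using c_sum[of a] by (simp add: step_int_def i)
qed

lemma Tc_abs_le:
  fixes g :: "state \<Rightarrow> real"
  assumes s: "s \<in> Dom" and g: "g \<in> borel_measurable SM" "\<And>s. s \<in> Dom \<Longrightarrow> \<bar>g s\<bar> \<le> 1"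
  shows "\<bar>Tc g s\<bar> \<le> 1"
proof -
  have m: "(\<lambda>s. - g s) \<in> borel_measurable SM" using g by measurable
  have n: "Tc (\<lambda>s. - g s) s = - Tc g s" by (cases s) (simp add: Tc_def step_int_def algebra_simps)
  have "Tc g s \<le> Tc (\<lambda>_. 1) s" by (rule Tc_mono[OF s g]) (use g(2) in \<open>auto simp: abs_le_iff\<close>)
  moreover have "Tc (\<lambda>s. - g s) s \<le> Tc (\<lambda>_. 1) s"
    by (rule Tc_mono[OF s m]) (use g(2) in \<open>auto simp: abs_le_iff\<close>)
  ultimately show ?thesis using n Tc_one[OF s] by simp
qed

text \<open>The factor 1 - \<alpha> - \<gamma> of the new posterior times \<open>H\<close> is p1 (1
  - \<alpha> - \<gamma>) f0 in terms of the old one, and the factor \<alpha> - \<beta> times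
  \<open>H\<close> is \<open>c1\<close> times f1. So \<open>R\<close> is integrated against f0 only
  and \<open>S\<close> against f1 only, and sorting by the old weights gives
  \<open>cont\<close>.\<close>

lemma Tc_val:
  fixes R S :: "state \<Rightarrow> real"
  assumes s: "s \<in> Dom"
    and R: "R \<in> borel_measurable SM" "\<And>s. s \<in> Dom \<Longrightarrow> \<bar>R s\<bar> \<le> 1"
    and S: "S \<in> borel_measurable SM" "\<And>s. s \<in> Dom \<Longrightarrow> \<bar>S s\<bar> \<le> 1"
  shows "Tc (val R S) s = cont R S s"
proof -
  obtain y z \<alpha> \<beta> \<gamma> where sa: "s = (y, z, \<alpha>, \<beta>, \<gamma>)" by (cases s)
  let ?a = "(\<alpha>, \<beta>, \<gamma>)"
  note s = s[unfolded sa]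
  have a: "?a \<in> posterior_domain" and z: "z \<in> E" using s by (auto simp: Dom_def)
  have aux: "x * r * h = k * (r * f)" if "x * h = k * f" for x r h k f :: real
  proof -
    have "x * r * h = (x * h) * r" by (simp add: mult.commute mult.left_commute)
    also have "\<dots> = k * (r * f)" unfolding that by (simp add: mult.commute mult.left_commute)
    finally show ?thesis .
  qed
  have "Tc (val R S) s = (\<integral>u. p1 * (1 - \<alpha> - \<gamma>) * (R (z, u, Pim z u ?a) * f 0 z u)
      + c1 ?a * (S (z, u, Pim z u ?a) * f 1 z u) \<partial>\<mu>)"
    unfolding sa
  proof (subst Tc_eq[OF s val_measurable[OF R(1) S(1)] val_abs[OF _ R(2) S(2)]], assumption+,
      rule Bochner_Integration.integral_cong[OF refl])
    fix u assume "u \<in> space \<mu>"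
    then have u: "u \<in> E" by simp
    obtain \<alpha>' \<beta>' \<gamma>' where P: "Pim z u ?a = (\<alpha>', \<beta>', \<gamma>')" by (cases "Pim z u ?a")
    note r = Pi_H0[OF a z u P] Pi_H12[OF a z u P] Pi_H1[OF a z u P]
    have "(1 - \<alpha>' - \<gamma>') * H z u ?a = p1 * (1 - \<alpha> - \<gamma>) * f 0 z u"
      using r by (simp add: algebra_simps del: Hfun.simps)
    then have "((1 - \<alpha>' - \<gamma>') * R (z, u, Pim z u ?a)) * H z u ?a =
      p1 * (1 - \<alpha> - \<gamma>) * (R (z, u, Pim z u ?a) * f 0 z u)"
      by (intro aux)
    moreover have "((\<alpha>' - \<beta>') * S (z, u, Pim z u ?a)) * H z u ?a = c1 ?a * (S (z, u, Pim z u ?a) * f 1 z u)"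
      using r(3) by (intro aux)
    ultimately show "val R S (z, u, Pim z u ?a) * H z u ?a =
      p1 * (1 - \<alpha> - \<gamma>) * (R (z, u, Pim z u ?a) * f 0 z u) + c1 ?a * (S (z, u, Pim z u ?a) * f 1 z u)"
      by (simp only: val_def P prod.case distrib_right)
  qed
  also have "\<dots> = p1 * (1 - \<alpha> - \<gamma>) * stepi 0 R z ?a + c1 ?a * stepi 1 S z ?a"
    unfolding step_int_def
    by (subst Bochner_Integration.integral_add)
       (auto intro!: integrable_mult_right integrable_step_mu[OF s] R S simp del: Hfun.simps Pi_map.simps)
  also have "\<dots> = cont R S s"
    by (simp add: sa cont_def c1_def algebra_simps)
  finally show ?thesis .
qed

section \<open>The recursion for finite horizons\<close>

lemma Rk_Suc: "Rk (Suc n) (y, z, a) = (1 - indicator (Dset (Rk n) (Sk n)) (y, z, a)) *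
    (p1 * stepi 0 (Rk n) z a + (1 - p1) * stepi 1 (Sk n) z a)"
  by (simp add: R_seq_def S_seq_def Let_def split_beta)

lemma Sk_Suc: "Sk (Suc n) (y, z, a) = indicator (Dset (Rk n) (Sk n)) (y, z, a) +
    (1 - indicator (Dset (Rk n) (Sk n)) (y, z, a)) * (p2 * stepi 1 (Sk n) z a)"
  by (simp add: R_seq_def S_seq_def Let_def split_beta)

lemma Rk_0: "Rk 0 s = 0" and Sk_0: "Sk 0 s = 1"
  by (simp_all add: R_seq_def S_seq_def)

text \<open>
  \<open>Wk k\<close> is the probability that, when \<open>\<theta>\<^sub>1\<close> has not yet occurred, the rule with horizon \<open>k\<close> stops
  before \<open>\<theta>\<^sub>1\<close>. Unlike \<open>Rk\<close> itself, both \<open>Wk\<close> and \<open>Rk + Wk\<close> are monotone in \<open>k\<close>.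
\<close>

primrec Wk :: "nat \<Rightarrow> state \<Rightarrow> real" where
  "Wk 0 = (\<lambda>_. 1)"
| "Wk (Suc n) = (\<lambda>(y, z, a). indicator (Dset (Rk n) (Sk n)) (y, z, a) +
    (1 - indicator (Dset (Rk n) (Sk n)) (y, z, a)) * (p1 * stepi 0 (Wk n) z a))"

lemma payoff_h_alt: "payoff_h s = fst (snd (snd s)) - fst (snd (snd (snd s)))"
  by (cases s) simp

lemma payoff_h_measurable: "payoff_h \<in> borel_measurable SM"
  unfolding payoff_h_alt[abs_def] by (intro borel_measurable_diff SM_coords)

lemma cont_measurable:
  assumes "R \<in> borel_measurable SM" "S \<in> borel_measurable SM"
  shows "cont R S \<in> borel_measurable SM"
proof -
  have "cont R S = (\<lambda>s. (1 - fst (snd (snd s)) - snd (snd (snd (snd s)))) *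
      (p1 * stepi 0 R (fst (snd s)) (snd (snd s)) + (1 - p1) * stepi 1 S (fst (snd s)) (snd (snd s)))
      + (fst (snd (snd s)) - fst (snd (snd (snd s)))) * p2 * stepi 1 S (fst (snd s)) (snd (snd s)))"
    by (auto simp: cont_def)
  then show ?thesis
    by (auto intro!: real_measurable
        SM_coords step_int_measurable assms)
qed

lemma stop_set_measurable:
  assumes "R \<in> borel_measurable SM" "S \<in> borel_measurable SM"
  shows "indicator (Dset R S) \<in> borel_measurable SM"
    and "{s \<in> space SM. s \<in> Dset R S} \<in> sets SM"
proof -
  show *: "{s \<in> space SM. s \<in> Dset R S} \<in> sets SM"
    unfolding mem_stop_set
    by (rule borel_measurable_le[OF cont_measurable[OF assms] payoff_h_measurable])
  show "indicator (Dset R S) \<in> borel_measurable SM"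
    by (rule measurable_cong[THEN iffD1, OF _ borel_measurable_indicator[OF *]]) (simp add: indicator_def)
qed

lemma seq_measurable:
  "Rk n \<in> borel_measurable SM" "Sk n \<in> borel_measurable SM" "Wk n \<in> borel_measurable SM"
proof (induction n)
  case 0
  have "Rk 0 = (\<lambda>_. 0)" "Sk 0 = (\<lambda>_. 1)" by (simp_all add: fun_eq_iff Rk_0 Sk_0)
  then show "Rk 0 \<in> borel_measurable SM" "Sk 0 \<in> borel_measurable SM" "Wk 0 \<in> borel_measurable SM"
    by simp_all
next
  case (Suc n)
  have i: "indicator (Dset (Rk n) (Sk n)) \<in> borel_measurable SM"
    by (rule stop_set_measurable Suc)+
  have "Rk (Suc n) = (\<lambda>s. (1 - indicator (Dset (Rk n) (Sk n)) s) *
    (p1 * stepi 0 (Rk n) (fst (snd s)) (snd (snd s)) + (1 - p1) * stepi 1 (Sk n) (fst (snd s)) (snd (snd s))))"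
    by (rule ext) (metis Rk_Suc prod.collapse)
  then show "Rk (Suc n) \<in> borel_measurable SM"
    by (auto intro!: real_measurable
        step_int_measurable Suc i)
  have "Sk (Suc n) = (\<lambda>s. indicator (Dset (Rk n) (Sk n)) s +
    (1 - indicator (Dset (Rk n) (Sk n)) s) * (p2 * stepi 1 (Sk n) (fst (snd s)) (snd (snd s))))"
    by (rule ext) (metis Sk_Suc prod.collapse)
  then show "Sk (Suc n) \<in> borel_measurable SM"
    by (auto intro!: real_measurable
        step_int_measurable Suc i)
  have "Wk (Suc n) = (\<lambda>s. indicator (Dset (Rk n) (Sk n)) s +
    (1 - indicator (Dset (Rk n) (Sk n)) s) * (p1 * stepi 0 (Wk n) (fst (snd s)) (snd (snd s))))"
    by auto
  then show "Wk (Suc n) \<in> borel_measurable SM"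
    by (auto intro!: real_measurable
        step_int_measurable Suc i)
qed

text \<open>Success and stopping before \<theta>1 are disjoint events, so \<open>Rk\<close> and
  \<open>Wk\<close> are bounded jointly; \<open>seq_antimono\<close> relies on this joint
  bound.\<close>

lemma seq_bounds:
  assumes "s \<in> Dom"
  shows "0 \<le> Rk n s \<and> 0 \<le> Wk n s \<and> Rk n s + Wk n s \<le> 1 \<and> 0 \<le> Sk n s \<and> Sk n s \<le> 1"
  using assms
proof (induction n arbitrary: s)
  case 0
  then show ?case by (simp add: Rk_0 Sk_0)
next
  case (Suc n)
  obtain y z a where sa: "s = (y, z, a)" by (cases s)
  note s = Suc.prems[unfolded sa]
  note m = seq_measurable[of n]
  have mU: "(\<lambda>s. Rk n s + Wk n s) \<in> borel_measurable SM" using m by measurable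
  have bR: "0 \<le> Rk n s \<and> Rk n s \<le> 1" and bW: "0 \<le> Wk n s \<and> Wk n s \<le> 1"
    and bU: "0 \<le> Rk n s + Wk n s \<and> Rk n s + Wk n s \<le> 1" and bS: "0 \<le> Sk n s \<and> Sk n s \<le> 1"
    if "s \<in> Dom" for s
    using Suc.IH[OF that] by auto
  have r: "0 \<le> stepi 0 (Rk n) z a" and w: "0 \<le> stepi 0 (Wk n) z a"
    and u: "stepi 0 (\<lambda>s. Rk n s + Wk n s) z a \<le> 1"
    and ss: "0 \<le> stepi 1 (Sk n) z a" "stepi 1 (Sk n) z a \<le> 1"
    by (auto intro!: step_int_bounds[OF s] m mU bR bW bS bU)
  have add: "stepi 0 (\<lambda>s. Rk n s + Wk n s) z a = stepi 0 (Rk n) z a + stepi 0 (Wk n) z a"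
    using bR bW by (intro step_int_add[OF s]) (auto intro!: m)
  have "p2 * stepi 1 (Sk n) z a \<le> 1" "0 \<le> p2 * stepi 1 (Sk n) z a"
    using ss p2_range by (auto simp: mult_le_one)
  moreover have "p1 * (stepi 0 (Rk n) z a + stepi 0 (Wk n) z a) + (1 - p1) * stepi 1 (Sk n) z a \<le> p1 * 1 + (1 - p1) * 1"
    using u[unfolded add] ss p1_range by (intro add_mono mult_left_mono) auto
  moreover have "0 \<le> p1 * stepi 0 (Rk n) z a + (1 - p1) * stepi 1 (Sk n) z a" "0 \<le> p1 * stepi 0 (Wk n) z a"
    using r w ss p1_range by auto
  ultimately show ?case
    unfolding sa Rk_Suc Sk_Suc Wk.simps prod.case
    by (cases "(y, z, a) \<in> Dset (Rk n) (Sk n)") (simp_all add: algebra_simps)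
qed

lemma seq_abs:
  assumes "s \<in> Dom"
  shows "\<bar>Rk n s\<bar> \<le> 1" "\<bar>Sk n s\<bar> \<le> 1" "\<bar>Wk n s\<bar> \<le> 1" "\<bar>Rk n s + Wk n s\<bar> \<le> 1"
  using seq_bounds[OF assms, of n] by auto

text \<open>On the stopping set the new pair is (0, 1), which gives the payoff \<alpha> - \<beta>;
  off it the new pair reproduces \<open>cont\<close>. As the stopping set is defined by comparing
  precisely these two numbers, the result is their maximum.\<close>

lemma val_Suc: "val (Rk (Suc n)) (Sk (Suc n)) s = max (payoff_h s) (cont (Rk n) (Sk n) s)"
proof -
  obtain y z \<alpha> \<beta> \<gamma> where sa: "s = (y, z, \<alpha>, \<beta>, \<gamma>)" by (cases s)
  show ?thesis
  proof (cases "s \<in> Dset (Rk n) (Sk n)")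
    case True
    then show ?thesis
      by (simp add: sa val_def Rk_Suc Sk_Suc) (simp add: mem_stop_set max_def)
  next
    case False
    then have "val (Rk (Suc n)) (Sk (Suc n)) s = cont (Rk n) (Sk n) s"
      by (simp add: sa val_def Rk_Suc Sk_Suc cont_def)
    with False show ?thesis by (simp add: mem_stop_set max_def)
  qed
qed

text \<open>Success at or after time n requires n < \<theta>2, whose posterior probability is 1 -
  \<beta>. This bound makes the value vanish at infinity in \<open>VZ_tail\<close>.\<close>

lemma val_bounds:
  assumes s: "(y, z, \<alpha>, \<beta>, \<gamma>) \<in> Dom"
    and "0 \<le> R (y, z, \<alpha>, \<beta>, \<gamma>)" "R (y, z, \<alpha>, \<beta>, \<gamma>) \<le> 1" "0 \<le> S (y, z, \<alpha>, \<beta>, \<gamma>)" "S (y, z, \<alpha>, \<beta>, \<gamma>) \<le> 1"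
  shows "0 \<le> val R S (y, z, \<alpha>, \<beta>, \<gamma>)" "val R S (y, z, \<alpha>, \<beta>, \<gamma>) \<le> 1 - \<beta>"
proof -
  have d: "0 \<le> 1 - \<alpha> - \<gamma>" "0 \<le> \<alpha> - \<beta>" "0 \<le> \<gamma>" using s by (auto simp: Dom_def posterior_domain_def)
  then show "0 \<le> val R S (y, z, \<alpha>, \<beta>, \<gamma>)" using assms by (simp add: val_def)
  have "val R S (y, z, \<alpha>, \<beta>, \<gamma>) \<le> (1 - \<alpha> - \<gamma>) * 1 + (\<alpha> - \<beta>) * 1"
    unfolding val_def prod.case using d assms by (intro add_mono mult_left_mono)
  also have "\<dots> \<le> 1 - \<beta>" using d by simp
  finally show "val R S (y, z, \<alpha>, \<beta>, \<gamma>) \<le> 1 - \<beta>" .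
qed

lemma val_seq:
  "val (Rk n) (Sk n) \<in> borel_measurable SM" "s \<in> Dom \<Longrightarrow> \<bar>val (Rk n) (Sk n) s\<bar> \<le> 1"
  by (auto intro!: val_measurable seq_measurable val_abs seq_abs)

lemma val_0: "val (Rk 0) (Sk 0) s = payoff_h s"
  by (cases s) (simp add: val_def Rk_0 Sk_0)

lemma cont_eq_Tc: "s \<in> Dom \<Longrightarrow> cont (Rk n) (Sk n) s = Tc (val (Rk n) (Sk n)) s"
  using Tc_val[of s "Rk n" "Sk n"] seq_measurable seq_abs by simp

text \<open>A longer horizon cannot be worse: the iteration starts at the payoff, which is below any
  maximum with it, and \<open>Tc\<close> preserves the order.\<close>

lemma val_mono: "s \<in> Dom \<Longrightarrow> val (Rk n) (Sk n) s \<le> val (Rk (Suc n)) (Sk (Suc n)) s"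
proof (induction n arbitrary: s)
  case 0
  then show ?case by (simp add: val_0 val_Suc)
next
  case (Suc n)
  have "cont (Rk n) (Sk n) s \<le> cont (Rk (Suc n)) (Sk (Suc n)) s"
    unfolding cont_eq_Tc[OF Suc.prems]
    by (rule Tc_mono[OF Suc.prems val_seq(1) val_seq(2) val_seq(1) val_seq(2) Suc.IH])
  then show ?case unfolding val_Suc by simp
qed

lemma stop_set_antimono:
  assumes "s \<in> Dom" "s \<in> Dset (Rk (Suc n)) (Sk (Suc n))"
  shows "s \<in> Dset (Rk n) (Sk n)"
proof -
  have "cont (Rk n) (Sk n) s \<le> cont (Rk (Suc n)) (Sk (Suc n)) s"
    unfolding cont_eq_Tc[OF assms(1)]
    by (rule Tc_mono[OF assms(1) val_seq(1) val_seq(2) val_seq(1) val_seq(2) val_mono])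
  then show ?thesis using assms(2) by (simp add: mem_stop_set)
qed

text \<open>A longer horizon shrinks the stopping set, so one stops later. \<open>Wk\<close> is the
  probability of stopping before \<theta>1 when both changes lie ahead and are distinct;
  \<open>Rk + Wk\<close> in that case, and \<open>Sk\<close> when only \<theta>2 lies ahead, are
  probabilities of stopping before \<theta>2. All three can only fall.\<close>

lemma seq_antimono:
  assumes "s \<in> Dom"
  shows "Sk (Suc n) s \<le> Sk n s \<and> Wk (Suc n) s \<le> Wk n s \<and> Rk (Suc n) s + Wk (Suc n) s \<le> Rk n s + Wk n s"
  using assms
proof (induction n arbitrary: s)
  case 0
  then show ?case using seq_bounds[OF 0, of 1] by (simp add: Rk_0 Sk_0)
next
  case (Suc n)
  obtain y z a where sa: "s = (y, z, a)" by (cases s)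
  note s = Suc.prems[unfolded sa]
  show ?case
  proof (cases "s \<in> Dset (Rk n) (Sk n)")
    case True
    \<comment> \<open>Stopping at once gives all three quantities their largest possible value, so
      the general bounds for the next index suffice.\<close>
    then have "Sk (Suc n) s = 1" "Wk (Suc n) s = 1" "Rk (Suc n) s = 0"
      by (simp_all add: sa Rk_Suc Sk_Suc)
    then show ?thesis using seq_bounds[OF Suc.prems, of "Suc (Suc n)"] by simp
  next
    case False
    then have F: "s \<notin> Dset (Rk (Suc n)) (Sk (Suc n))"
      using stop_set_antimono[OF Suc.prems] by blast
    let ?U = "\<lambda>n s. Rk n s + Wk n s"
    have mU: "?U n \<in> borel_measurable SM" for n
      using seq_measurable[of n] by measurable
    have S: "stepi 1 (Sk (Suc n)) z a \<le> stepi 1 (Sk n) z a"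
      by (rule step_int_mono[OF s _ seq_measurable(2) seq_abs(2) seq_measurable(2) seq_abs(2)]) (auto simp: Suc.IH)
    have W: "stepi 0 (Wk (Suc n)) z a \<le> stepi 0 (Wk n) z a"
      by (rule step_int_mono[OF s _ seq_measurable(3) seq_abs(3) seq_measurable(3) seq_abs(3)])
         (auto simp: Suc.IH simp del: Wk.simps)
    have "stepi 0 (?U (Suc n)) z a \<le> stepi 0 (?U n) z a"
      by (rule step_int_mono[OF s _ mU seq_abs(4) mU seq_abs(4)]) (auto simp: Suc.IH simp del: Wk.simps)
    moreover have "stepi 0 (?U n) z a = stepi 0 (Rk n) z a + stepi 0 (Wk n) z a" for n
      by (rule step_int_add[OF s _ seq_measurable(1) seq_abs(1) seq_measurable(3) seq_abs(3)]) simp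
    ultimately have U: "stepi 0 (Rk (Suc n)) z a + stepi 0 (Wk (Suc n)) z a \<le> stepi 0 (Rk n) z a + stepi 0 (Wk n) z a"
      by metis
    have R1: "Rk (Suc n) s = p1 * stepi 0 (Rk n) z a + (1 - p1) * stepi 1 (Sk n) z a"
       "Sk (Suc n) s = p2 * stepi 1 (Sk n) z a" "Wk (Suc n) s = p1 * stepi 0 (Wk n) z a"
      using False by (simp_all add: sa Rk_Suc Sk_Suc)
    have R2: "Rk (Suc (Suc n)) s = p1 * stepi 0 (Rk (Suc n)) z a + (1 - p1) * stepi 1 (Sk (Suc n)) z a"
       "Sk (Suc (Suc n)) s = p2 * stepi 1 (Sk (Suc n)) z a" "Wk (Suc (Suc n)) s = p1 * stepi 0 (Wk (Suc n)) z a"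
      using F unfolding sa Rk_Suc[of "Suc n"] Sk_Suc[of "Suc n"] Wk.simps(2)[of "Suc n"] by simp_all
    have "p1 * (stepi 0 (Rk (Suc n)) z a + stepi 0 (Wk (Suc n)) z a) \<le> p1 * (stepi 0 (Rk n) z a + stepi 0 (Wk n) z a)"
      using U p1_range by (intro mult_left_mono) auto
    moreover have "(1 - p1) * stepi 1 (Sk (Suc n)) z a \<le> (1 - p1) * stepi 1 (Sk n) z a"
      using S p1_range by (intro mult_left_mono) auto
    moreover have "p1 * stepi 0 (Wk (Suc n)) z a \<le> p1 * stepi 0 (Wk n) z a"
      using W p1_range by (intro mult_left_mono) auto
    moreover have "p2 * stepi 1 (Sk (Suc n)) z a \<le> p2 * stepi 1 (Sk n) z a"
      using S p2_range by (intro mult_left_mono) auto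
    ultimately show ?thesis
      unfolding R1 R2 distrib_left by linarith
  qed
qed

section \<open>Limits of the recursion and the value function\<close>

lemma seq_convergent:
  assumes s: "s \<in> Dom"
  shows "convergent (\<lambda>n. Rk n s)" "convergent (\<lambda>n. Sk n s)"
proof -
  have dec: "convergent f" if "\<And>n. f (Suc n) \<le> f n" "\<And>n. 0 \<le> f n" for f :: "nat \<Rightarrow> real"
    using decseq_convergent[of f 0] that unfolding decseq_Suc_iff convergent_def by metis
  show "convergent (\<lambda>n. Sk n s)"
    using seq_antimono[OF s] seq_bounds[OF s] by (intro dec) auto
  \<comment> \<open>Both terms of this difference are decreasing and nonnegative, although their
    difference need not be monotone.\<close>
  have "convergent (\<lambda>n. (Rk n s + Wk n s) - Wk n s)"
    using seq_antimono[OF s] seq_bounds[OF s] by (intro convergent_diff dec) (auto simp del: Wk.simps)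
  then show "convergent (\<lambda>n. Rk n s)" by simp
qed

lemma lim_LIMSEQ:
  assumes "s \<in> Dom"
  shows "(\<lambda>n. Rk n s) \<longlonglongrightarrow> Rl s" "(\<lambda>n. Sk n s) \<longlonglongrightarrow> Sl s"
  using seq_convergent[OF assms] by (simp_all add: R_lim_def S_lim_def convergent_LIMSEQ_iff)

text \<open>Off \<open>Dom\<close> the sequences may diverge; the limit operator is measurable there
  too, with its default value.\<close>

lemma lim_measurable: "Rl \<in> borel_measurable SM" "Sl \<in> borel_measurable SM"
  unfolding R_lim_def[abs_def] S_lim_def[abs_def]
  by (intro borel_measurable_lim_metric seq_measurable)+

lemma lim_bounds:
  assumes "s \<in> Dom"
  shows "0 \<le> Rl s" "Rl s \<le> 1" "0 \<le> Sl s" "Sl s \<le> 1"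
proof -
  have b: "0 \<le> Rk n s" "Rk n s \<le> 1" "0 \<le> Sk n s" "Sk n s \<le> 1" for n
    using seq_bounds[OF assms, of n] by auto
  show "0 \<le> Rl s" "Rl s \<le> 1" "0 \<le> Sl s" "Sl s \<le> 1"
    using LIMSEQ_le_const[OF lim_LIMSEQ(1)[OF assms]] LIMSEQ_le_const2[OF lim_LIMSEQ(1)[OF assms]]
      LIMSEQ_le_const[OF lim_LIMSEQ(2)[OF assms]] LIMSEQ_le_const2[OF lim_LIMSEQ(2)[OF assms]] b
    by blast+
qed

lemma step_int_LIMSEQ:
  fixes g :: "nat \<Rightarrow> state \<Rightarrow> real"
  assumes s: "(y, z, a) \<in> Dom" and i: "i < 3"
    and g: "\<And>n. g n \<in> borel_measurable SM" "\<And>n s. s \<in> Dom \<Longrightarrow> \<bar>g n s\<bar> \<le> 1"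
    and h: "h \<in> borel_measurable SM" "\<And>s. s \<in> Dom \<Longrightarrow> (\<lambda>n. g n s) \<longlonglongrightarrow> h s"
  shows "(\<lambda>n. stepi i (g n) z a) \<longlonglongrightarrow> stepi i h z a"
proof -
  have z: "z \<in> E" using s by (auto simp: Dom_def)
  interpret K: prob_space "K i z" by (rule prob_space_K[OF i z])
  have sm: "(\<lambda>u. v (z, u, Pim z u a)) \<in> borel_measurable (K i z)" if "v \<in> borel_measurable SM"
    for v :: "state \<Rightarrow> real"
    using section_measurable[OF that z, of a] by (simp add: measurable_cong_sets[OF sets_K refl])
  show ?thesis
    unfolding step_int_K[OF i z g(1)] step_int_K[OF i z h(1)]
    using g(2)[OF Dom_next[OF s]] h(2)[OF Dom_next[OF s]]
    by (intro integral_dominated_convergence[where w="\<lambda>_. 1"] sm g(1) h(1) AE_I2) auto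
qed

definition Vf :: "state \<Rightarrow> real" where "Vf = val Rl Sl"

lemma Vf_measurable: "Vf \<in> borel_measurable SM"
  unfolding Vf_def by (intro val_measurable lim_measurable)

lemma Vf_abs: "s \<in> Dom \<Longrightarrow> \<bar>Vf s\<bar> \<le> 1"
  unfolding Vf_def using lim_bounds[of s] by (intro val_abs) auto

lemma Vf_bounds: "(y, z, \<alpha>, \<beta>, \<gamma>) \<in> Dom \<Longrightarrow> 0 \<le> Vf (y, z, \<alpha>, \<beta>, \<gamma>) \<and> Vf (y, z, \<alpha>, \<beta>, \<gamma>) \<le> 1 - \<beta>"
  unfolding Vf_def by (intro conjI val_bounds lim_bounds)

lemma cont_lim_eq_Tc: "s \<in> Dom \<Longrightarrow> cont Rl Sl s = Tc Vf s"
  unfolding Vf_def using lim_measurable lim_bounds by (intro Tc_val[symmetric]) auto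

text \<open>\<open>val_Suc\<close> in the limit: the shifted values converge to \<open>Vf\<close>,
  the continuation values converge by dominated convergence, and the maximum is continuous.\<close>

lemma Vf_eq_max:
  assumes "s \<in> Dom"
  shows "Vf s = max (payoff_h s) (cont Rl Sl s)"
proof -
  obtain y z \<alpha> \<beta> \<gamma> where sa: "s = (y, z, \<alpha>, \<beta>, \<gamma>)" by (cases s)
  note s = assms[unfolded sa]
  have c: "(\<lambda>n. cont (Rk n) (Sk n) s) \<longlonglongrightarrow> cont Rl Sl s"
    unfolding sa cont_def prod.case
    by (intro tendsto_intros step_int_LIMSEQ[OF s] seq_measurable seq_abs lim_measurable lim_LIMSEQ) auto
  have v: "(\<lambda>n. val (Rk n) (Sk n) s) \<longlonglongrightarrow> Vf s"
    unfolding sa Vf_def val_def prod.case by (intro tendsto_intros lim_LIMSEQ s)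
  have "(\<lambda>n. val (Rk (Suc n)) (Sk (Suc n)) s) \<longlonglongrightarrow> max (payoff_h s) (cont Rl Sl s)"
    unfolding val_Suc by (intro tendsto_intros c)
  then show ?thesis using LIMSEQ_Suc[OF v] LIMSEQ_unique by blast
qed

lemma mem_B_star: "s \<in> Bst \<longleftrightarrow> cont Rl Sl s \<le> payoff_h s"
  by (simp add: B_star_def mem_stop_set)

lemma B_star_measurable: "{s \<in> space SM. s \<in> Bst} \<in> sets SM"
  unfolding B_star_def by (intro stop_set_measurable lim_measurable)

end

section \<open>Disintegration along a kernel\<close>

text \<open>Meant for measures weighted by indicators of hidden events: these weights are not
  measurable for the observed history F, but the integrands are.\<close>

lemma nn_integral_eq_subalgebra:
  assumes F1: "subalgebra M1 F" and F2: "subalgebra M2 F"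
    and eq: "\<And>A. A \<in> sets F \<Longrightarrow> emeasure M1 A = emeasure M2 A"
    and g: "g \<in> borel_measurable F"
  shows "(\<integral>\<^sup>+x. g x \<partial>M1) = (\<integral>\<^sup>+x. g x \<partial>M2)"
proof -
  have "restr_to_subalg M1 F = restr_to_subalg M2 F"
    by (rule measure_eqI)
       (simp_all add: sets_restr_to_subalg F1 F2 emeasure_restr_to_subalg eq)
  then show ?thesis
    using nn_integral_subalgebra2[OF F1 g] nn_integral_subalgebra2[OF F2 g] by simp
qed

lemma subalgebra_ident: "subalgebra M F \<Longrightarrow> (\<lambda>x. x) \<in> M \<rightarrow>\<^sub>M F"
  by (rule measurable_from_subalg) (auto intro: measurable_ident_sets)

text \<open>Both sides are integrals of \<open>G\<close> with respect to measures on the product of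
  F and N. The hypothesis says that these agree on rectangles, an intersection-stable generator
  containing the whole space, which has finite mass.\<close>

lemma kernel_disintegration:
  assumes F1: "subalgebra M1 F" and F2: "subalgebra M2 F"
    and fin: "finite_measure M1" and ne: "space F \<noteq> {}"
    and Y: "Y \<in> M1 \<rightarrow>\<^sub>M N" and L: "L \<in> F \<rightarrow>\<^sub>M subprob_algebra N"
    and rect: "\<And>A B. A \<in> sets F \<Longrightarrow> B \<in> sets N \<Longrightarrow>
      emeasure M1 (A \<inter> Y -` B) = (\<integral>\<^sup>+x\<in>A. emeasure (L x) B \<partial>M2)"
    and G: "G \<in> borel_measurable (F \<Otimes>\<^sub>M N)"
  shows "(\<integral>\<^sup>+x. G (x, Y x) \<partial>M1) = (\<integral>\<^sup>+x. \<integral>\<^sup>+u. G (x, u) \<partial>L x \<partial>M2)"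
proof -
  define P where "P = F \<Otimes>\<^sub>M N"
  have pY: "(\<lambda>x. (x, Y x)) \<in> M1 \<rightarrow>\<^sub>M P"
    unfolding P_def by (intro measurable_Pair subalgebra_ident F1 Y)
  have id2: "(\<lambda>x. x) \<in> M2 \<rightarrow>\<^sub>M F" by (rule subalgebra_ident[OF F2])
  have L2: "(\<lambda>x. distr (L x) P (Pair x)) \<in> F \<rightarrow>\<^sub>M subprob_algebra P"
    by (rule measurable_distr2[OF _ L]) (simp add: P_def measurable_ident_sets)
  define N1 where "N1 = distr M1 P (\<lambda>x. (x, Y x))"
  \<comment> \<open>The kernel is measurable for F only, so the mixture is taken over the
    restriction of \<open>M2\<close> to F.\<close>
  define N2 where "N2 = bind (restr_to_subalg M2 F) (\<lambda>x. distr (L x) P (Pair x))"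
  have sp2: "space (restr_to_subalg M2 F) \<noteq> {}"
    using ne F2 by (simp add: space_restr_to_subalg subalgebra_def)
  have L2': "(\<lambda>x. distr (L x) P (Pair x)) \<in> restr_to_subalg M2 F \<rightarrow>\<^sub>M subprob_algebra P"
    using L2 by (simp add: measurable_cong_sets[OF sets_restr_to_subalg[OF F2] refl])
  have i1: "(\<integral>\<^sup>+p. g p \<partial>N1) = (\<integral>\<^sup>+x. g (x, Y x) \<partial>M1)" if "g \<in> borel_measurable P" for g
    unfolding N1_def using that by (intro nn_integral_distr[OF pY]) simp
  have i2: "(\<integral>\<^sup>+p. g p \<partial>N2) = (\<integral>\<^sup>+x. \<integral>\<^sup>+u. g (x, u) \<partial>L x \<partial>M2)" if g: "g \<in> borel_measurable P" for g
  proof -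
    have "(\<integral>\<^sup>+p. g p \<partial>N2) = (\<integral>\<^sup>+x. \<integral>\<^sup>+p. g p \<partial>distr (L x) P (Pair x) \<partial>restr_to_subalg M2 F)"
      unfolding N2_def by (rule nn_integral_bind[OF g L2'])
    also have "\<dots> = (\<integral>\<^sup>+x. \<integral>\<^sup>+u. g (x, u) \<partial>L x \<partial>restr_to_subalg M2 F)"
    proof (rule nn_integral_cong)
      fix x assume "x \<in> space (restr_to_subalg M2 F)"
      then have x: "x \<in> space F" using F2 by (simp add: space_restr_to_subalg subalgebra_def)
      have "Pair x \<in> L x \<rightarrow>\<^sub>M P"
        unfolding measurable_cong_sets[OF sets_kernel[OF L x] refl] P_def
        using x by (intro measurable_Pair1')
      then show "(\<integral>\<^sup>+p. g p \<partial>distr (L x) P (Pair x)) = (\<integral>\<^sup>+u. g (x, u) \<partial>L x)"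
        by (rule nn_integral_distr) (simp add: g)
    qed
    also have "\<dots> = (\<integral>\<^sup>+x. \<integral>\<^sup>+u. g (x, u) \<partial>L x \<partial>M2)"
    proof (rule nn_integral_subalgebra2[OF F2])
      show "(\<lambda>x. \<integral>\<^sup>+u. g (x, u) \<partial>L x) \<in> borel_measurable F"
        by (rule nn_integral_measurable_subprob_algebra2[OF _ L]) (use g in \<open>simp add: P_def\<close>)
    qed
    finally show ?thesis .
  qed
  have "N1 = N2"
  proof (rule measure_eqI_generator_eq[where E="{A \<times> B | A B. A \<in> sets F \<and> B \<in> sets N}"
        and \<Omega>="space F \<times> space N" and A="\<lambda>_. space F \<times> space N"])
    show "Int_stable {A \<times> B |A B. A \<in> sets F \<and> B \<in> sets N}"
      by (rule Int_stable_pair_measure_generator)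
    show "{A \<times> B |A B. A \<in> sets F \<and> B \<in> sets N} \<subseteq> Pow (space F \<times> space N)"
      using sets.sets_into_space[of _ F] sets.sets_into_space[of _ N] by blast
    show "sets N1 = sigma_sets (space F \<times> space N) {A \<times> B |A B. A \<in> sets F \<and> B \<in> sets N}"
      by (simp add: N1_def P_def sets_pair_measure)
    have "sets N2 = sets P"
      unfolding N2_def by (rule sets_bind[OF _ sp2]) (use L2' in \<open>auto dest: sets_kernel\<close>)
    then show "sets N2 = sigma_sets (space F \<times> space N) {A \<times> B |A B. A \<in> sets F \<and> B \<in> sets N}"
      by (simp add: P_def sets_pair_measure)
    show "range (\<lambda>_. space F \<times> space N) \<subseteq> {A \<times> B |A B. A \<in> sets F \<and> B \<in> sets N}" by auto
    show "emeasure N1 (space F \<times> space N) \<noteq> \<infinity>" for i :: nat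
    proof -
      interpret finite_measure M1 by fact
      have "emeasure N1 (space F \<times> space N) = emeasure M1 ((\<lambda>x. (x, Y x)) -` (space F \<times> space N) \<inter> space M1)"
        unfolding N1_def by (rule emeasure_distr[OF pY]) (simp add: P_def)
      then show ?thesis by simp
    qed
    fix D assume "D \<in> {A \<times> B |A B. A \<in> sets F \<and> B \<in> sets N}"
    then obtain A B where D: "D = A \<times> B" and A: "A \<in> sets F" and B: "B \<in> sets N" by auto
    have DP: "D \<in> sets P" using A B by (simp add: D P_def)
    have As: "A \<subseteq> space M1" using sets.sets_into_space[OF A] F1 by (simp add: subalgebra_def)
    have "emeasure N1 D = emeasure M1 ((\<lambda>x. (x, Y x)) -` D \<inter> space M1)"
      unfolding N1_def by (rule emeasure_distr[OF pY DP])
    also have "(\<lambda>x. (x, Y x)) -` D \<inter> space M1 = A \<inter> Y -` B"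
      using As by (auto simp: D)
    also have "emeasure M1 (A \<inter> Y -` B) = (\<integral>\<^sup>+x. \<integral>\<^sup>+u. indicator D (x, u) \<partial>L x \<partial>M2)"
      unfolding rect[OF A B]
    proof (rule nn_integral_cong)
      fix x assume "x \<in> space M2"
      then have x: "x \<in> space F" using F2 by (simp add: subalgebra_def)
      have B': "B \<in> sets (L x)" using B sets_kernel[OF L x] by simp
      have "(\<integral>\<^sup>+u. indicator D (x, u) \<partial>L x) = (\<integral>\<^sup>+u. indicator A x * indicator B u \<partial>L x)"
        by (simp add: D indicator_times)
      also have "\<dots> = indicator A x * emeasure (L x) B"
        using B' by (simp add: nn_integral_cmult)
      finally show "emeasure (L x) B * indicator A x = (\<integral>\<^sup>+u. indicator D (x, u) \<partial>L x)"
        by (simp add: mult.commute)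
    qed
    also have "\<dots> = emeasure N2 D"
      using i2[of "indicator D"] DP \<open>sets N2 = sets P\<close> by simp
    finally show "emeasure N1 D = emeasure N2 D" .
  qed simp
  then show ?thesis using i1[of G] i2[of G] G by (simp add: P_def)
qed

text \<open>Preimages split into countably many level sets. This is how a statement about one value
  of the hidden pair passes to sets of values.\<close>

lemma emeasure_eq_countable:
  fixes g :: "'a \<Rightarrow> 'b::countable"
  assumes g: "g \<in> M \<rightarrow>\<^sub>M count_space UNIV" and s: "sets M1 = sets M" "sets M2 = sets M"
    and eq: "\<And>b. b \<in> D \<Longrightarrow> emeasure M1 (g -` {b} \<inter> space M) = emeasure M2 (g -` {b} \<inter> space M)"
  shows "emeasure M1 (g -` D \<inter> space M) = emeasure M2 (g -` D \<inter> space M)"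
proof -
  have U: "g -` D \<inter> space M = (\<Union>b\<in>D. g -` {b} \<inter> space M)" by auto
  have m: "g -` {b} \<inter> space M \<in> sets M" for b
    by (rule measurable_sets[OF g]) simp
  have d: "disjoint_family_on (\<lambda>b. g -` {b} \<inter> space M) D"
    by (auto simp: disjoint_family_on_def)
  have "emeasure N (g -` D \<inter> space M) = (\<integral>\<^sup>+b. emeasure N (g -` {b} \<inter> space M) \<partial>count_space D)"
    if "sets N = sets M" for N
    unfolding U by (rule emeasure_UN_countable[OF _ _ d]) (use m that in \<open>auto\<close>)
  then show ?thesis
    using s eq by (simp cong: nn_integral_cong_simp)
qed

section \<open>Observed and hidden states\<close>

sublocale switching_model \<subseteq> kern?: switching_kernels E \<mu> f p1 p2
  by (unfold_locales; (rule E_borel sets_mu densities ratio_finite p1_range p2_range; assumption?))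

context switching_model begin

section \<open>The observed history\<close>

abbreviation "F n \<equiv> hist M X (enat n)"
abbreviation "FX n \<equiv> F n \<Otimes>\<^sub>M \<mu>"

lemma space_hist [simp]: "space (hist M X t) = space M"
  unfolding hist_def by (rule space_measure_of) auto

lemma sets_hist: "sets (hist M X t) = sigma_sets (space M) {X i -` B \<inter> space M | i B. enat i \<le> t \<and> B \<in> sets borel}"
  unfolding hist_def by (rule sets_measure_of) auto

lemma X_borel: "X i \<in> borel_measurable M"
  by (rule mu_to_borel[OF X_measurable])

lemma X_in_E: "\<omega> \<in> space M \<Longrightarrow> X i \<omega> \<in> E"
  using measurable_space[OF X_measurable] by simp

lemma subalgebra_hist: "subalgebra M (hist M X t)"
  unfolding subalgebra_def
proof
  show "sets (hist M X t) \<subseteq> sets M"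
    unfolding sets_hist by (rule sets.sigma_sets_subset) (auto intro: measurable_sets[OF X_borel])
qed simp

lemma hist_mono: "s \<le> t \<Longrightarrow> sets (hist M X s) \<subseteq> sets (hist M X t)"
  unfolding sets_hist by (rule sigma_sets_mono') (auto intro: order_trans)

lemma sub_hist: "i \<le> j \<Longrightarrow> subalgebra (F j) (F i)"
  using hist_mono[of "enat i" "enat j"] by (simp add: subalgebra_def)

lemma sets_mu_borel: "B \<in> sets \<mu> \<Longrightarrow> B \<in> sets borel"
  using E_borel by (auto simp: sets_mu sets_restrict_space)

lemma X_hist:
  assumes "i \<le> n"
  shows "X i \<in> F n \<rightarrow>\<^sub>M \<mu>"
proof (rule measurableI)
  fix B assume "B \<in> sets \<mu>"
  then have "X i -` B \<inter> space M \<in> {X i -` B \<inter> space M | i B. enat i \<le> enat n \<and> B \<in> sets borel}"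
    using assms sets_mu_borel by auto
  then show "X i -` B \<inter> space (F n) \<in> sets (F n)"
    unfolding sets_hist by simp
qed (simp add: X_in_E)

text \<open>Such an event is the preimage of a Borel set under \<open>X 0\<close>, which is almost
  surely the constant x; whether x belongs to the Borel set decides.\<close>

lemma hist_0:
  assumes "A \<in> sets (F 0)"
  shows "(AE \<omega> in M. \<omega> \<in> A) \<or> (AE \<omega> in M. \<omega> \<notin> A)"
proof -
  have "sets (F 0) \<subseteq> sets (vimage_algebra (space M) (X 0) borel)"
    unfolding sets_hist
    by (rule sets.sigma_sets_subset'[where M="vimage_algebra (space M) (X 0) borel", simplified])
       (auto simp: sets_vimage_algebra2 enat_0 enat_0_iff intro: exI[of _ UNIV])
  with assms obtain B where A: "A = X 0 -` B \<inter> space M"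
    by (auto simp: sets_vimage_algebra2)
  show ?thesis
  proof (cases "x \<in> B")
    case True
    have "AE \<omega> in M. \<omega> \<in> A" using X_zero AE_space by eventually_elim (use True in \<open>simp add: A\<close>)
    then show ?thesis ..
  next
    case False
    have "AE \<omega> in M. \<omega> \<notin> A" using X_zero by eventually_elim (use False in \<open>simp add: A\<close>)
    then show ?thesis ..
  qed
qed

text \<open>The pullbacks of sets in \<open>FX n\<close> along the graph of \<open>X (Suc n)\<close>
  form a \<sigma>-algebra containing all generators. Events of the next history thus become
  integrands for the one-step formulas.\<close>

lemma hist_Suc:
  assumes "A \<in> sets (F (Suc n))"
  obtains D where "D \<in> sets (FX n)" "A = {\<omega> \<in> space M. (\<omega>, X (Suc n) \<omega>) \<in> D}"
proof -
  let ?V = "vimage_algebra (space M) (\<lambda>\<omega>. (\<omega>, X (Suc n) \<omega>)) (FX n)"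
  have fn: "(\<lambda>\<omega>. (\<omega>, X (Suc n) \<omega>)) \<in> space M \<rightarrow> space (FX n)"
    by (auto simp: space_pair_measure X_in_E)
  have V: "sets ?V = {(\<lambda>\<omega>. (\<omega>, X (Suc n) \<omega>)) -` D \<inter> space M | D. D \<in> sets (FX n)}"
    by (rule sets_vimage_algebra2[OF fn])
  have "X i -` B \<inter> space M \<in> sets ?V" if "i \<le> Suc n" "B \<in> sets borel" for i B
  proof (cases "i \<le> n")
    case True
    have "(X i -` B \<inter> space M) \<times> E \<in> sets (FX n)"
      using measurable_sets[OF mu_to_borel[OF X_hist[OF True]] that(2)] sets.top[of \<mu>]
      by (auto intro!: pair_measureI)
    moreover have "X i -` B \<inter> space M = (\<lambda>\<omega>. (\<omega>, X (Suc n) \<omega>)) -` ((X i -` B \<inter> space M) \<times> E) \<inter> space M"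
      using X_in_E by auto
    ultimately show ?thesis unfolding V by blast
  next
    case False
    with that have i: "i = Suc n" by simp
    have "space M \<times> (B \<inter> E) \<in> sets (FX n)"
      using sets.top[of "F n"] that(2) by (intro pair_measureI) (auto simp: sets_mu sets_restrict_space)
    moreover have "X i -` B \<inter> space M = (\<lambda>\<omega>. (\<omega>, X (Suc n) \<omega>)) -` (space M \<times> (B \<inter> E)) \<inter> space M"
      using X_in_E by (auto simp: i)
    ultimately show ?thesis unfolding V by blast
  qed
  then have "sets (F (Suc n)) \<subseteq> sets ?V"
    unfolding sets_hist using sets.top[of ?V]
    by (intro sets.sigma_sets_subset'[where M="?V", simplified]) auto
  with assms obtain D where "D \<in> sets (FX n)" "A = (\<lambda>\<omega>. (\<omega>, X (Suc n) \<omega>)) -` D \<inter> space M"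
    unfolding V by auto
  then show ?thesis by (intro that[of D]) auto
qed

section \<open>Events of the hidden pair and the one-step law of the observations\<close>

definition \<theta> :: "'a \<Rightarrow> nat \<times> nat" where "\<theta> \<omega> = (\<theta>1 \<omega>, \<theta>2 \<omega>)"

definition C :: "(nat \<times> nat) set \<Rightarrow> 'a set" where "C D = \<theta> -` D \<inter> space M"

lemma theta_pair: "\<theta> \<in> M \<rightarrow>\<^sub>M count_space UNIV"
proof -
  have "\<theta> -` {(j, k)} \<inter> space M = (\<theta>1 -` {j} \<inter> space M) \<inter> (\<theta>2 -` {k} \<inter> space M)" for j k
    by (auto simp: \<theta>_def)
  then have "\<theta> -` {p} \<inter> space M \<in> sets M" for p
    using measurable_sets[OF theta_measurable(1), of "{_}"] measurable_sets[OF theta_measurable(2), of "{_}"]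
    by (cases p) auto
  then show ?thesis by (simp add: measurable_count_space_eq2_countable)
qed

lemma C_sets [simp]: "C D \<in> sets M"
  unfolding C_def by (rule measurable_sets[OF theta_pair]) simp

lemma mem_C: "\<omega> \<in> C D \<longleftrightarrow> \<omega> \<in> space M \<and> (\<theta>1 \<omega>, \<theta>2 \<omega>) \<in> D"
  by (auto simp: C_def \<theta>_def)

lemma hist_sets: "A \<in> sets (hist M X t) \<Longrightarrow> A \<in> sets M"
  using subalgebra_hist by (auto simp: subalgebra_def)

lemma hist_meas: "g \<in> hist M X t \<rightarrow>\<^sub>M N \<Longrightarrow> g \<in> M \<rightarrow>\<^sub>M N"
  by (rule measurable_from_subalg[OF subalgebra_hist])

lemma regime_less: "regime j k s < 3"
  by (simp add: regime_def)

lemma KX_measurable: "r < 3 \<Longrightarrow> (\<lambda>\<omega>. K r (X n \<omega>)) \<in> F n \<rightarrow>\<^sub>M subprob_algebra \<mu>"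
  by (rule measurable_compose[OF X_hist[OF order_refl] K_measurable])

lemma KX_emeasure: "r < 3 \<Longrightarrow> B \<in> sets \<mu> \<Longrightarrow> (\<lambda>\<omega>. emeasure (K r (X n \<omega>)) B) \<in> borel_measurable (F n)"
  by (rule measurable_compose[OF KX_measurable measurable_emeasure_subprob_algebra])

lemma KX_nn_integral:
  assumes "r < 3" "G \<in> borel_measurable (FX n)"
  shows "(\<lambda>\<omega>. \<integral>\<^sup>+u. G (\<omega>, u) \<partial>K r (X n \<omega>)) \<in> borel_measurable (F n)"
  by (rule nn_integral_measurable_subprob_algebra2[OF _ KX_measurable]) (use assms in simp_all)

lemma measure_K:
  assumes "i < 3" "z \<in> E" "B \<in> sets \<mu>"
  shows "measure (K i z) B = (LINT u:B|\<mu>. f i z u)"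
proof -
  have "measure (K i z) B = (\<integral>u. indicator B u \<partial>K i z)"
    using assms sets.sets_into_space[of B \<mu>] by (simp add: Int_absorb2)
  also have "\<dots> = (\<integral>u. indicator B u * f i z u \<partial>\<mu>)"
    by (rule integral_K[OF assms(1,2)]) (use assms(3) in simp)
  finally show ?thesis by (simp add: set_lebesgue_integral_def)
qed

text \<open>For a null value of the hidden pair both sides vanish. Otherwise the conditional
  expectation in \<open>X_markov\<close> is integrated over A under the conditioned measure, and the
  common mass of the conditioning event is cancelled.\<close>

lemma markov_point:
  assumes A: "A \<in> sets (F n)" and B: "B \<in> sets \<mu>"
  shows "emeasure M (C {(j, k)} \<inter> (A \<inter> X (Suc n) -` B)) =
    (\<integral>\<^sup>+\<omega>. indicator (C {(j, k)}) \<omega> * (indicator A \<omega> * emeasure (K (regime j k (Suc n)) (X n \<omega>)) B) \<partial>M)"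
proof (cases "emeasure M (C {(j, k)}) = 0")
  case True
  then have ae: "AE \<omega> in M. \<omega> \<notin> C {(j, k)}"
    by (intro AE_not_in) (simp add: null_sets_def)
  have "emeasure M (C {(j, k)} \<inter> (A \<inter> X (Suc n) -` B)) \<le> emeasure M (C {(j, k)})"
    by (intro emeasure_mono) auto
  moreover have "(\<integral>\<^sup>+\<omega>. indicator (C {(j, k)}) \<omega> * (indicator A \<omega> * emeasure (K (regime j k (Suc n)) (X n \<omega>)) B) \<partial>M)
      = (\<integral>\<^sup>+\<omega>. 0 \<partial>M)"
    by (rule nn_integral_cong_AE) (use ae in eventually_elim, simp)
  ultimately show ?thesis using True by simp
next
  case False
  let ?C = "C {(j, k)}" and ?r = "regime j k (Suc n)"
  define U where "U = uniform_measure M ?C"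
  have Ceq: "{\<omega> \<in> space M. \<theta>1 \<omega> = j \<and> \<theta>2 \<omega> = k} = ?C" by (auto simp: mem_C)
  interpret U: prob_space U
    unfolding U_def by (rule prob_space_uniform_measure[OF False]) simp
  have sU: "sets U = sets M" "space U = space M" by (simp_all add: U_def)
  have subU: "subalgebra U (F n)" using subalgebra_hist by (simp add: subalgebra_def sU)
  interpret UF: finite_measure_subalgebra U "F n"
    by unfold_locales (rule subU)
  have As: "A \<subseteq> space M" using sets.sets_into_space[OF A] by simp
  have XB: "X (Suc n) -` B \<inter> space M \<in> sets M" by (rule measurable_sets[OF X_measurable B])
  have AM: "A \<in> sets M" by (rule hist_sets[OF A])
  have AXB: "A \<inter> X (Suc n) -` B \<in> sets M"
  proof -
    have "A \<inter> X (Suc n) -` B = A \<inter> (X (Suc n) -` B \<inter> space M)" using As by auto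
    then show ?thesis using AM XB by auto
  qed
  have pos: "\<P>(\<omega> in M. \<theta>1 \<omega> = j \<and> \<theta>2 \<omega> = k) \<noteq> 0"
    using False unfolding Ceq by (simp add: emeasure_eq_measure)
  have ce: "AE \<omega> in U. real_cond_exp U (F n) (indicator (X (Suc n) -` B \<inter> space M)) \<omega> = measure (K ?r (X n \<omega>)) B"
  proof -
    have "AE \<omega> in U. real_cond_exp U (F n) (indicator (X (Suc n) -` B \<inter> space M)) \<omega> = (LINT u:B|\<mu>. f ?r (X n \<omega>) u)"
      using X_markov[OF pos _ B, of "Suc n", unfolded Ceq, folded U_def] by simp
    then show ?thesis using AE_space
      by eventually_elim (simp add: measure_K[OF regime_less X_in_E B] sU)
  qed
  have bK: "measure (K ?r (X n \<omega>)) B \<le> 1" if "\<omega> \<in> space M" for \<omega>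
    using prob_space.prob_le_1[OF prob_space_K[OF regime_less X_in_E[OF that]]] .
  have mK: "(\<lambda>\<omega>. measure (K ?r (X n \<omega>)) B) \<in> borel_measurable U"
    unfolding measurable_cong_sets[OF sU(1) refl]
    by (rule hist_meas, rule measurable_compose[OF KX_measurable[OF regime_less] measurable_measure_subprob_algebra[OF B]])
  have iU: "integrable U (indicator (X (Suc n) -` B \<inter> space M) :: 'a \<Rightarrow> real)"
    using XB by (simp add: sU less_top[symmetric])
  have "measure U (A \<inter> X (Suc n) -` B) = (\<integral>\<omega>\<in>A. indicator (X (Suc n) -` B \<inter> space M) \<omega> \<partial>U)"
  proof -
    have "(\<lambda>\<omega>. indicator A \<omega> *\<^sub>R indicator (X (Suc n) -` B \<inter> space M) \<omega>) = (indicator (A \<inter> X (Suc n) -` B) :: 'a \<Rightarrow> real)"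
      using As by (auto simp: indicator_def fun_eq_iff)
    then show ?thesis
      unfolding set_lebesgue_integral_def using As by (simp add: sU Int_absorb2 le_infI1)
  qed
  also have "\<dots> = (\<integral>\<omega>\<in>A. real_cond_exp U (F n) (indicator (X (Suc n) -` B \<inter> space M)) \<omega> \<partial>U)"
    by (rule UF.real_cond_exp_intA[OF iU A])
  also have "\<dots> = (\<integral>\<omega>. indicator A \<omega> * measure (K ?r (X n \<omega>)) B \<partial>U)"
    unfolding set_lebesgue_integral_def
    by (rule integral_cong_AE)
       (use ce AM mK sU in \<open>auto intro!: borel_measurable_times borel_measurable_indicator borel_measurable_cond_exp2\<close>)
  finally have 1: "measure U (A \<inter> X (Suc n) -` B) = (\<integral>\<omega>. indicator A \<omega> * measure (K ?r (X n \<omega>)) B \<partial>U)" .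
  have iK: "integrable U (\<lambda>\<omega>. indicator A \<omega> * measure (K ?r (X n \<omega>)) B)"
    by (rule U.integrable_const_bound[where B=1])
       (use bK mK AM sU in \<open>auto intro!: AE_I2 borel_measurable_times simp: indicator_def\<close>)
  have "emeasure U (A \<inter> X (Suc n) -` B) = (\<integral>\<^sup>+\<omega>. ennreal (indicator A \<omega> * measure (K ?r (X n \<omega>)) B) \<partial>U)"
    unfolding U.emeasure_eq_measure 1 by (rule nn_integral_eq_integral[symmetric, OF iK]) simp
  also have "\<dots> = (\<integral>\<^sup>+\<omega>. indicator A \<omega> * emeasure (K ?r (X n \<omega>)) B \<partial>U)"
  proof (rule nn_integral_cong)
    fix \<omega> assume "\<omega> \<in> space U"
    then interpret K: prob_space "K ?r (X n \<omega>)"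
      by (intro prob_space_K regime_less X_in_E) (simp add: sU)
    show "ennreal (indicator A \<omega> * measure (K ?r (X n \<omega>)) B) = indicator A \<omega> * emeasure (K ?r (X n \<omega>)) B"
      by (simp add: K.emeasure_eq_measure indicator_def)
  qed
  finally have 2: "emeasure M (?C \<inter> (A \<inter> X (Suc n) -` B)) / emeasure M ?C =
      (\<integral>\<^sup>+\<omega>. indicator A \<omega> * emeasure (K ?r (X n \<omega>)) B * indicator ?C \<omega> \<partial>M) / emeasure M ?C"
    unfolding U_def using AXB KX_emeasure[OF regime_less B, THEN hist_meas] AM
    by (simp add: nn_integral_uniform_measure)
  \<comment> \<open>Both conditioned quantities carry the same divisor, which is finite and
    nonzero.\<close>
  have canc: "a = b" if "a / emeasure M ?C = b / emeasure M ?C" for a b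
  proof -
    have "a / emeasure M ?C * emeasure M ?C = b / emeasure M ?C * emeasure M ?C" using that by simp
    then show ?thesis using False by (simp add: ennreal_divide_times ennreal_divide_self less_top[symmetric])
  qed
  show ?thesis using canc[OF 2] by (simp add: mult_ac)
qed

lemma AX_sets:
  assumes "A \<in> sets (F n)" "B \<in> sets \<mu>"
  shows "A \<inter> X m -` B \<in> sets M"
proof -
  have "A \<inter> X m -` B = A \<inter> (X m -` B \<inter> space M)" using sets.sets_into_space[OF assms(1)] by auto
  then show ?thesis using hist_sets[OF assms(1)] measurable_sets[OF X_measurable assms(2)] by auto
qed

lemma emeasure_density_C:
  assumes "g \<in> borel_measurable M"
  shows "emeasure (density M g) (C D) = (\<integral>\<^sup>+\<omega>. indicator (C D) \<omega> * g \<omega> \<partial>M)"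
  using emeasure_density[OF assms C_sets] by (simp add: mult.commute)

lemma emeasure_eq_C:
  assumes "g \<in> borel_measurable M" "h \<in> borel_measurable M"
    and "\<And>p. p \<in> D \<Longrightarrow> (\<integral>\<^sup>+\<omega>. indicator (C {p}) \<omega> * g \<omega> \<partial>M) = (\<integral>\<^sup>+\<omega>. indicator (C {p}) \<omega> * h \<omega> \<partial>M)"
  shows "(\<integral>\<^sup>+\<omega>. indicator (C D) \<omega> * g \<omega> \<partial>M) = (\<integral>\<^sup>+\<omega>. indicator (C D) \<omega> * h \<omega> \<partial>M)"
  using emeasure_eq_countable[OF theta_pair, of "density M g" "density M h" D, folded C_def]
    assms(3) by (simp add: emeasure_density_C assms(1,2))

lemma emeasure_C_Int:
  assumes "S \<in> sets M"
  shows "emeasure M (C D \<inter> S) = (\<integral>\<^sup>+\<omega>. indicator (C D) \<omega> * indicator S \<omega> \<partial>M)"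
proof -
  have "(\<integral>\<^sup>+\<omega>. indicator (C D) \<omega> * indicator S \<omega> \<partial>M) = (\<integral>\<^sup>+\<omega>. indicator (C D \<inter> S) \<omega> \<partial>M)"
    by (simp add: indicator_inter_arith)
  then show ?thesis using nn_integral_indicator[OF sets.Int[OF C_sets[of D] assms]] by simp
qed

text \<open>All pairs in D share the regime at time n + 1, hence the kernel, so the identities for
  single pairs can be added up.\<close>

lemma markov_set:
  assumes A: "A \<in> sets (F n)" and B: "B \<in> sets \<mu>" and r: "r < 3"
    and D: "\<And>j k. (j, k) \<in> D \<Longrightarrow> regime j k (Suc n) = r"
  shows "emeasure M (C D \<inter> (A \<inter> X (Suc n) -` B)) =
    (\<integral>\<^sup>+\<omega>. indicator (C D) \<omega> * (indicator A \<omega> * emeasure (K r (X n \<omega>)) B) \<partial>M)"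
  unfolding emeasure_C_Int[OF AX_sets[OF A B]]
proof (rule emeasure_eq_C)
  show "indicator (A \<inter> X (Suc n) -` B) \<in> borel_measurable M"
    by (rule borel_measurable_indicator[OF AX_sets[OF A B]])
  show "(\<lambda>\<omega>. indicator A \<omega> * emeasure (K r (X n \<omega>)) B) \<in> borel_measurable M"
    by (intro borel_measurable_times_ennreal borel_measurable_indicator hist_sets[OF A] KX_emeasure[OF r B, THEN hist_meas])
  fix p assume p: "p \<in> D"
  obtain j k where jk: "p = (j, k)" by (cases p)
  show "(\<integral>\<^sup>+\<omega>. indicator (C {p}) \<omega> * indicator (A \<inter> X (Suc n) -` B) \<omega> \<partial>M) =
      (\<integral>\<^sup>+\<omega>. indicator (C {p}) \<omega> * (indicator A \<omega> * emeasure (K r (X n \<omega>)) B) \<partial>M)"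
    using markov_point[OF A B, of j k] D p
    by (simp add: jk emeasure_C_Int[OF AX_sets[OF A B]])
qed

text \<open>Disintegration of the measure weighted by the hidden event; \<open>markov_set\<close>
  supplies the rectangles.\<close>

lemma one_step0:
  assumes r: "r < 3" and D: "\<And>j k. (j, k) \<in> D \<Longrightarrow> regime j k (Suc n) = r"
    and G: "G \<in> borel_measurable (FX n)"
  shows "(\<integral>\<^sup>+\<omega>. indicator (C D) \<omega> * G (\<omega>, X (Suc n) \<omega>) \<partial>M) =
    (\<integral>\<^sup>+\<omega>. indicator (C D) \<omega> * (\<integral>\<^sup>+u. G (\<omega>, u) \<partial>K r (X n \<omega>)) \<partial>M)"
proof -
  let ?N = "density M (indicator (C D))"
  have iC: "(indicator (C D) :: 'a \<Rightarrow> ennreal) \<in> borel_measurable M"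
    by (rule borel_measurable_indicator[OF C_sets])
  have sN: "subalgebra ?N (F n)" using subalgebra_hist by (simp add: subalgebra_def)
  have Gm: "(\<lambda>\<omega>. G (\<omega>, X (Suc n) \<omega>)) \<in> borel_measurable M"
    by (rule measurable_compose[OF measurable_Pair[OF subalgebra_ident[OF subalgebra_hist] X_measurable] G])
  have "(\<integral>\<^sup>+\<omega>. G (\<omega>, X (Suc n) \<omega>) \<partial>?N) = (\<integral>\<^sup>+\<omega>. \<integral>\<^sup>+u. G (\<omega>, u) \<partial>K r (X n \<omega>) \<partial>?N)"
  proof (rule kernel_disintegration[OF sN sN _ _ _ KX_measurable[OF r] _ G])
    show "finite_measure ?N"
    proof (rule finite_measureI)
      have "emeasure ?N (space M) = emeasure M (C D \<inter> space M)"
        unfolding emeasure_C_Int[OF sets.top] by (rule emeasure_density[OF iC sets.top])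
      then show "emeasure ?N (space ?N) \<noteq> \<infinity>" by simp
    qed
    show "space (F n) \<noteq> {}" using not_empty by simp
    show "X (Suc n) \<in> ?N \<rightarrow>\<^sub>M \<mu>" using X_measurable by simp
    fix A B assume AB: "A \<in> sets (F n)" "B \<in> sets \<mu>"
    have "emeasure ?N (A \<inter> X (Suc n) -` B) = emeasure M (C D \<inter> (A \<inter> X (Suc n) -` B))"
      unfolding emeasure_C_Int[OF AX_sets[OF AB]] by (rule emeasure_density[OF iC AX_sets[OF AB]])
    also have "\<dots> = (\<integral>\<^sup>+\<omega>. indicator (C D) \<omega> * (indicator A \<omega> * emeasure (K r (X n \<omega>)) B) \<partial>M)"
      by (rule markov_set[OF AB r D])
    also have "\<dots> = (\<integral>\<^sup>+\<omega>. (indicator A \<omega> * emeasure (K r (X n \<omega>)) B) \<partial>?N)"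
      by (rule nn_integral_density[symmetric, OF iC])
         (intro borel_measurable_times_ennreal borel_measurable_indicator hist_sets[OF AB(1)] KX_emeasure[OF r AB(2), THEN hist_meas])
    finally show "emeasure ?N (A \<inter> X (Suc n) -` B) = (\<integral>\<^sup>+\<omega>\<in>A. emeasure (K r (X n \<omega>)) B \<partial>?N)"
      by (simp add: mult.commute)
  qed
  then show ?thesis
    using nn_integral_density[OF iC Gm] nn_integral_density[OF iC KX_nn_integral[OF r G, THEN hist_meas]] by simp
qed

text \<open>After integrating out the next observation, what is left is measurable for
  \<open>F n\<close>, so the indicator of the hidden event may be replaced by a version w of its
  conditional probability given \<open>F n\<close>.\<close>

lemma one_step:
  assumes r: "r < 3" and D: "\<And>j k. (j, k) \<in> D \<Longrightarrow> regime j k (Suc n) = r"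
    and w: "w \<in> borel_measurable (F n)"
      "\<And>A. A \<in> sets (F n) \<Longrightarrow> emeasure M (C D \<inter> A) = (\<integral>\<^sup>+\<omega>\<in>A. w \<omega> \<partial>M)"
    and G: "G \<in> borel_measurable (FX n)"
  shows "(\<integral>\<^sup>+\<omega>. indicator (C D) \<omega> * G (\<omega>, X (Suc n) \<omega>) \<partial>M) =
    (\<integral>\<^sup>+\<omega>. w \<omega> * (\<integral>\<^sup>+u. G (\<omega>, u) \<partial>K r (X n \<omega>)) \<partial>M)"
proof -
  note \<phi> = KX_nn_integral[OF r G]
  have iC: "(indicator (C D) :: 'a \<Rightarrow> ennreal) \<in> borel_measurable M"
    by (rule borel_measurable_indicator[OF C_sets])
  have "(\<integral>\<^sup>+\<omega>. (\<integral>\<^sup>+u. G (\<omega>, u) \<partial>K r (X n \<omega>)) \<partial>density M (indicator (C D))) =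
    (\<integral>\<^sup>+\<omega>. (\<integral>\<^sup>+u. G (\<omega>, u) \<partial>K r (X n \<omega>)) \<partial>density M w)"
  proof (rule nn_integral_eq_subalgebra[OF _ _ _ \<phi>])
    fix A assume A: "A \<in> sets (F n)"
    show "emeasure (density M (indicator (C D))) A = emeasure (density M w) A"
      using w(2)[OF A] emeasure_C_Int[OF hist_sets[OF A], of D]
      by (simp add: emeasure_density[OF iC hist_sets[OF A]] emeasure_density[OF hist_meas[OF w(1)] hist_sets[OF A]])
  qed (use subalgebra_hist in \<open>simp_all add: subalgebra_def\<close>)
  moreover have "(\<integral>\<^sup>+\<omega>. indicator (C D) \<omega> * G (\<omega>, X (Suc n) \<omega>) \<partial>M) =
    (\<integral>\<^sup>+\<omega>. indicator (C D) \<omega> * (\<integral>\<^sup>+u. G (\<omega>, u) \<partial>K r (X n \<omega>)) \<partial>M)"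
    by (rule one_step0[OF r _ G]) (rule D)
  ultimately show ?thesis
    using nn_integral_density[OF iC \<phi>[THEN hist_meas]]
      nn_integral_density[OF hist_meas[OF w(1)] \<phi>[THEN hist_meas]] by simp
qed

section \<open>The observed past carries the same information for pairs with equal regimes\<close>

definition agree :: "nat \<Rightarrow> nat \<times> nat \<Rightarrow> nat \<times> nat \<Rightarrow> bool" where
  "agree n p q \<longleftrightarrow> (\<forall>s\<in>{1..n}. regime (fst p) (snd p) s = regime (fst q) (snd q) s)"

text \<open>Cross-multiplied so as to cover values of \<open>(\<theta>\<^sub>1, \<theta>\<^sub>2)\<close> of probability zero.\<close>

lemma agree_point:
  assumes "agree n p q" "A \<in> sets (F n)"
  shows "emeasure M (C {q}) * emeasure M (C {p} \<inter> A) = emeasure M (C {p}) * emeasure M (C {q} \<inter> A)"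
  using assms
proof (induction n arbitrary: A)
  case 0
  note A = hist_sets[OF 0(2)]
  show ?case
    using hist_0[OF 0(2)]
  proof
    assume ae: "AE \<omega> in M. \<omega> \<in> A"
    have "emeasure M (C D \<inter> A) = emeasure M (C D)" for D
      by (rule emeasure_eq_AE) (use ae A in auto)
    then show ?thesis by (simp add: mult.commute)
  next
    assume ae: "AE \<omega> in M. \<omega> \<notin> A"
    have "emeasure M (C D \<inter> A) = emeasure M {}" for D
      by (rule emeasure_eq_AE) (use ae A in auto)
    then show ?thesis by simp
  qed
next
  case (Suc n)
  have ag: "agree n p q" and r: "regime (fst p) (snd p) (Suc n) = regime (fst q) (snd q) (Suc n)"
    using Suc.prems(1) by (auto simp: agree_def)
  let ?r = "regime (fst p) (snd p) (Suc n)"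
  obtain D where D: "D \<in> sets (FX n)" and A: "A = {\<omega> \<in> space M. (\<omega>, X (Suc n) \<omega>) \<in> D}"
    using hist_Suc[OF Suc.prems(2)] .
  have G: "(indicator D :: _ \<Rightarrow> ennreal) \<in> borel_measurable (FX n)" using D by simp
  define \<phi> where "\<phi> = (\<lambda>\<omega>. \<integral>\<^sup>+u. indicator D (\<omega>, u) \<partial>K ?r (X n \<omega>))"
  have \<phi>: "\<phi> \<in> borel_measurable (F n)" unfolding \<phi>_def by (rule KX_nn_integral[OF regime_less G])
  have iC: "(indicator (C S) :: 'a \<Rightarrow> ennreal) \<in> borel_measurable M" for S
    by (rule borel_measurable_indicator[OF C_sets])
  have eq: "emeasure M (C {t} \<inter> A) = (\<integral>\<^sup>+\<omega>. indicator (C {t}) \<omega> * \<phi> \<omega> \<partial>M)"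
    if "regime (fst t) (snd t) (Suc n) = ?r" for t
  proof -
    have "emeasure M (C {t} \<inter> A) = (\<integral>\<^sup>+\<omega>. indicator (C {t}) \<omega> * indicator A \<omega> \<partial>M)"
      by (rule emeasure_C_Int[OF hist_sets[OF Suc.prems(2)]])
    also have "\<dots> = (\<integral>\<^sup>+\<omega>. indicator (C {t}) \<omega> * indicator D (\<omega>, X (Suc n) \<omega>) \<partial>M)"
      by (rule nn_integral_cong) (simp add: A indicator_def)
    also have "\<dots> = (\<integral>\<^sup>+\<omega>. indicator (C {t}) \<omega> * \<phi> \<omega> \<partial>M)"
      unfolding \<phi>_def by (rule one_step0[OF regime_less _ G]) (use that in auto)
    finally show ?thesis .
  qed
  have sub: "subalgebra (density M g) (F n)" for g
    using subalgebra_hist by (simp add: subalgebra_def)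
  have cC: "(\<lambda>\<omega>. c * indicator (C S) \<omega>) \<in> borel_measurable M" for S and c :: ennreal
    by (intro borel_measurable_times_ennreal borel_measurable_const iC)
  have pull: "(\<integral>\<^sup>+\<omega>. (c * indicator (C S) \<omega>) * g \<omega> \<partial>M) = c * (\<integral>\<^sup>+\<omega>. indicator (C S) \<omega> * g \<omega> \<partial>M)"
    if "g \<in> borel_measurable M" for S c and g :: "'a \<Rightarrow> ennreal"
    unfolding mult.assoc by (rule nn_integral_cmult) (intro borel_measurable_times_ennreal that iC)
  \<comment> \<open>By the induction hypothesis the two weighted measures coincide on
    \<open>F n\<close>, and \<phi> is measurable for it; the common regime at time n + 1 makes
    \<phi> serve both p and q.\<close>
  have "(\<integral>\<^sup>+\<omega>. \<phi> \<omega> \<partial>density M (\<lambda>\<omega>. emeasure M (C {q}) * indicator (C {p}) \<omega>)) =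
      (\<integral>\<^sup>+\<omega>. \<phi> \<omega> \<partial>density M (\<lambda>\<omega>. emeasure M (C {p}) * indicator (C {q}) \<omega>))"
  proof (rule nn_integral_eq_subalgebra[OF sub sub _ \<phi>])
    fix A assume A: "A \<in> sets (F n)"
    note AM = hist_sets[OF A]
    show "emeasure (density M (\<lambda>\<omega>. emeasure M (C {q}) * indicator (C {p}) \<omega>)) A =
      emeasure (density M (\<lambda>\<omega>. emeasure M (C {p}) * indicator (C {q}) \<omega>)) A"
      using Suc.IH[OF ag A] unfolding emeasure_C_Int[OF AM]
      by (simp add: emeasure_density[OF cC AM] pull[OF borel_measurable_indicator[OF AM]])
  qed
  then show ?case
    by (simp add: eq r nn_integral_density[OF cC hist_meas[OF \<phi>]] pull[OF hist_meas[OF \<phi>]])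
qed

text \<open>\<open>agree_point\<close> is summed over D for fixed q, and the result over D'.\<close>

lemma agree_set:
  assumes ag: "\<And>p q. p \<in> D \<Longrightarrow> q \<in> D' \<Longrightarrow> agree n p q" and A: "A \<in> sets (F n)"
  shows "emeasure M (C D') * emeasure M (C D \<inter> A) = emeasure M (C D) * emeasure M (C D' \<inter> A)"
proof -
  note AM = hist_sets[OF A]
  have iA: "(indicator A :: 'a \<Rightarrow> ennreal) \<in> borel_measurable M" by (rule borel_measurable_indicator[OF AM])
  have cA: "(\<lambda>\<omega>. c * indicator A \<omega>) \<in> borel_measurable M" for c :: ennreal
    by (intro borel_measurable_times_ennreal borel_measurable_const iA)
  have pull: "(\<integral>\<^sup>+\<omega>. indicator (C S) \<omega> * (c * indicator A \<omega>) \<partial>M) = c * emeasure M (C S \<inter> A)" for S and c :: ennreal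
  proof -
    have "(\<integral>\<^sup>+\<omega>. indicator (C S) \<omega> * (c * indicator A \<omega>) \<partial>M) = (\<integral>\<^sup>+\<omega>. c * (indicator (C S) \<omega> * indicator A \<omega>) \<partial>M)"
      by (simp add: mult.left_commute)
    also have "\<dots> = c * (\<integral>\<^sup>+\<omega>. indicator (C S) \<omega> * indicator A \<omega> \<partial>M)"
      by (rule nn_integral_cmult) (intro borel_measurable_times_ennreal iA borel_measurable_indicator C_sets)
    finally show ?thesis unfolding emeasure_C_Int[OF AM] .
  qed
  have pull1: "(\<integral>\<^sup>+\<omega>. indicator (C S) \<omega> * c \<partial>M) = c * emeasure M (C S)" for S and c :: ennreal
    by (subst nn_integral_multc[OF borel_measurable_indicator[OF C_sets]])
       (simp only: nn_integral_indicator[OF C_sets] mult.commute)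
  have 1: "emeasure M (C {q}) * emeasure M (C D \<inter> A) = emeasure M (C D) * emeasure M (C {q} \<inter> A)" if q: "q \<in> D'" for q
    using emeasure_eq_C[OF cA[of "emeasure M (C {q})"] borel_measurable_const[of "emeasure M (C {q} \<inter> A)"], of D]
      agree_point[OF ag[OF _ q] A]
    unfolding pull pull1 by (simp add: mult.commute)
  show ?thesis
    using emeasure_eq_C[OF borel_measurable_const[of "emeasure M (C D \<inter> A)"] cA[of "emeasure M (C D)"], of D'] 1
    unfolding pull pull1 by (simp add: mult.commute)
qed

text \<open>Given the hidden pair, the observed past cannot tell D from D', so the ratio c of their
  prior probabilities persists on every observed event. If D' is null, the hypothesis makes D null
  too.\<close>

lemma transfer:
  assumes ag: "\<And>p q. p \<in> D \<Longrightarrow> q \<in> D' \<Longrightarrow> agree n p q" and A: "A \<in> sets (F n)"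
    and c: "prob (C D) = c * prob (C D')"
  shows "prob (C D \<inter> A) = c * prob (C D' \<inter> A)"
proof (cases "prob (C D') = 0")
  case True
  have AM: "A \<in> sets M" by (rule hist_sets[OF A])
  have "prob (C S \<inter> A) \<le> prob (C S)" for S
    using AM by (intro finite_measure_mono) auto
  from this[of D] this[of D'] show ?thesis using True c by (simp add: measure_le_0_iff)
next
  case False
  have "prob (C D') * prob (C D \<inter> A) = prob (C D) * prob (C D' \<inter> A)"
    using agree_set[OF ag A, of D D']
    by (simp add: emeasure_eq_measure ennreal_mult[symmetric])
  then show ?thesis using False unfolding c by simp
qed

text \<open>
  The hidden states at time \<open>n\<close>: no change yet (\<open>D0\<close>), split into simultaneous (\<open>D12\<close>) and
  distinct (\<open>Dn\<close>) future changes; one change (\<open>D1\<close>); both changes (\<open>D2\<close>).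
\<close>

definition "D0 n = {(j::nat, k::nat). n < j}"
definition "D12 n = {(j::nat, k::nat). n < j \<and> k = j}"
definition "Dn n = {(j::nat, k::nat). n < j \<and> j < k}"
definition "D1 n = {(j::nat, k::nat). j \<le> n \<and> n < k}"
definition "D2 n = {(j::nat, k::nat). j \<le> k \<and> k \<le> n}"
definition "Dj i = {(j::nat, k::nat). j = i}"
definition "Dt i m = {(j::nat, k::nat). j = i \<and> m < k}"

lemmas D_defs = D0_def D12_def Dn_def D1_def D2_def Dj_def Dt_def

lemma mem_D: "(j, k) \<in> D0 n \<longleftrightarrow> n < j" "(j, k) \<in> D12 n \<longleftrightarrow> n < j \<and> k = j"
  "(j, k) \<in> Dn n \<longleftrightarrow> n < j \<and> j < k" "(j, k) \<in> Dt i n \<longleftrightarrow> j = i \<and> n < k"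
  by (simp_all add: D_defs)

lemma theta_le': "\<omega> \<in> C D \<Longrightarrow> \<theta>1 \<omega> \<le> \<theta>2 \<omega>"
  by (simp add: mem_C theta_le)

lemma prob_split:
  assumes "A \<in> sets M" "C D \<inter> A = C D' \<inter> A \<union> C D'' \<inter> A" "(C D' \<inter> A) \<inter> (C D'' \<inter> A) = {}"
  shows "prob (C D \<inter> A) = prob (C D' \<inter> A) + prob (C D'' \<inter> A)"
  unfolding assms(2) by (rule finite_measure_Union) (use assms in auto)

lemma prob_split':
  assumes "C D = C D' \<union> C D''" "C D' \<inter> C D'' = {}"
  shows "prob (C D) = prob (C D') + prob (C D'')"
  unfolding assms(1) by (rule finite_measure_Union) (use assms in auto)

section \<open>Prior probabilities and transitions of the hidden state\<close>

lemma prob_Dj: "prob (C (Dj i)) = (if i = 0 then \<pi> else (1 - \<pi>) * p1 ^ (i - 1) * (1 - p1))"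
proof -
  have "C (Dj i) = {\<omega> \<in> space M. \<theta>1 \<omega> = i}" by (auto simp: mem_C D_defs)
  then show ?thesis using theta1_zero theta1_pos[of i] by auto
qed

lemma prob_D0: "prob (C (D0 n)) = (1 - \<pi>) * p1 ^ n"
proof (induction n)
  case 0
  have "C (D0 0) = space M - C (Dj 0)" by (auto simp: mem_C D_defs)
  then show ?case using prob_compl[of "C (Dj 0)"] prob_Dj[of 0] by simp
next
  case (Suc n)
  have "prob (C (D0 n)) = prob (C (D0 (Suc n))) + prob (C (Dj (Suc n)))"
    by (rule prob_split') (auto simp: mem_C D_defs)
  then show ?case using Suc prob_Dj[of "Suc n"] by (simp add: algebra_simps)
qed

text \<open>Conditional laws are given only for values of \<theta>1 of positive probability; in the
  remaining case both sides are zero.\<close>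

lemma prob_pair:
  assumes "i \<le> k"
  shows "prob (C {(i, k)}) = (if k = i then \<rho> else (1 - \<rho>) * p2 ^ (k - i - 1) * (1 - p2)) * prob (C (Dj i))"
proof -
  have e: "C (Dj i) = {\<omega> \<in> space M. \<theta>1 \<omega> = i}"
    "C {(i, k)} = {\<omega> \<in> space M. \<theta>2 \<omega> = k \<and> \<theta>1 \<omega> = i}" by (auto simp: mem_C D_defs)
  show ?thesis
  proof (cases "prob (C (Dj i)) = 0")
    case True
    have "prob (C {(i, k)}) \<le> prob (C (Dj i))"
      by (rule finite_measure_mono) (auto simp: mem_C D_defs)
    with True show ?thesis by (simp add: measure_le_0_iff)
  next
    case False
    then have "prob (C {(i, k)}) / prob (C (Dj i)) = (if k = i then \<rho> else (1 - \<rho>) * p2 ^ (k - i - 1) * (1 - p2))"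
      using theta2_eq[of i] theta2_gt[of i k] assms unfolding e cond_prob_def by auto
    with False show ?thesis by (simp add: field_simps)
  qed
qed

lemma prob_Dt: "prob (C (Dt i (i + d))) = (1 - \<rho>) * p2 ^ d * prob (C (Dj i))"
proof (induction d)
  case 0
  have "prob (C (Dj i)) = prob (C (Dt i (i + 0))) + prob (C {(i, i)})"
    by (rule prob_split') (use theta_le' in \<open>fastforce simp: mem_C D_defs le_less\<close>)+
  then show ?case using prob_pair[of i i] by (simp add: algebra_simps)
next
  case (Suc d)
  have "prob (C (Dt i (i + d))) = prob (C (Dt i (i + Suc d))) + prob (C {(i, i + Suc d)})"
    by (rule prob_split') (auto simp: mem_C D_defs)
  then show ?case using Suc prob_pair[of i "i + Suc d"] by (simp add: algebra_simps)
qed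

lemma prob_Dt': "i \<le> m \<Longrightarrow> prob (C (Dt i m)) = (1 - \<rho>) * p2 ^ (m - i) * prob (C (Dj i))"
  using prob_Dt[of i "m - i"] by simp

text \<open>The conditional probability \<rho> is the same for every value of \<theta>1. Comparing M
  weighted by the indicator of \<theta>1 = \<theta>2 with M weighted by \<rho> on the level sets of
  \<theta>1 avoids an infinite series.\<close>

lemma prob_D12: "prob (C (D12 n)) = \<rho> * (1 - \<pi>) * p1 ^ n"
proof -
  have iC: "(indicator (C {(j, k). k = j}) :: 'a \<Rightarrow> ennreal) \<in> borel_measurable M"
    by (rule borel_measurable_indicator[OF C_sets])
  have t1: "\<theta>1 -` S \<inter> space M = C {(j, k). j \<in> S}" for S by (auto simp: mem_C)
  have 1: "emeasure (density M (indicator (C {(j, k). k = j}))) (C {(j, k). j \<in> S}) = emeasure M (C {(j, k). j \<in> S \<and> k = j})" for S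
  proof -
    have "C {(j, k). k = j} \<inter> C {(j, k). j \<in> S} = C {(j, k). j \<in> S \<and> k = j}" by (auto simp: mem_C)
    moreover have "emeasure (density M (indicator (C {(j, k). k = j}))) (C {(j, k). j \<in> S})
        = emeasure M (C {(j, k). k = j} \<inter> C {(j, k). j \<in> S})"
      unfolding emeasure_C_Int[OF C_sets] by (rule emeasure_density[OF iC C_sets])
    ultimately show ?thesis by simp
  qed
  have 2: "emeasure (density M (\<lambda>_. ennreal \<rho>)) (C S) = ennreal \<rho> * emeasure M (C S)" for S
    by (simp add: emeasure_density_const)
  have "emeasure (density M (indicator (C {(j, k). k = j}))) (\<theta>1 -` {n<..} \<inter> space M) =
      emeasure (density M (\<lambda>_. ennreal \<rho>)) (\<theta>1 -` {n<..} \<inter> space M)"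
  proof (rule emeasure_eq_countable[OF theta_measurable(1)])
    fix b :: nat
    have "{(j, k). j \<in> {b} \<and> k = j} = {(b, b)}" "{(j, k). j \<in> {b}} = Dj b" by (auto simp: D_defs)
    then show "emeasure (density M (indicator (C {(j, k). k = j}))) (\<theta>1 -` {b} \<inter> space M) =
      emeasure (density M (\<lambda>_. ennreal \<rho>)) (\<theta>1 -` {b} \<inter> space M)"
      unfolding t1 1 2 using prob_pair[of b b] rho_range
      by (simp add: emeasure_eq_measure ennreal_mult)
  qed simp_all
  moreover have "{(j, k). j \<in> {n<..} \<and> k = j} = D12 n" "{(j, k). j \<in> {n<..}} = D0 n" by (auto simp: D_defs)
  ultimately have "ennreal (prob (C (D12 n))) = ennreal (\<rho> * prob (C (D0 n)))"
    unfolding t1 1 2 using rho_range by (simp add: emeasure_eq_measure ennreal_mult)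
  then show ?thesis using rho_range unfolding prob_D0 by (simp add: ennreal_inj mult_nonneg_nonneg pi_range p1_range less_imp_le)
qed

lemma prob_Dn: "prob (C (Dn n)) = (1 - \<rho>) * (1 - \<pi>) * p1 ^ n"
proof -
  have "prob (C (D0 n)) = prob (C (D12 n)) + prob (C (Dn n))"
    by (rule prob_split') (use theta_le' in \<open>fastforce simp: mem_C D_defs le_less\<close>)+
  then show ?thesis by (simp add: prob_D0 prob_D12 algebra_simps)
qed

lemma prob_D2_0: "prob (C (D2 0)) = \<rho> * \<pi>"
proof -
  have "D2 0 = {(0, 0)}" by (auto simp: D_defs)
  then show ?thesis using prob_pair[of 0 0] prob_Dj[of 0] by simp
qed

text \<open>In this and the next three lemmas, all pairs on both sides have regime 0 up to time n;
  the factor is therefore the ratio of prior probabilities.\<close>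

lemma prob_D0_Suc: "A \<in> sets (F n) \<Longrightarrow> prob (C (D0 (Suc n)) \<inter> A) = p1 * prob (C (D0 n) \<inter> A)"
  by (rule transfer[where n=n]) (auto simp: agree_def regime_def prob_D0 mem_D)

lemma prob_D12_Suc: "A \<in> sets (F n) \<Longrightarrow> prob (C (D12 (Suc n)) \<inter> A) = p1 * prob (C (D12 n) \<inter> A)"
  by (rule transfer[where n=n]) (auto simp: agree_def regime_def prob_D12 mem_D)

lemma prob_Dn_hit: "A \<in> sets (F n) \<Longrightarrow> prob (C (Dt (Suc n) (Suc n)) \<inter> A) = (1 - p1) * prob (C (Dn n) \<inter> A)"
  by (rule transfer[where n=n]) (auto simp: agree_def regime_def prob_Dn prob_Dt' prob_Dj mem_D)

lemma prob_D12_hit: "A \<in> sets (F n) \<Longrightarrow> prob (C {(Suc n, Suc n)} \<inter> A) = (1 - p1) * prob (C (D12 n) \<inter> A)"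
  by (rule transfer[where n=n]) (auto simp: agree_def regime_def prob_D12 prob_pair prob_Dj mem_D)

text \<open>Pairs with different values of \<theta>1 need not agree up to n, so the state with one
  change cannot be treated by a single transfer. It is split by the value i of \<theta>1, and the
  parts are summed in \<open>prob_D1_Suc\<close> and \<open>prob_D2_Suc\<close>.\<close>

lemma
  assumes i: "i \<le> n" and A: "A \<in> sets (F n)"
  shows prob_Dt_Suc: "prob (C (Dt i (Suc n)) \<inter> A) = p2 * prob (C (Dt i n) \<inter> A)"
    and prob_Dt_hit: "prob (C {(i, Suc n)} \<inter> A) = (1 - p2) * prob (C (Dt i n) \<inter> A)"
proof -
  show "prob (C (Dt i (Suc n)) \<inter> A) = p2 * prob (C (Dt i n) \<inter> A)"
    by (rule transfer[OF _ A]) (use i in \<open>auto simp: agree_def regime_def prob_Dt' mem_D Suc_diff_le\<close>)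
  show "prob (C {(i, Suc n)} \<inter> A) = (1 - p2) * prob (C (Dt i n) \<inter> A)"
    by (rule transfer[OF _ A]) (use i in \<open>auto simp: agree_def regime_def prob_Dt' prob_pair mem_D Suc_diff_le\<close>)
qed

lemma prob_UN:
  assumes A: "A \<in> sets M" and "C D = (\<Union>i\<le>n. C (Df i))" "disjoint_family_on (\<lambda>i. C (Df i)) {..n}"
  shows "prob (C D \<inter> A) = (\<Sum>i\<le>n::nat. prob (C (Df i) \<inter> A))"
proof -
  have "C D \<inter> A = (\<Union>i\<le>n. C (Df i) \<inter> A)" using assms(2) by auto
  then show ?thesis
    using assms by (simp only:) (intro finite_measure_finite_Union, auto simp: disjoint_family_on_def)
qed

lemma prob_D1_Suc:
  assumes A: "A \<in> sets (F n)"
  shows "prob (C (D1 (Suc n)) \<inter> A) = p2 * prob (C (D1 n) \<inter> A) + (1 - p1) * prob (C (Dn n) \<inter> A)"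
proof -
  note AM = hist_sets[OF A]
  have "prob (C (D1 (Suc n)) \<inter> A) = prob (C {(j, k). j \<le> n \<and> Suc n < k} \<inter> A) + prob (C (Dt (Suc n) (Suc n)) \<inter> A)"
    by (rule prob_split[OF AM]) (auto simp: mem_C D_defs)
  also have "prob (C {(j, k). j \<le> n \<and> Suc n < k} \<inter> A) = (\<Sum>i\<le>n. prob (C (Dt i (Suc n)) \<inter> A))"
    by (rule prob_UN[OF AM]) (auto simp: mem_C D_defs disjoint_family_on_def)
  also have "\<dots> = (\<Sum>i\<le>n. p2 * prob (C (Dt i n) \<inter> A))"
    by (rule sum.cong) (use A in \<open>auto simp: prob_Dt_Suc\<close>)
  also have "\<dots> = p2 * (\<Sum>i\<le>n. prob (C (Dt i n) \<inter> A))" by (simp add: sum_distrib_left)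
  also have "(\<Sum>i\<le>n. prob (C (Dt i n) \<inter> A)) = prob (C (D1 n) \<inter> A)"
    by (rule prob_UN[OF AM, symmetric]) (auto simp: mem_C D_defs disjoint_family_on_def)
  finally show ?thesis by (simp add: prob_Dn_hit[OF A])
qed

text \<open>The second change can occur at n + 1 in two ways: after an earlier first change, or
  together with it.\<close>

lemma prob_D2_Suc:
  assumes A: "A \<in> sets (F n)"
  shows "prob (C (D2 (Suc n)) \<inter> A) = prob (C (D2 n) \<inter> A) + (1 - p2) * prob (C (D1 n) \<inter> A) + (1 - p1) * prob (C (D12 n) \<inter> A)"
proof -
  note AM = hist_sets[OF A]
  have "prob (C (D2 (Suc n)) \<inter> A) = prob (C (D2 n) \<inter> A) + prob (C {(j, k). j \<le> Suc n \<and> k = Suc n} \<inter> A)"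
    by (rule prob_split[OF AM]) (auto simp: mem_C D_defs)
  also have "prob (C {(j, k). j \<le> Suc n \<and> k = Suc n} \<inter> A) = prob (C {(j, k). j \<le> n \<and> k = Suc n} \<inter> A) + prob (C {(Suc n, Suc n)} \<inter> A)"
    by (rule prob_split[OF AM]) (auto simp: mem_C D_defs)
  also have "prob (C {(j, k). j \<le> n \<and> k = Suc n} \<inter> A) = (\<Sum>i\<le>n. prob (C {(i, Suc n)} \<inter> A))"
    by (rule prob_UN[OF AM]) (auto simp: mem_C D_defs disjoint_family_on_def)
  also have "\<dots> = (\<Sum>i\<le>n. (1 - p2) * prob (C (Dt i n) \<inter> A))"
    by (rule sum.cong) (use A in \<open>auto simp: prob_Dt_hit\<close>)
  also have "\<dots> = (1 - p2) * (\<Sum>i\<le>n. prob (C (Dt i n) \<inter> A))" by (simp add: sum_distrib_left)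
  also have "(\<Sum>i\<le>n. prob (C (Dt i n) \<inter> A)) = prob (C (D1 n) \<inter> A)"
    by (rule prob_UN[OF AM, symmetric]) (auto simp: mem_C D_defs disjoint_family_on_def)
  finally show ?thesis by (simp add: prob_D12_hit[OF A])
qed

section \<open>The filter\<close>

definition Pst :: "nat \<Rightarrow> 'a \<Rightarrow> posterior" where
  "Pst n \<omega> = (Post M \<theta>1 X n \<omega>, Post M \<theta>2 X n \<omega>, Post12 M \<theta>1 \<theta>2 X n \<omega>)"

abbreviation "Z \<equiv> \<xi> M \<theta>1 \<theta>2 X"

lemma Z_eq: "Z n \<omega> = (X (n - 1) \<omega>, X n \<omega>, Pst n \<omega>)"
  by (simp add: \<xi>_def Pst_def)

lemma hist_finite_subalgebra: "finite_measure_subalgebra M (hist M X t)"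
  by (intro finite_measure_subalgebra.intro finite_measure_subalgebra_axioms.intro
      finite_measure_axioms subalgebra_hist)

lemma integrable_indicator_event: "S \<in> sets M \<Longrightarrow> integrable M (indicator S :: 'a \<Rightarrow> real)"
  by (simp add: less_top[symmetric])

lemma set_integral_indicator_prob:
  assumes "S \<in> sets M" "A \<in> sets M"
  shows "(\<integral>\<omega>\<in>A. indicator S \<omega> \<partial>M) = prob (S \<inter> A)"
proof -
  have "(\<integral>\<omega>\<in>A. indicator S \<omega> \<partial>M) = (\<integral>\<omega>. indicator (S \<inter> A) \<omega> \<partial>M)"
    unfolding set_lebesgue_integral_def by (rule Bochner_Integration.integral_cong) (auto simp: indicator_def)
  also have "\<dots> = prob (S \<inter> A)"
    using sets.sets_into_space[OF assms(2)] by (simp add: Int_absorb2 le_infI2)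
  finally show ?thesis .
qed

lemma cond_exp_event:
  assumes S: "S \<in> sets M"
  shows "real_cond_exp M (F n) (indicator S) \<in> borel_measurable (F n)"
    and "integrable M (real_cond_exp M (F n) (indicator S))"
    and "A \<in> sets (F n) \<Longrightarrow> prob (S \<inter> A) = (\<integral>\<omega>\<in>A. real_cond_exp M (F n) (indicator S) \<omega> \<partial>M)"
proof -
  interpret S: finite_measure_subalgebra M "F n" by (rule hist_finite_subalgebra)
  show "real_cond_exp M (F n) (indicator S) \<in> borel_measurable (F n)"
    by (rule borel_measurable_cond_exp)
  show "integrable M (real_cond_exp M (F n) (indicator S))"
    by (rule S.real_cond_exp_int(1)[OF integrable_indicator_event[OF S]])
  assume A: "A \<in> sets (F n)"
  have "(\<integral>\<omega>\<in>A. real_cond_exp M (F n) (indicator S) \<omega> \<partial>M) = (\<integral>\<omega>\<in>A. indicator S \<omega> \<partial>M)"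
    by (rule S.real_cond_exp_intA[OF integrable_indicator_event[OF S] A, symmetric])
  also have "\<dots> = prob (S \<inter> A)"
    by (rule set_integral_indicator_prob[OF S hist_sets[OF A]])
  finally show "prob (S \<inter> A) = (\<integral>\<omega>\<in>A. real_cond_exp M (F n) (indicator S) \<omega> \<partial>M)" ..
qed

lemma Post_C:
  "Post M \<theta>1 X n = real_cond_exp M (F n) (indicator (C {(j, k). j \<le> n}))"
  "Post M \<theta>2 X n = real_cond_exp M (F n) (indicator (C (D2 n)))"
  "Post12 M \<theta>1 \<theta>2 X n = real_cond_exp M (F n) (indicator (C (D12 n)))"
proof -
  have "{\<omega> \<in> space M. \<theta>1 \<omega> \<le> n} = C {(j, k). j \<le> n}"
    "{\<omega> \<in> space M. \<theta>2 \<omega> \<le> n} = C (D2 n)"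
    "{\<omega> \<in> space M. \<theta>1 \<omega> = \<theta>2 \<omega> \<and> n < \<theta>1 \<omega>} = C (D12 n)"
    using theta_le by (auto simp: mem_C D_defs)
  then show "Post M \<theta>1 X n = real_cond_exp M (F n) (indicator (C {(j, k). j \<le> n}))"
    "Post M \<theta>2 X n = real_cond_exp M (F n) (indicator (C (D2 n)))"
    "Post12 M \<theta>1 \<theta>2 X n = real_cond_exp M (F n) (indicator (C (D12 n)))"
    by (simp_all add: Post_def Post12_def)
qed

lemma Pst_measurable: "Pst n \<in> borel_measurable (F n)"
  unfolding Pst_def Post_C by (intro borel_measurable_Pair cond_exp_event C_sets)

lemma Pst_coords:
  "(\<lambda>\<omega>. fst (Pst n \<omega>)) \<in> borel_measurable (F n)" "integrable M (\<lambda>\<omega>. fst (Pst n \<omega>))"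
  "(\<lambda>\<omega>. fst (snd (Pst n \<omega>))) \<in> borel_measurable (F n)" "integrable M (\<lambda>\<omega>. fst (snd (Pst n \<omega>)))"
  "(\<lambda>\<omega>. snd (snd (Pst n \<omega>))) \<in> borel_measurable (F n)" "integrable M (\<lambda>\<omega>. snd (snd (Pst n \<omega>)))"
  unfolding Pst_def Post_C fst_conv snd_conv by (intro cond_exp_event C_sets)+

lemma Pst_int:
  assumes "A \<in> sets (F n)"
  shows "(\<integral>\<omega>\<in>A. fst (Pst n \<omega>) \<partial>M) = prob (C {(j, k). j \<le> n} \<inter> A)"
    "(\<integral>\<omega>\<in>A. fst (snd (Pst n \<omega>)) \<partial>M) = prob (C (D2 n) \<inter> A)"
    "(\<integral>\<omega>\<in>A. snd (snd (Pst n \<omega>)) \<partial>M) = prob (C (D12 n) \<inter> A)"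
  unfolding Pst_def Post_C fst_conv snd_conv
  by (intro cond_exp_event(3)[symmetric] C_sets assms)+

text \<open>The defining inequalities hold between indicators of hidden events and pass to
  conditional expectations, hence almost surely only.\<close>

lemma Pst_dom: "AE \<omega> in M. Pst n \<omega> \<in> posterior_domain"
proof -
  interpret S: finite_measure_subalgebra M "F n" by (rule hist_finite_subalgebra)
  let ?e = "\<lambda>D. real_cond_exp M (F n) (indicator (C D))"
  let ?D1 = "{(j, k). j \<le> n}"
  have i: "integrable M (indicator (C D) :: 'a \<Rightarrow> real)" for D
    by (rule integrable_indicator_event) simp
  have bm: "(indicator (C D) :: 'a \<Rightarrow> real) \<in> borel_measurable M" for D
    by (rule borel_measurable_indicator[OF C_sets])
  have nn: "AE \<omega> in M. 0 \<le> ?e D \<omega>" for D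
    by (rule S.real_cond_exp_pos[OF _ bm]) simp
  have le: "AE \<omega> in M. ?e (D2 n) \<omega> \<le> ?e ?D1 \<omega>"
    by (rule S.real_cond_exp_mono[OF _ i i]) (auto intro!: AE_I2 simp: indicator_def mem_C D_defs)
  have add: "AE \<omega> in M. real_cond_exp M (F n) (\<lambda>\<omega>. indicator (C ?D1) \<omega> + indicator (C (D12 n)) \<omega>) \<omega> = ?e ?D1 \<omega> + ?e (D12 n) \<omega>"
    by (rule S.real_cond_exp_add[OF i i])
  have one: "AE \<omega> in M. real_cond_exp M (F n) (\<lambda>_. 1) \<omega> = 1"
    by (rule S.real_cond_exp_F_meas) auto
  have "AE \<omega> in M. real_cond_exp M (F n) (\<lambda>\<omega>. indicator (C ?D1) \<omega> + indicator (C (D12 n)) \<omega>) \<omega> \<le> real_cond_exp M (F n) (\<lambda>_. 1) \<omega>"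
    by (rule S.real_cond_exp_mono[OF _ Bochner_Integration.integrable_add[OF i i] integrable_const])
       (auto intro!: AE_I2 simp: indicator_def mem_C D_defs)
  with nn[of "D2 n"] nn[of "D12 n"] le add one show ?thesis
    by eventually_elim (simp add: Pst_def Post_C posterior_domain_def)
qed

lemma Z_measurable: "Z n \<in> F n \<rightarrow>\<^sub>M SM"
  unfolding Z_eq by (intro SM_Pair X_hist Pst_measurable) auto

lemma Z_dom: "AE \<omega> in M. Z n \<omega> \<in> Dom"
  using Pst_dom AE_space by eventually_elim (simp add: Z_eq Dom_def X_in_E)

text \<open>A predicted probability like \<open>c0\<close>, \<open>c1\<close>, \<open>c2\<close>,
  but of a part of the event behind \<open>c0\<close>: a simultaneous change after time n + 1. It
  drives the third coordinate of the posterior.\<close>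

definition c12 :: "posterior \<Rightarrow> real" where "c12 a = p1 * snd (snd a)"

text \<open>The predicted weights are affine in the posterior, so one formula integrates all of
  them.\<close>

lemma set_integral_lin:
  assumes A: "A \<in> sets (F n)"
  shows "(\<integral>\<omega>\<in>A. a + b * fst (Pst n \<omega>) + c * fst (snd (Pst n \<omega>)) + d * snd (snd (Pst n \<omega>)) \<partial>M) =
    a * prob A + b * prob (C {(j, k). j \<le> n} \<inter> A) + c * prob (C (D2 n) \<inter> A) + d * prob (C (D12 n) \<inter> A)"
proof -
  have AM: "A \<in> sets M" by (rule hist_sets[OF A])
  have si: "set_integrable M A g" if "integrable M g" for g :: "'a \<Rightarrow> real"
    unfolding set_integrable_def by (rule integrable_mult_indicator[OF AM that])
  have s1: "set_integrable M A (\<lambda>\<omega>. a)" by (rule si) simp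
  have s2: "set_integrable M A (\<lambda>\<omega>. b * fst (Pst n \<omega>))" by (rule si) (intro integrable_mult_right Pst_coords)
  have s3: "set_integrable M A (\<lambda>\<omega>. c * fst (snd (Pst n \<omega>)))" by (rule si) (intro integrable_mult_right Pst_coords)
  have s4: "set_integrable M A (\<lambda>\<omega>. d * snd (snd (Pst n \<omega>)))" by (rule si) (intro integrable_mult_right Pst_coords)
  have "(\<integral>\<omega>\<in>A. a \<partial>M) = a * prob A"
    using AM sets.sets_into_space[OF AM] by (simp add: set_lebesgue_integral_def Int_absorb2 mult.commute)
  then show ?thesis
    by (simp add: set_integral_add(2) set_integral_add(1) s1 s2 s3 s4 Pst_int[OF A])
qed

text \<open>The prediction step. Transitions of the hidden state multiply probabilities of present
  hidden states on A, and these are integrals of affine functions of the posterior.\<close>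

lemma weights:
  assumes A: "A \<in> sets (F n)"
  shows "prob (C (D0 (Suc n)) \<inter> A) = (\<integral>\<omega>\<in>A. c0 (Pst n \<omega>) \<partial>M)"
    and "prob (C (D1 (Suc n)) \<inter> A) = (\<integral>\<omega>\<in>A. c1 (Pst n \<omega>) \<partial>M)"
    and "prob (C (D2 (Suc n)) \<inter> A) = (\<integral>\<omega>\<in>A. c2 (Pst n \<omega>) \<partial>M)"
    and "prob (C (D12 (Suc n)) \<inter> A) = (\<integral>\<omega>\<in>A. c12 (Pst n \<omega>) \<partial>M)"
proof -
  have AM: "A \<in> sets M" by (rule hist_sets[OF A])
  have As: "A \<subseteq> space M" by (rule sets.sets_into_space[OF AM])
  let ?J = "{(j::nat, k::nat). j \<le> n}"
  have "C UNIV \<inter> A = C ?J \<inter> A \<union> C (D0 n) \<inter> A" by (auto simp: mem_C D_defs)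
  then have "prob (C UNIV \<inter> A) = prob (C ?J \<inter> A) + prob (C (D0 n) \<inter> A)"
    by (intro prob_split[OF AM]) (auto simp: mem_C D_defs)
  moreover have "C UNIV \<inter> A = A" using As by (auto simp: mem_C)
  ultimately have 1: "prob (C (D0 n) \<inter> A) = prob A - prob (C ?J \<inter> A)" by simp
  have *: "prob (C ?J \<inter> A) = prob (C (D2 n) \<inter> A) + prob (C (D1 n) \<inter> A)"
    by (rule prob_split[OF AM]) (use theta_le' in \<open>fastforce simp: mem_C D_defs\<close>)+
  have **: "prob (C (D0 n) \<inter> A) = prob (C (D12 n) \<inter> A) + prob (C (Dn n) \<inter> A)"
    by (rule prob_split[OF AM]) (use theta_le' in \<open>fastforce simp: mem_C D_defs le_less\<close>)+
  have 2: "prob (C (D1 n) \<inter> A) = prob (C ?J \<inter> A) - prob (C (D2 n) \<inter> A)"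
    using * by simp
  have 3: "prob (C (Dn n) \<inter> A) = prob A - prob (C ?J \<inter> A) - prob (C (D12 n) \<inter> A)"
    using ** 1 by simp
  show "prob (C (D0 (Suc n)) \<inter> A) = (\<integral>\<omega>\<in>A. c0 (Pst n \<omega>) \<partial>M)"
  proof -
    have "(\<integral>\<omega>\<in>A. c0 (Pst n \<omega>) \<partial>M) = (\<integral>\<omega>\<in>A. p1 + (- p1) * fst (Pst n \<omega>) + 0 * fst (snd (Pst n \<omega>)) + 0 * snd (snd (Pst n \<omega>)) \<partial>M)"
      by (intro arg_cong2[where f="set_lebesgue_integral M"] refl ext) (simp add: c0_def algebra_simps)
    then show ?thesis
      unfolding prob_D0_Suc[OF A] set_integral_lin[OF A] 1 by (simp add: algebra_simps)
  qed
  have "(\<integral>\<omega>\<in>A. c1 (Pst n \<omega>) \<partial>M) = (\<integral>\<omega>\<in>A. (1 - p1) + (p2 - (1 - p1)) * fst (Pst n \<omega>) + (- p2) * fst (snd (Pst n \<omega>)) + (- (1 - p1)) * snd (snd (Pst n \<omega>)) \<partial>M)"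
    by (intro arg_cong2[where f="set_lebesgue_integral M"] refl ext) (simp add: c1_def algebra_simps)
  then show "prob (C (D1 (Suc n)) \<inter> A) = (\<integral>\<omega>\<in>A. c1 (Pst n \<omega>) \<partial>M)"
    unfolding prob_D1_Suc[OF A] set_integral_lin[OF A] 2 3 by (simp add: algebra_simps)
  have "(\<integral>\<omega>\<in>A. c2 (Pst n \<omega>) \<partial>M) = (\<integral>\<omega>\<in>A. 0 + (1 - p2) * fst (Pst n \<omega>) + p2 * fst (snd (Pst n \<omega>)) + (1 - p1) * snd (snd (Pst n \<omega>)) \<partial>M)"
    by (intro arg_cong2[where f="set_lebesgue_integral M"] refl ext) (simp add: c2_def)
  then show "prob (C (D2 (Suc n)) \<inter> A) = (\<integral>\<omega>\<in>A. c2 (Pst n \<omega>) \<partial>M)"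
    unfolding prob_D2_Suc[OF A] set_integral_lin[OF A] 2 by (simp add: algebra_simps)
  show "prob (C (D12 (Suc n)) \<inter> A) = (\<integral>\<omega>\<in>A. c12 (Pst n \<omega>) \<partial>M)"
    unfolding prob_D12_Suc[OF A] using set_integral_lin[OF A, of 0 0 0 p1]
    by (auto simp: c12_def)
qed

text \<open>Says that t of the posterior is a version of the conditional probability of the hidden
  event given \<open>F n\<close>, in the extended nonnegative form that \<open>one_step\<close>
  uses. Signs are controlled on the posterior domain only.\<close>

definition is_weight :: "nat \<Rightarrow> (nat \<times> nat) set \<Rightarrow> (posterior \<Rightarrow> real) \<Rightarrow> bool" where
  "is_weight n D t \<longleftrightarrow> (\<lambda>\<omega>. t (Pst n \<omega>)) \<in> borel_measurable (F n) \<and> (\<forall>a\<in>posterior_domain. 0 \<le> t a) \<and>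
     (\<forall>A\<in>sets (F n). emeasure M (C D \<inter> A) = (\<integral>\<^sup>+\<omega>\<in>A. ennreal (t (Pst n \<omega>)) \<partial>M))"

lemma is_weightI:
  assumes m: "(\<lambda>\<omega>. t (Pst n \<omega>)) \<in> borel_measurable (F n)" and i: "integrable M (\<lambda>\<omega>. t (Pst n \<omega>))"
    and nn: "\<And>a. a \<in> posterior_domain \<Longrightarrow> 0 \<le> t a"
    and eq: "\<And>A. A \<in> sets (F n) \<Longrightarrow> prob (C D \<inter> A) = (\<integral>\<omega>\<in>A. t (Pst n \<omega>) \<partial>M)"
  shows "is_weight n D t"
  unfolding is_weight_def
proof (intro conjI ballI m nn)
  fix A assume A: "A \<in> sets (F n)"
  have AM: "A \<in> sets M" by (rule hist_sets[OF A])
  have "(\<integral>\<^sup>+\<omega>. ennreal (indicator A \<omega> *\<^sub>R t (Pst n \<omega>)) \<partial>M) = ennreal (\<integral>\<omega>\<in>A. t (Pst n \<omega>) \<partial>M)"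
    unfolding set_lebesgue_integral_def
  proof (rule nn_integral_eq_integral[OF integrable_mult_indicator[OF AM i]])
    show "AE \<omega> in M. 0 \<le> indicator A \<omega> *\<^sub>R t (Pst n \<omega>)"
      using Pst_dom[of n] by eventually_elim (simp add: nn)
  qed
  also have "\<dots> = emeasure M (C D \<inter> A)" by (simp add: eq[OF A] emeasure_eq_measure)
  also have "(\<lambda>\<omega>. ennreal (indicator A \<omega> *\<^sub>R t (Pst n \<omega>))) = (\<lambda>\<omega>. ennreal (t (Pst n \<omega>)) * indicator A \<omega>)"
    by (simp add: fun_eq_iff indicator_def)
  finally show "emeasure M (C D \<inter> A) = (\<integral>\<^sup>+\<omega>\<in>A. ennreal (t (Pst n \<omega>)) \<partial>M)" ..
qed

lemma is_weights:
  "is_weight n (D0 (Suc n)) c0" "is_weight n (D1 (Suc n)) c1" "is_weight n (D2 (Suc n)) c2"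
  "is_weight n (D12 (Suc n)) c12"
proof -
  have [simp]: "0 \<le> c12 a" if "a \<in> posterior_domain" for a
    using that p1_range by (auto simp: c12_def posterior_domain_def)
  show "is_weight n (D0 (Suc n)) c0"
  proof (rule is_weightI[OF _ _ _ weights(1)])
    show "(\<lambda>\<omega>. c0 (Pst n \<omega>)) \<in> borel_measurable (F n)" "integrable M (\<lambda>\<omega>. c0 (Pst n \<omega>))"
      unfolding c0_def by (intro real_measurable
        integrable_mult_left Bochner_Integration.integrable_diff integrable_const Pst_coords)+
  qed (simp_all add: c_nonneg)
  show "is_weight n (D1 (Suc n)) c1"
  proof (rule is_weightI[OF _ _ _ weights(2)])
    show "(\<lambda>\<omega>. c1 (Pst n \<omega>)) \<in> borel_measurable (F n)" "integrable M (\<lambda>\<omega>. c1 (Pst n \<omega>))"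
      unfolding c1_def by (intro real_measurable
        integrable_mult_right Bochner_Integration.integrable_diff Bochner_Integration.integrable_add integrable_const Pst_coords)+
  qed (simp_all add: c_nonneg)
  show "is_weight n (D2 (Suc n)) c2"
  proof (rule is_weightI[OF _ _ _ weights(3)])
    show "(\<lambda>\<omega>. c2 (Pst n \<omega>)) \<in> borel_measurable (F n)" "integrable M (\<lambda>\<omega>. c2 (Pst n \<omega>))"
      unfolding c2_def by (intro real_measurable
        integrable_mult_right Bochner_Integration.integrable_diff Bochner_Integration.integrable_add integrable_const Pst_coords)+
  qed (simp_all add: c_nonneg)
  show "is_weight n (D12 (Suc n)) c12"
  proof (rule is_weightI[OF _ _ _ weights(4)])
    show "(\<lambda>\<omega>. c12 (Pst n \<omega>)) \<in> borel_measurable (F n)" "integrable M (\<lambda>\<omega>. c12 (Pst n \<omega>))"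
      unfolding c12_def by (intro real_measurable integrable_mult_right Pst_coords)+
  qed simp_all
qed

lemma nn_integral_K_scaled:
  assumes "r < 3" "z \<in> E" "0 \<le> t" and g: "g \<in> borel_measurable \<mu>"
  shows "ennreal t * (\<integral>\<^sup>+u. g u \<partial>K r z) = (\<integral>\<^sup>+u. ennreal (t * f r z u) * g u \<partial>\<mu>)"
proof -
  have fs: "(\<lambda>u. ennreal (f r z u)) \<in> borel_measurable \<mu>"
    by (rule measurable_compose[OF f_section[OF assms(1,2)] measurable_ennreal])
  have "(\<integral>\<^sup>+u. ennreal (t * f r z u) * g u \<partial>\<mu>) = (\<integral>\<^sup>+u. ennreal t * (ennreal (f r z u) * g u) \<partial>\<mu>)"
    using assms(3) by (simp add: ennreal_mult' mult.assoc)
  also have "\<dots> = ennreal t * (\<integral>\<^sup>+u. ennreal (f r z u) * g u \<partial>\<mu>)"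
    by (intro nn_integral_cmult borel_measurable_times_ennreal fs g)
  finally show ?thesis unfolding nn_integral_K[OF assms(1,2) g] ..
qed

lemma section_G:
  assumes "G \<in> borel_measurable (FX n)" "\<omega> \<in> space M"
  shows "(\<lambda>u. G (\<omega>, u)) \<in> borel_measurable \<mu>"
  by (rule measurable_compose[OF measurable_Pair1' assms(1)]) (use assms in simp)

lemma weight_step:
  assumes w: "is_weight n D t" and r: "r < 3" and D: "\<And>j k. (j, k) \<in> D \<Longrightarrow> regime j k (Suc n) = r"
    and G: "G \<in> borel_measurable (FX n)"
  shows "(\<integral>\<^sup>+\<omega>. indicator (C D) \<omega> * G (\<omega>, X (Suc n) \<omega>) \<partial>M) =
    (\<integral>\<^sup>+\<omega>. ennreal (t (Pst n \<omega>)) * (\<integral>\<^sup>+u. G (\<omega>, u) \<partial>K r (X n \<omega>)) \<partial>M)"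
  by (rule one_step[OF r _ _ _ G]) (use w D in \<open>auto simp: is_weight_def\<close>)

lemma H_sum_ennreal:
  assumes "a \<in> posterior_domain" "z \<in> E" "u \<in> E"
  shows "ennreal (c0 a * f 0 z u) + ennreal (c1 a * f 1 z u) + ennreal (c2 a * f 2 z u) = ennreal (H z u a)"
  unfolding H_eq using c_nonneg[OF assms(1)] f_nonneg[OF _ assms(2,3)]
  by (simp add: ennreal_plus[symmetric] del: ennreal_plus)

lemma regime_D:
  "(j, k) \<in> D0 (Suc n) \<Longrightarrow> regime j k (Suc n) = 0"
  "(j, k) \<in> D12 (Suc n) \<Longrightarrow> regime j k (Suc n) = 0"
  "(j, k) \<in> D1 (Suc n) \<Longrightarrow> regime j k (Suc n) = 1"
  "(j, k) \<in> D2 (Suc n) \<Longrightarrow> regime j k (Suc n) = 2"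
  by (auto simp: D_defs regime_def)

text \<open>At time n + 1 exactly one of the states no change, one change, both changes holds, and
  each has its own kernel. Weighted by the predicted probabilities, the three densities add up to
  \<open>H\<close>.\<close>

lemma total_step:
  assumes G: "G \<in> borel_measurable (FX n)"
  shows "(\<integral>\<^sup>+\<omega>. G (\<omega>, X (Suc n) \<omega>) \<partial>M) =
    (\<integral>\<^sup>+\<omega>. \<integral>\<^sup>+u. ennreal (H (X n \<omega>) u (Pst n \<omega>)) * G (\<omega>, u) \<partial>\<mu> \<partial>M)"
proof -
  let ?g = "\<lambda>\<omega>. G (\<omega>, X (Suc n) \<omega>)"
  have gm: "?g \<in> borel_measurable M"
    by (rule measurable_compose[OF measurable_Pair[OF subalgebra_ident[OF subalgebra_hist] X_measurable] G])
  have im: "(\<lambda>\<omega>. indicator (C D) \<omega> * ?g \<omega>) \<in> borel_measurable M" for D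
    by (intro borel_measurable_times_ennreal gm borel_measurable_indicator C_sets)
  have w: "\<And>D t. is_weight n D t \<Longrightarrow> (\<lambda>\<omega>. t (Pst n \<omega>)) \<in> borel_measurable (F n)"
    by (simp add: is_weight_def)
  have tm: "(\<lambda>\<omega>. ennreal (t (Pst n \<omega>)) * (\<integral>\<^sup>+u. G (\<omega>, u) \<partial>K r (X n \<omega>))) \<in> borel_measurable M"
    if "is_weight n D t" "r < 3" for D t r
    by (rule hist_meas[of _ "enat n"])
       (intro borel_measurable_times_ennreal measurable_compose[OF w[OF that(1)] measurable_ennreal] KX_nn_integral that G)
  have "(\<integral>\<^sup>+\<omega>. ?g \<omega> \<partial>M) = (\<integral>\<^sup>+\<omega>. indicator (C (D0 (Suc n))) \<omega> * ?g \<omega> + indicator (C (D1 (Suc n))) \<omega> * ?g \<omega>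
      + indicator (C (D2 (Suc n))) \<omega> * ?g \<omega> \<partial>M)"
  proof (rule nn_integral_cong)
    fix \<omega> assume "\<omega> \<in> space M"
    then show "?g \<omega> = indicator (C (D0 (Suc n))) \<omega> * ?g \<omega> + indicator (C (D1 (Suc n))) \<omega> * ?g \<omega>
      + indicator (C (D2 (Suc n))) \<omega> * ?g \<omega>"
      using theta_le[of \<omega>] by (auto simp: indicator_def mem_C D_defs not_le)
  qed
  also have "\<dots> = (\<integral>\<^sup>+\<omega>. indicator (C (D0 (Suc n))) \<omega> * ?g \<omega> \<partial>M) + (\<integral>\<^sup>+\<omega>. indicator (C (D1 (Suc n))) \<omega> * ?g \<omega> \<partial>M)
      + (\<integral>\<^sup>+\<omega>. indicator (C (D2 (Suc n))) \<omega> * ?g \<omega> \<partial>M)"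
    by (simp add: nn_integral_add im borel_measurable_add)
  also have "\<dots> = (\<integral>\<^sup>+\<omega>. ennreal (c0 (Pst n \<omega>)) * (\<integral>\<^sup>+u. G (\<omega>, u) \<partial>K 0 (X n \<omega>)) \<partial>M)
     + (\<integral>\<^sup>+\<omega>. ennreal (c1 (Pst n \<omega>)) * (\<integral>\<^sup>+u. G (\<omega>, u) \<partial>K 1 (X n \<omega>)) \<partial>M)
     + (\<integral>\<^sup>+\<omega>. ennreal (c2 (Pst n \<omega>)) * (\<integral>\<^sup>+u. G (\<omega>, u) \<partial>K 2 (X n \<omega>)) \<partial>M)"
    using weight_step[OF is_weights(1) _ regime_D(1) G] weight_step[OF is_weights(2) _ regime_D(3) G]
      weight_step[OF is_weights(3) _ regime_D(4) G] by simp
  also have "\<dots> = (\<integral>\<^sup>+\<omega>. ennreal (c0 (Pst n \<omega>)) * (\<integral>\<^sup>+u. G (\<omega>, u) \<partial>K 0 (X n \<omega>))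
     + ennreal (c1 (Pst n \<omega>)) * (\<integral>\<^sup>+u. G (\<omega>, u) \<partial>K 1 (X n \<omega>))
     + ennreal (c2 (Pst n \<omega>)) * (\<integral>\<^sup>+u. G (\<omega>, u) \<partial>K 2 (X n \<omega>)) \<partial>M)"
    using tm[OF is_weights(1), of 0] tm[OF is_weights(2), of 1] tm[OF is_weights(3), of 2]
    by (simp add: nn_integral_add borel_measurable_add)
  also have "\<dots> = (\<integral>\<^sup>+\<omega>. \<integral>\<^sup>+u. ennreal (H (X n \<omega>) u (Pst n \<omega>)) * G (\<omega>, u) \<partial>\<mu> \<partial>M)"
  proof (rule nn_integral_cong_AE, use Pst_dom[of n] AE_space in eventually_elim)
    case (elim \<omega>)
    let ?z = "X n \<omega>" and ?a = "Pst n \<omega>"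
    have z: "?z \<in> E" using elim X_in_E by simp
    note Gs = section_G[OF G elim(2)]
    have ms: "(\<lambda>u. ennreal (t * f r ?z u) * G (\<omega>, u)) \<in> borel_measurable \<mu>" if "r < 3" for t r
      by (intro borel_measurable_times_ennreal Gs measurable_compose[OF _ measurable_ennreal]
          real_measurable f_section that z)
    have "(\<integral>\<^sup>+u. ennreal (H ?z u ?a) * G (\<omega>, u) \<partial>\<mu>) = (\<integral>\<^sup>+u. ennreal (c0 ?a * f 0 ?z u) * G (\<omega>, u)
        + ennreal (c1 ?a * f 1 ?z u) * G (\<omega>, u) + ennreal (c2 ?a * f 2 ?z u) * G (\<omega>, u) \<partial>\<mu>)"
      by (rule nn_integral_cong) (simp add: H_sum_ennreal[OF elim(1) z, symmetric] distrib_right)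
    also have "\<dots> = (\<integral>\<^sup>+u. ennreal (c0 ?a * f 0 ?z u) * G (\<omega>, u) \<partial>\<mu>)
        + (\<integral>\<^sup>+u. ennreal (c1 ?a * f 1 ?z u) * G (\<omega>, u) \<partial>\<mu>) + (\<integral>\<^sup>+u. ennreal (c2 ?a * f 2 ?z u) * G (\<omega>, u) \<partial>\<mu>)"
      using ms[of 0] ms[of 1] ms[of 2] by (simp add: nn_integral_add borel_measurable_add)
    finally show ?case
      using c_nonneg[OF elim(1)] by (simp add: nn_integral_K_scaled[OF _ z _ Gs])
  qed
  finally show ?thesis .
qed

lemma hist_Suc_meas: "g \<in> F n \<rightarrow>\<^sub>M N \<Longrightarrow> g \<in> F (Suc n) \<rightarrow>\<^sub>M N"
  by (rule measurable_from_subalg[OF sub_hist[of n "Suc n"]]) simp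

text \<open>Bayes' formula. An event of the next history is a set of pairs (\<omega>, u) with u the
  next observation. On it the hidden event has joint density t times \<open>f r\<close> by
  \<open>weight_step\<close>, the quotient q has density \<open>H\<close> times q by
  \<open>total_step\<close>, and the two coincide.\<close>

lemma filter_update:
  assumes w: "is_weight n D t" and r: "r < 3" and D: "\<And>j k. (j, k) \<in> D \<Longrightarrow> regime j k (Suc n) = r"
  shows "AE \<omega> in M. real_cond_exp M (F (Suc n)) (indicator (C D)) \<omega> =
    t (Pst n \<omega>) * f r (X n \<omega>) (X (Suc n) \<omega>) / H (X n \<omega>) (X (Suc n) \<omega>) (Pst n \<omega>)"
proof -
  interpret S: finite_measure_subalgebra M "F (Suc n)" by (rule hist_finite_subalgebra)
  define q where "q \<omega> u = t (Pst n \<omega>) * f r (X n \<omega>) u / H (X n \<omega>) u (Pst n \<omega>)" for \<omega> u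
  have tw: "(\<lambda>\<omega>. t (Pst n \<omega>)) \<in> borel_measurable (F n)" and tn: "\<And>a. a \<in> posterior_domain \<Longrightarrow> 0 \<le> t a"
    using w by (auto simp: is_weight_def)
  have qm: "(\<lambda>\<omega>. q \<omega> (X (Suc n) \<omega>)) \<in> borel_measurable (F (Suc n))"
    unfolding q_def
    by (intro real_measurable hist_Suc_meas[OF tw] f_measurable r H_measurable
        hist_Suc_meas[OF Pst_measurable] X_hist) simp_all
  have qp: "(\<lambda>p. q (fst p) (snd p)) \<in> borel_measurable (FX n)"
    unfolding q_def
    by (intro real_measurable measurable_compose[OF measurable_fst tw]
        f_measurable r H_measurable measurable_compose[OF measurable_fst Pst_measurable]
        measurable_compose[OF measurable_fst X_hist[OF order_refl]] measurable_snd)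
  have q0: "AE \<omega> in M. 0 \<le> q \<omega> (X (Suc n) \<omega>)"
    using Pst_dom[of n] AE_space
    by eventually_elim (auto simp: q_def intro!: divide_nonneg_nonneg mult_nonneg_nonneg tn f_nonneg r H_nonneg X_in_E)
  have eq: "emeasure M (C D \<inter> A) = (\<integral>\<^sup>+\<omega>. ennreal (q \<omega> (X (Suc n) \<omega>)) * indicator A \<omega> \<partial>M)"
    if A: "A \<in> sets (F (Suc n))" for A
  proof -
    obtain S where S: "S \<in> sets (FX n)" and Aeq: "A = {\<omega> \<in> space M. (\<omega>, X (Suc n) \<omega>) \<in> S}"
      using hist_Suc[OF A] .
    have iS: "(indicator S :: _ \<Rightarrow> ennreal) \<in> borel_measurable (FX n)" using S by simp
    have qS: "(\<lambda>p. ennreal (q (fst p) (snd p)) * indicator S p) \<in> borel_measurable (FX n)"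
      by (intro borel_measurable_times_ennreal iS measurable_compose[OF qp measurable_ennreal])
    have "emeasure M (C D \<inter> A) = (\<integral>\<^sup>+\<omega>. indicator (C D) \<omega> * indicator A \<omega> \<partial>M)"
      by (rule emeasure_C_Int[OF hist_sets[OF A]])
    also have "\<dots> = (\<integral>\<^sup>+\<omega>. indicator (C D) \<omega> * indicator S (\<omega>, X (Suc n) \<omega>) \<partial>M)"
      by (rule nn_integral_cong) (simp add: Aeq indicator_def)
    also have "\<dots> = (\<integral>\<^sup>+\<omega>. ennreal (t (Pst n \<omega>)) * (\<integral>\<^sup>+u. indicator S (\<omega>, u) \<partial>K r (X n \<omega>)) \<partial>M)"
      by (rule weight_step[OF w r _ iS]) (rule D)
    also have "\<dots> = (\<integral>\<^sup>+\<omega>. \<integral>\<^sup>+u. ennreal (H (X n \<omega>) u (Pst n \<omega>)) * (ennreal (q \<omega> u) * indicator S (\<omega>, u)) \<partial>\<mu> \<partial>M)"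
    proof (rule nn_integral_cong_AE, use Pst_dom[of n] AE_space in eventually_elim)
      case (elim \<omega>)
      let ?z = "X n \<omega>" and ?a = "Pst n \<omega>"
      have z: "?z \<in> E" using elim X_in_E by simp
      have "ennreal (t ?a) * (\<integral>\<^sup>+u. indicator S (\<omega>, u) \<partial>K r ?z) = (\<integral>\<^sup>+u. ennreal (t ?a * f r ?z u) * indicator S (\<omega>, u) \<partial>\<mu>)"
        by (rule nn_integral_K_scaled[OF r z tn[OF elim(1)] section_G[OF iS elim(2)]])
      also have "\<dots> = (\<integral>\<^sup>+u. ennreal (H ?z u ?a) * (ennreal (q \<omega> u) * indicator S (\<omega>, u)) \<partial>\<mu>)"
      proof (rule nn_integral_cong)
        fix u assume "u \<in> space \<mu>"
        then have u: "u \<in> E" by simp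
        \<comment> \<open>Where \<open>H\<close> vanishes, so does the density on the right, by
          \<open>H_zero\<close>.\<close>
        have "H ?z u ?a * q \<omega> u = t ?a * f r ?z u"
          using H_zero[OF elim(1) z u _ r] by (cases "H ?z u ?a = 0") (simp_all add: q_def)
        then have "ennreal (t ?a * f r ?z u) = ennreal (H ?z u ?a) * ennreal (q \<omega> u)"
          using H_nonneg[OF elim(1) z u] by (metis ennreal_mult')
        then show "ennreal (t ?a * f r ?z u) * indicator S (\<omega>, u) = ennreal (H ?z u ?a) * (ennreal (q \<omega> u) * indicator S (\<omega>, u))"
          by (simp add: mult.assoc)
      qed
      finally show ?case .
    qed
    also have "\<dots> = (\<integral>\<^sup>+\<omega>. ennreal (q \<omega> (X (Suc n) \<omega>)) * indicator S (\<omega>, X (Suc n) \<omega>) \<partial>M)"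
      using total_step[OF qS] by simp
    also have "\<dots> = (\<integral>\<^sup>+\<omega>. ennreal (q \<omega> (X (Suc n) \<omega>)) * indicator A \<omega> \<partial>M)"
      by (rule nn_integral_cong) (simp add: Aeq indicator_def)
    finally show ?thesis .
  qed
  note qM = hist_meas[OF qm]
  have iq: "integrable M (\<lambda>\<omega>. q \<omega> (X (Suc n) \<omega>))"
  proof (rule integrableI_nonneg[OF qM q0])
    have "(\<integral>\<^sup>+\<omega>. ennreal (q \<omega> (X (Suc n) \<omega>)) \<partial>M) = (\<integral>\<^sup>+\<omega>. ennreal (q \<omega> (X (Suc n) \<omega>)) * indicator (space M) \<omega> \<partial>M)"
      by (rule nn_integral_cong) simp
    also have "\<dots> = emeasure M (C D \<inter> space M)" using eq[of "space M"] sets.top[of "F (Suc n)"] by simp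
    finally show "(\<integral>\<^sup>+\<omega>. ennreal (q \<omega> (X (Suc n) \<omega>)) \<partial>M) < \<infinity>" by (simp add: less_top[symmetric])
  qed
  have "AE \<omega> in M. real_cond_exp M (F (Suc n)) (indicator (C D)) \<omega> = q \<omega> (X (Suc n) \<omega>)"
  proof (rule S.real_cond_exp_charact[OF _ integrable_indicator_event[OF C_sets] iq qm])
    fix A assume A: "A \<in> sets (F (Suc n))"
    note AM = hist_sets[OF A]
    have "(\<integral>\<omega>\<in>A. indicator (C D) \<omega> \<partial>M) = prob (C D \<inter> A)"
      by (rule set_integral_indicator_prob[OF C_sets AM])
    also have "\<dots> = (\<integral>\<omega>\<in>A. q \<omega> (X (Suc n) \<omega>) \<partial>M)"
    proof -
      have ii: "integrable M (\<lambda>\<omega>. indicator A \<omega> *\<^sub>R q \<omega> (X (Suc n) \<omega>))"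
        by (rule integrable_mult_indicator[OF AM iq])
      have i0: "AE \<omega> in M. 0 \<le> indicator A \<omega> *\<^sub>R q \<omega> (X (Suc n) \<omega>)"
        using q0 by eventually_elim simp
      have "ennreal (prob (C D \<inter> A)) = (\<integral>\<^sup>+\<omega>. ennreal (indicator A \<omega> *\<^sub>R q \<omega> (X (Suc n) \<omega>)) \<partial>M)"
      proof -
        have "(\<lambda>\<omega>. ennreal (indicator A \<omega> *\<^sub>R q \<omega> (X (Suc n) \<omega>))) = (\<lambda>\<omega>. ennreal (q \<omega> (X (Suc n) \<omega>)) * indicator A \<omega>)"
          by (simp add: fun_eq_iff indicator_def)
        then show ?thesis using eq[OF A] by (simp add: emeasure_eq_measure)
      qed
      also have "\<dots> = ennreal (\<integral>\<omega>\<in>A. q \<omega> (X (Suc n) \<omega>) \<partial>M)"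
        unfolding set_lebesgue_integral_def by (rule nn_integral_eq_integral[OF ii i0])
      finally show ?thesis
        using integral_nonneg_AE[OF i0] by (simp add: set_lebesgue_integral_def)
    qed
    finally show "(\<integral>\<omega>\<in>A. indicator (C D) \<omega> \<partial>M) = (\<integral>\<omega>\<in>A. q \<omega> (X (Suc n) \<omega>) \<partial>M)" .
  qed
  then show ?thesis by (simp add: q_def)
qed

text \<open>\<open>filter_update\<close> requires a single regime on the hidden event, whereas
  \<theta>1 \<le> n + 1 covers regimes 1 and 2. The first coordinate is therefore computed from the
  complementary event of no change.\<close>

lemma Pst_Suc: "AE \<omega> in M. Pst (Suc n) \<omega> = Pim (X n \<omega>) (X (Suc n) \<omega>) (Pst n \<omega>)"
proof -
  interpret S: finite_measure_subalgebra M "F (Suc n)" by (rule hist_finite_subalgebra)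
  have i: "integrable M (indicator (C D) :: 'a \<Rightarrow> real)" for D
    by (rule integrable_indicator_event) simp
  have u: "AE \<omega> in M. real_cond_exp M (F (Suc n)) (indicator (C {(j, k). j \<le> Suc n})) \<omega>
      = real_cond_exp M (F (Suc n)) (\<lambda>\<omega>. 1 - indicator (C (D0 (Suc n))) \<omega>) \<omega>"
  proof (rule S.real_cond_exp_cong)
    show "AE \<omega> in M. indicator (C {(j, k). j \<le> Suc n}) \<omega> = (1 - indicator (C (D0 (Suc n))) \<omega> :: real)"
      by (rule AE_I2) (auto simp: indicator_def mem_C D_defs)
  qed (intro real_measurable borel_measurable_indicator C_sets)+
  have d: "AE \<omega> in M. real_cond_exp M (F (Suc n)) (\<lambda>\<omega>. 1 - indicator (C (D0 (Suc n))) \<omega>) \<omega>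
      = real_cond_exp M (F (Suc n)) (\<lambda>_. 1) \<omega> - real_cond_exp M (F (Suc n)) (indicator (C (D0 (Suc n)))) \<omega>"
    by (rule S.real_cond_exp_diff[OF integrable_const i])
  have one: "AE \<omega> in M. real_cond_exp M (F (Suc n)) (\<lambda>_. 1) \<omega> = 1"
    by (rule S.real_cond_exp_F_meas) auto
  have "AE \<omega> in M. real_cond_exp M (F (Suc n)) (indicator (C (D0 (Suc n)))) \<omega> =
      c0 (Pst n \<omega>) * f 0 (X n \<omega>) (X (Suc n) \<omega>) / H (X n \<omega>) (X (Suc n) \<omega>) (Pst n \<omega>)"
    by (rule filter_update[OF is_weights(1)]) (simp_all add: regime_D)
  moreover have "AE \<omega> in M. real_cond_exp M (F (Suc n)) (indicator (C (D2 (Suc n)))) \<omega> =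
      c2 (Pst n \<omega>) * f 2 (X n \<omega>) (X (Suc n) \<omega>) / H (X n \<omega>) (X (Suc n) \<omega>) (Pst n \<omega>)"
    by (rule filter_update[OF is_weights(3)]) (simp_all add: regime_D)
  moreover have "AE \<omega> in M. real_cond_exp M (F (Suc n)) (indicator (C (D12 (Suc n)))) \<omega> =
      c12 (Pst n \<omega>) * f 0 (X n \<omega>) (X (Suc n) \<omega>) / H (X n \<omega>) (X (Suc n) \<omega>) (Pst n \<omega>)"
    by (rule filter_update[OF is_weights(4)]) (simp_all add: regime_D)
  ultimately show ?thesis
    using u d one
    by eventually_elim (simp add: Pst_def[of "Suc n"] Post_C Pi_eq c12_def)
qed

text \<open>\<open>F 0\<close> is trivial up to null sets, so conditional probabilities given it are
  the prior ones.\<close>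

lemma Pst_0: "AE \<omega> in M. Pst 0 \<omega> = (\<pi>, \<rho> * \<pi>, \<rho> * (1 - \<pi>))"
proof -
  interpret S: finite_measure_subalgebra M "F 0" by (rule hist_finite_subalgebra)
  have e: "AE \<omega> in M. real_cond_exp M (F 0) (indicator (C D)) \<omega> = prob (C D)" for D
  proof (rule S.real_cond_exp_charact[OF _ integrable_indicator_event[OF C_sets] integrable_const borel_measurable_const])
    fix A assume A: "A \<in> sets (F 0)"
    note AM = hist_sets[OF A]
    note 1 = set_integral_indicator_prob[OF C_sets AM, of D]
    have 2: "(\<integral>\<omega>\<in>A. prob (C D) \<partial>M) = prob (C D) * prob A"
      using AM sets.sets_into_space[OF AM] by (simp add: set_lebesgue_integral_def Int_absorb2 mult.commute)
    have "prob (C D \<inter> A) = prob (C D) * prob A"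
      using hist_0[OF A]
    proof
      assume ae: "AE \<omega> in M. \<omega> \<in> A"
      have "prob (C D \<inter> A) = prob (C D)"
        by (rule finite_measure_eq_AE) (use ae AM in auto)
      moreover have "prob A = 1" using ae AM by (simp add: prob_eq_1)
      ultimately show ?thesis by simp
    next
      assume ae: "AE \<omega> in M. \<omega> \<notin> A"
      have "prob (C D \<inter> A) = prob {}"
        by (rule finite_measure_eq_AE) (use ae AM in auto)
      moreover have "prob A = 0" using ae AM by (simp add: prob_eq_0)
      ultimately show ?thesis by simp
    qed
    then show "(\<integral>\<omega>\<in>A. indicator (C D) \<omega> \<partial>M) = (\<integral>\<omega>\<in>A. prob (C D) \<partial>M)"
      unfolding 1 2 .
  qed
  have D: "prob (C {(j, k). j = 0}) = \<pi>" using prob_Dj[of 0] by (simp add: Dj_def)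
  show ?thesis
    using e[of "{(j, k). j \<le> 0}"] e[of "D2 0"] e[of "D12 0"]
    by eventually_elim (simp add: Pst_def Post_C D prob_D2_0 prob_D12)
qed

section \<open>The state process is Markov\<close>

lemma Z_Suc: "AE \<omega> in M. Z (Suc n) \<omega> = (X n \<omega>, X (Suc n) \<omega>, Pim (X n \<omega>) (X (Suc n) \<omega>) (Pst n \<omega>))"
  using Pst_Suc by eventually_elim (simp add: Z_eq)

lemma vZ_integrable:
  assumes v: "v \<in> borel_measurable SM" "\<And>s. s \<in> Dom \<Longrightarrow> \<bar>v s\<bar> \<le> (1::real)"
  shows "integrable M (\<lambda>\<omega>. v (Z n \<omega>))"
proof (rule integrable_const_bound[where B=1])
  show "AE \<omega> in M. norm (v (Z n \<omega>)) \<le> 1" using Z_dom[of n] by eventually_elim (simp add: v(2))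
  show "(\<lambda>\<omega>. v (Z n \<omega>)) \<in> borel_measurable M"
    by (rule measurable_compose[OF hist_meas[OF Z_measurable] v(1)])
qed

text \<open>\<open>total_step\<close> is an identity between nonnegative integrals, whence the range
  [0, 1]. Its inner integral is the one in \<open>Tc_eq\<close>.\<close>

lemma Z_step_nonneg:
  assumes v: "v \<in> borel_measurable SM" "\<And>s. s \<in> Dom \<Longrightarrow> 0 \<le> v s \<and> v s \<le> (1::real)" and A: "A \<in> sets (F n)"
  shows "(\<integral>\<omega>\<in>A. v (Z (Suc n) \<omega>) \<partial>M) = (\<integral>\<omega>\<in>A. Tc v (Z n \<omega>) \<partial>M)"
proof -
  note AM = hist_sets[OF A]
  have va: "\<bar>v s\<bar> \<le> 1" if "s \<in> Dom" for s using v(2)[OF that] by simp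
  note g = Tc_measurable[OF v(1)]
  have g0: "0 \<le> Tc v s" "\<bar>Tc v s\<bar> \<le> 1" if "s \<in> Dom" for s
  proof -
    show "\<bar>Tc v s\<bar> \<le> 1" by (rule Tc_abs_le[OF that v(1) va])
    have "Tc (\<lambda>_. 0) s \<le> Tc v s"
      by (rule Tc_mono[OF that _ _ v(1) va]) (use v(2) in auto)
    then show "0 \<le> Tc v s" by (simp add: Tc_def step_int_def split: prod.splits)
  qed
  let ?v = "\<lambda>\<omega> u. v (X n \<omega>, u, Pim (X n \<omega>) u (Pst n \<omega>))"
  let ?G = "\<lambda>p. ennreal (?v (fst p) (snd p)) * indicator A (fst p)"
  have G: "?G \<in> borel_measurable (FX n)"
  proof (intro borel_measurable_times_ennreal measurable_compose[OF _ measurable_ennreal] SM_comp[OF v(1)]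
        Pi_measurable measurable_compose[OF measurable_fst X_hist[OF order_refl]] measurable_snd
        measurable_compose[OF measurable_fst Pst_measurable])
    show "(\<lambda>p. indicator A (fst p) :: ennreal) \<in> borel_measurable (FX n)"
      by (rule measurable_compose[OF measurable_fst]) (use A in simp)
  qed
  have "(\<integral>\<^sup>+\<omega>. ennreal (indicator A \<omega> *\<^sub>R v (Z (Suc n) \<omega>)) \<partial>M) = (\<integral>\<^sup>+\<omega>. ?G (\<omega>, X (Suc n) \<omega>) \<partial>M)"
    by (rule nn_integral_cong_AE, use Z_Suc[of n] in eventually_elim) (simp add: indicator_def)
  also have "\<dots> = (\<integral>\<^sup>+\<omega>. \<integral>\<^sup>+u. ennreal (H (X n \<omega>) u (Pst n \<omega>)) * ?G (\<omega>, u) \<partial>\<mu> \<partial>M)"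
    by (rule total_step[OF G])
  also have "\<dots> = (\<integral>\<^sup>+\<omega>. ennreal (indicator A \<omega> *\<^sub>R Tc v (Z n \<omega>)) \<partial>M)"
  proof (rule nn_integral_cong_AE, use Z_dom[of n] in eventually_elim)
    case (elim \<omega>)
    let ?z = "X n \<omega>" and ?a = "Pst n \<omega>"
    have s: "(X (n - 1) \<omega>, ?z, ?a) \<in> Dom" using elim by (simp add: Z_eq)
    then have z: "?z \<in> E" and a: "?a \<in> posterior_domain" by (auto simp: Dom_def)
    have "(\<integral>\<^sup>+u. ennreal (H ?z u ?a) * ?G (\<omega>, u) \<partial>\<mu>) = (\<integral>\<^sup>+u. indicator A \<omega> * ennreal (?v \<omega> u * H ?z u ?a) \<partial>\<mu>)"
    proof (rule nn_integral_cong)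
      fix u assume "u \<in> space \<mu>"
      then have u: "u \<in> E" by simp
      show "ennreal (H ?z u ?a) * ?G (\<omega>, u) = indicator A \<omega> * ennreal (?v \<omega> u * H ?z u ?a)"
        using H_nonneg[OF a z u] by (simp add: ennreal_mult' mult_ac)
    qed
    also have "\<dots> = indicator A \<omega> * (\<integral>\<^sup>+u. ennreal (?v \<omega> u * H ?z u ?a) \<partial>\<mu>)"
      by (rule nn_integral_cmult)
         (intro measurable_compose[OF _ measurable_ennreal] borel_measurable_integrable integrable_Tc[OF s v(1) va])
    also have "(\<integral>\<^sup>+u. ennreal (?v \<omega> u * H ?z u ?a) \<partial>\<mu>) = ennreal (Tc v (Z n \<omega>))"
    proof -
      have "(\<integral>\<^sup>+u. ennreal (?v \<omega> u * H ?z u ?a) \<partial>\<mu>) = ennreal (\<integral>u. ?v \<omega> u * H ?z u ?a \<partial>\<mu>)"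
        by (rule nn_integral_eq_integral[OF integrable_Tc[OF s v(1) va]])
           (auto intro!: AE_I2 mult_nonneg_nonneg H_nonneg a z v(2)[OF Dom_next[OF s], THEN conjunct1])
      moreover have "Tc v (Z n \<omega>) = (\<integral>u. ?v \<omega> u * H ?z u ?a \<partial>\<mu>)"
        unfolding Z_eq by (rule Tc_eq[OF s v(1) va])
      ultimately show ?thesis by (simp only:)
    qed
    finally show ?case by (simp add: indicator_def)
  qed
  finally have eq: "(\<integral>\<^sup>+\<omega>. ennreal (indicator A \<omega> *\<^sub>R v (Z (Suc n) \<omega>)) \<partial>M) = (\<integral>\<^sup>+\<omega>. ennreal (indicator A \<omega> *\<^sub>R Tc v (Z n \<omega>)) \<partial>M)" .
  have 1: "(\<integral>\<^sup>+\<omega>. ennreal (indicator A \<omega> *\<^sub>R w (Z m \<omega>)) \<partial>M) = ennreal (\<integral>\<omega>\<in>A. w (Z m \<omega>) \<partial>M)"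
    and 2: "0 \<le> (\<integral>\<omega>\<in>A. w (Z m \<omega>) \<partial>M)"
    if "w \<in> borel_measurable SM" "\<And>s. s \<in> Dom \<Longrightarrow> \<bar>w s\<bar> \<le> 1" "\<And>s. s \<in> Dom \<Longrightarrow> 0 \<le> w s" for w :: "state \<Rightarrow> real" and m
  proof -
    have ae: "AE \<omega> in M. 0 \<le> indicator A \<omega> *\<^sub>R w (Z m \<omega>)"
      using Z_dom[of m] by eventually_elim (simp add: that(3))
    show "(\<integral>\<^sup>+\<omega>. ennreal (indicator A \<omega> *\<^sub>R w (Z m \<omega>)) \<partial>M) = ennreal (\<integral>\<omega>\<in>A. w (Z m \<omega>) \<partial>M)"
      unfolding set_lebesgue_integral_def
      by (rule nn_integral_eq_integral[OF integrable_mult_indicator[OF AM vZ_integrable[OF that(1,2)]] ae])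
    show "0 \<le> (\<integral>\<omega>\<in>A. w (Z m \<omega>) \<partial>M)"
      unfolding set_lebesgue_integral_def by (rule integral_nonneg_AE[OF ae])
  qed
  show ?thesis
    using eq 1[OF v(1) va] 1[OF g g0(2) g0(1)] 2[OF v(1) va] 2[OF g g0(2) g0(1)] v(2) by (simp add: ennreal_inj)

qed

text \<open>Prepares the passage from [-1, 1] to [0, 1]: affine maps commute with expectations under
  probability kernels.\<close>

lemma step_int_half:
  fixes v :: "state \<Rightarrow> real"
  assumes s: "(y, z, a) \<in> Dom" and i: "i < 3"
    and v: "v \<in> borel_measurable SM" "\<And>s. s \<in> Dom \<Longrightarrow> \<bar>v s\<bar> \<le> 1"
  shows "stepi i (\<lambda>s. (v s + 1) / 2) z a = (stepi i v z a + 1) / 2"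
proof -
  have z: "z \<in> E" using s by (auto simp: Dom_def)
  interpret K: prob_space "K i z" by (rule prob_space_K[OF i z])
  have m: "(\<lambda>s. (v s + 1) / 2) \<in> borel_measurable SM"
    using v(1) by (intro real_measurable)
  have "integrable (K i z) (\<lambda>u. v (z, u, Pim z u a))" by (rule integrable_step[OF s v i])
  then show ?thesis
    unfolding step_int_K[OF i z m] step_int_K[OF i z v(1)] using K.prob_space by simp
qed

text \<open>The Markov property in integrated form, reduced to range [0, 1] by the affine map from v
  to (v + 1) / 2. It includes n = 0, which \<open>V0_eq\<close> uses.\<close>

lemma Z_step:
  assumes v: "v \<in> borel_measurable SM" "\<And>s. s \<in> Dom \<Longrightarrow> \<bar>v s\<bar> \<le> (1::real)" and A: "A \<in> sets (F n)"
  shows "(\<integral>\<omega>\<in>A. v (Z (Suc n) \<omega>) \<partial>M) = (\<integral>\<omega>\<in>A. Tc v (Z n \<omega>) \<partial>M)"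
proof -
  note AM = hist_sets[OF A]
  let ?w = "\<lambda>s. (v s + 1) / 2"
  have m: "?w \<in> borel_measurable SM"
    using v(1) by (intro real_measurable)
  have "(\<integral>\<omega>\<in>A. ?w (Z (Suc n) \<omega>) \<partial>M) = (\<integral>\<omega>\<in>A. Tc ?w (Z n \<omega>) \<partial>M)"
  proof (rule Z_step_nonneg[OF m _ A])
    fix s assume "s \<in> Dom"
    from v(2)[OF this] show "0 \<le> ?w s \<and> ?w s \<le> 1" by (simp add: abs_le_iff)
  qed
  also have "(\<integral>\<omega>\<in>A. Tc ?w (Z n \<omega>) \<partial>M) = (\<integral>\<omega>\<in>A. (Tc v (Z n \<omega>) + 1) / 2 \<partial>M)"
    unfolding set_lebesgue_integral_def
  proof (rule integral_cong_AE)
    show "AE \<omega> in M. indicator A \<omega> *\<^sub>R Tc ?w (Z n \<omega>) = indicator A \<omega> *\<^sub>R ((Tc v (Z n \<omega>) + 1) / 2)"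
      using Z_dom[of n]
    proof eventually_elim
      case (elim \<omega>)
      obtain y z a where s: "Z n \<omega> = (y, z, a)" by (cases "Z n \<omega>")
      have "Tc ?w (y, z, a) = ((c0 a + c1 a + c2 a) + Tc v (y, z, a)) / 2"
      proof -
        have h: "stepi i ?w z a = (stepi i v z a + 1) / 2" if "i < 3" for i
          by (rule step_int_half[OF elim[unfolded s] that v])
        have h0: "stepi 0 ?w z a = (stepi 0 v z a + 1) / 2" and h1: "stepi 1 ?w z a = (stepi 1 v z a + 1) / 2"
          and h2: "stepi 2 ?w z a = (stepi 2 v z a + 1) / 2" by (rule h, simp)+
        show ?thesis
          unfolding Tc_def prod.case h0 h1 h2 by (simp add: field_simps)
      qed
      then show ?case unfolding s c_sum by (simp add: add.commute)
    qed
    show "(\<lambda>\<omega>. indicator A \<omega> *\<^sub>R Tc ?w (Z n \<omega>)) \<in> borel_measurable M"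
      "(\<lambda>\<omega>. indicator A \<omega> *\<^sub>R ((Tc v (Z n \<omega>) + 1) / 2)) \<in> borel_measurable M"
      by (intro borel_measurable_scaleR borel_measurable_indicator AM real_measurable measurable_compose[OF hist_meas[OF Z_measurable]] Tc_measurable v m)+
  qed
  finally have eq: "(\<integral>\<omega>\<in>A. ?w (Z (Suc n) \<omega>) \<partial>M) = (\<integral>\<omega>\<in>A. (Tc v (Z n \<omega>) + 1) / 2 \<partial>M)" .
  have half: "(\<integral>\<omega>\<in>A. (u \<omega> + 1) / 2 \<partial>M) = ((\<integral>\<omega>\<in>A. u \<omega> \<partial>M) + prob A) / 2" if "integrable M u" for u :: "'a \<Rightarrow> real"
  proof -
    have i: "integrable M (\<lambda>\<omega>. indicator A \<omega> * u \<omega>)" using integrable_mult_indicator[OF AM that] by simp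
    have "(\<integral>\<omega>\<in>A. (u \<omega> + 1) / 2 \<partial>M) = (\<integral>\<omega>. (indicator A \<omega> * u \<omega> + indicator A \<omega>) / 2 \<partial>M)"
      unfolding set_lebesgue_integral_def by (rule Bochner_Integration.integral_cong) (auto simp: algebra_simps)
    also have "\<dots> = ((\<integral>\<omega>\<in>A. u \<omega> \<partial>M) + prob A) / 2"
      using i integrable_indicator_event[OF AM] sets.sets_into_space[OF AM]
      by (simp add: set_lebesgue_integral_def Int_absorb2)
    finally show ?thesis .
  qed
  have iT: "integrable M (\<lambda>\<omega>. Tc v (Z n \<omega>))"
    by (rule vZ_integrable[OF Tc_measurable[OF v(1)] Tc_abs_le[OF _ v]])
  have iv: "integrable M (\<lambda>\<omega>. v (Z (Suc n) \<omega>))"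
    by (rule vZ_integrable[OF v])
  show ?thesis using eq unfolding half[OF iv] half[OF iT] by simp
qed

section \<open>Versions of the conditional expectation operator\<close>

lemma id_SM_borel: "(\<lambda>s. s) \<in> SM \<rightarrow>\<^sub>M borel"
proof -
  have "(\<lambda>s. (fst s, fst (snd s), snd (snd s))) \<in> SM \<rightarrow>\<^sub>M borel"
    by (intro borel_measurable_Pair mu_to_borel SM_proj)
  then show ?thesis by simp
qed

lemma payoff_space_SM: "v \<in> payoff_space E \<Longrightarrow> v \<in> borel_measurable SM"
  by (rule measurable_compose[OF id_SM_borel]) (simp add: payoff_space_def)

lemma payoff_space_Dom: "v \<in> payoff_space E \<Longrightarrow> s \<in> Dom \<Longrightarrow> \<bar>v s\<bar> \<le> 1"
  using dom_cube by (auto simp: payoff_space_def Dom_def)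

lemma payoff_h_space: "payoff_h \<in> payoff_space E"
proof -
  have "payoff_h \<in> borel_measurable borel"
    unfolding payoff_h_alt[abs_def]
    by (intro borel_measurable_diff borel_measurable_fst_comp borel_measurable_snd_comp) simp_all
  then show ?thesis by (auto simp: payoff_space_def)
qed

lemma payoff_h_Dom: "s \<in> Dom \<Longrightarrow> \<bar>payoff_h s\<bar> \<le> 1"
  by (rule payoff_space_Dom[OF payoff_h_space])

lemma Q_op_space: "v \<in> payoff_space E \<Longrightarrow> T v \<in> payoff_space E \<Longrightarrow> Q_op T v \<in> payoff_space E"
  by (auto simp: payoff_space_def Q_op_def max_def intro!: borel_measurable_max[unfolded max_def])

text \<open>A measurable retraction of the real line onto E, used to extend functions of the state
  measurably; the start point x serves as the default.\<close>

definition retr :: "real \<Rightarrow> real" where "retr y = (if y \<in> E then y else x)"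

lemma retr_measurable: "retr \<in> borel \<rightarrow>\<^sub>M \<mu>"
proof (rule measurableI)
  fix B assume "B \<in> sets \<mu>"
  then have B: "B \<in> sets borel" "B \<subseteq> E"
    using sets_mu_borel sets.sets_into_space[of B \<mu>] by auto
  then have "retr -` B \<inter> space borel = (if x \<in> B then B \<union> - E else B)"
    by (auto simp: retr_def split: if_splits)
  then show "retr -` B \<inter> space borel \<in> sets borel" using B E_borel by auto
qed (simp add: retr_def x_in_E)

text \<open>
  Off \<open>E\<close> the densities need not be Borel and off the posterior domain \<open>Tc v\<close> may exceed 1, so both
  are modified there.
\<close>

definition Tx :: "(state \<Rightarrow> real) \<Rightarrow> state \<Rightarrow> real" where
  "Tx v s = (if snd (snd s) \<in> posterior_domain then Tc v (retr (fst s), retr (fst (snd s)), snd (snd s)) else 0)"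

lemma posterior_domain_closed: "closed posterior_domain"
proof -
  have eq: "posterior_domain = {a. 0 \<le> fst (snd a)} \<inter> {a. fst (snd a) \<le> fst a} \<inter> {a. 0 \<le> snd (snd a)}
      \<inter> {a. fst a + snd (snd a) \<le> 1}"
    by (auto simp: posterior_domain_def)
  show ?thesis
    unfolding eq by (intro closed_Int closed_Collect_le continuous_intros)
qed

lemma Tx_borel:
  assumes v: "v \<in> borel_measurable SM"
  shows "Tx v \<in> borel_measurable borel"
  unfolding Tx_def
proof (rule measurable_If)
  have ss: "(\<lambda>s::state. snd (snd s)) \<in> borel_measurable borel"
    by (intro borel_measurable_snd_comp) simp
  show "(\<lambda>s. Tc v (retr (fst s), retr (fst (snd s)), snd (snd s))) \<in> borel_measurable borel"
    by (intro SM_comp[OF Tc_measurable[OF v]] ss measurable_compose[OF _ retr_measurable]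
        borel_measurable_fst_comp borel_measurable_snd_comp) simp_all
  have "(\<lambda>s::state. snd (snd s)) -` posterior_domain \<inter> space borel \<in> sets borel"
    by (rule measurable_sets[OF ss]) (simp add: posterior_domain_closed borel_closed)
  then show "{s \<in> space borel. snd (snd (s :: state)) \<in> posterior_domain} \<in> sets borel"
    by (simp add: vimage_def)
qed simp

lemma Tx_Dom: "s \<in> Dom \<Longrightarrow> Tx v s = Tc v s"
  by (auto simp: Tx_def Dom_def retr_def)

lemma Z_borel: "Z n \<in> F n \<rightarrow>\<^sub>M borel"
  by (rule measurable_compose[OF Z_measurable id_SM_borel])

abbreviation "G n \<equiv> vimage_algebra (space M) (Z n) borel"

lemma G_hist: "sets (G n) \<subseteq> sets (F n)"
  using measurable_sets[OF Z_borel[of n]] by (auto simp: sets_vimage_algebra2)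

lemma subalgebra_G: "subalgebra M (G n)"
  using G_hist hist_sets by (fastforce simp: subalgebra_def)

text \<open>\<open>Z_step\<close> tests against all events of \<open>F n\<close>, in particular
  those generated by \<open>Z n\<close>; the candidate is itself a function of
  \<open>Z n\<close>.\<close>

lemma Tx_cond_exp:
  assumes v: "v \<in> borel_measurable SM" "\<And>s. s \<in> Dom \<Longrightarrow> \<bar>v s\<bar> \<le> 1"
  shows "AE \<omega> in M. Tx v (Z n \<omega>) = real_cond_exp M (G n) (\<lambda>\<omega>. v (Z (Suc n) \<omega>)) \<omega>"
proof -
  interpret S: finite_measure_subalgebra M "G n"
    by (intro finite_measure_subalgebra.intro finite_measure_subalgebra_axioms.intro
      finite_measure_axioms subalgebra_G)
  have mM: "(\<lambda>\<omega>. Tx v (Z n \<omega>)) \<in> borel_measurable M"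
    by (rule measurable_compose[OF hist_meas[OF Z_borel] Tx_borel[OF v(1)]])
  have mT: "(\<lambda>\<omega>. Tc v (Z n \<omega>)) \<in> borel_measurable M"
    by (rule measurable_compose[OF hist_meas[OF Z_measurable] Tc_measurable[OF v(1)]])
  have ae: "AE \<omega> in M. Tx v (Z n \<omega>) = Tc v (Z n \<omega>)"
    using Z_dom[of n] by eventually_elim (rule Tx_Dom)
  have "AE \<omega> in M. real_cond_exp M (G n) (\<lambda>\<omega>. v (Z (Suc n) \<omega>)) \<omega> = Tx v (Z n \<omega>)"
  proof (rule S.real_cond_exp_charact[OF _ vZ_integrable[OF v]])
    have "integrable M (\<lambda>\<omega>. Tc v (Z n \<omega>))"
      by (rule vZ_integrable[OF Tc_measurable[OF v(1)] Tc_abs_le[OF _ v]])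
    then show "integrable M (\<lambda>\<omega>. Tx v (Z n \<omega>))"
      using integrable_cong_AE[OF mM mT ae] by simp
    show "(\<lambda>\<omega>. Tx v (Z n \<omega>)) \<in> borel_measurable (G n)"
      by (rule measurable_compose[OF measurable_vimage_algebra1 Tx_borel[OF v(1)]]) simp
    fix A assume "A \<in> sets (G n)"
    then have A: "A \<in> sets (F n)" using G_hist by blast
    have "(\<integral>\<omega>\<in>A. v (Z (Suc n) \<omega>) \<partial>M) = (\<integral>\<omega>\<in>A. Tc v (Z n \<omega>) \<partial>M)" by (rule Z_step[OF v A])
    also have "\<dots> = (\<integral>\<omega>\<in>A. Tx v (Z n \<omega>) \<partial>M)"
      unfolding set_lebesgue_integral_def
      by (rule integral_cong_AE)
         (use ae in \<open>auto intro!: borel_measurable_times borel_measurable_indicator hist_sets[OF A] mM mT\<close>)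
    finally show "(\<integral>\<omega>\<in>A. v (Z (Suc n) \<omega>) \<partial>M) = (\<integral>\<omega>\<in>A. Tx v (Z n \<omega>) \<partial>M)" .
  qed
  then show ?thesis by eventually_elim simp
qed

text \<open>Ensures that statements about all versions of the operator are not vacuous.\<close>

lemma Tx_version: "is_T_version M E Z Tx"
  unfolding is_T_version_def
proof (intro ballI conjI allI impI)
  fix v assume v: "v \<in> payoff_space E"
  note vS = payoff_space_SM[OF v] payoff_space_Dom[OF v]
  show "Tx v \<in> payoff_space E"
  proof -
    have "\<bar>Tx v s\<bar> \<le> 1" if "s \<in> E \<times> E \<times> {0..1} \<times> {0..1} \<times> {0..1}" for s
    proof (cases "snd (snd s) \<in> posterior_domain")
      case True
      with that have "s \<in> Dom" by (cases s) (auto simp: Dom_def)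
      then show ?thesis using Tc_abs_le[OF _ vS] by (simp add: Tx_Dom)
    qed (simp add: Tx_def)
    then show ?thesis using Tx_borel[OF vS(1)] by (auto simp: payoff_space_def)
  qed
  fix n :: nat
  show "AE \<omega> in M. Tx v (Z n \<omega>) = real_cond_exp M (G n) (\<lambda>\<omega>. v (Z (n + 1) \<omega>)) \<omega>"
    using Tx_cond_exp[OF vS] by simp
qed

text \<open>A version is pinned down only along the laws of the state process, so it is compared
  with \<open>Tc\<close> there. For the same reason v may be replaced by a function w equal to it
  along the next state.\<close>

lemma T_version_AE:
  assumes T: "is_T_version M E Z T" and v: "v \<in> payoff_space E"
    and w: "w \<in> borel_measurable SM" "\<And>s. s \<in> Dom \<Longrightarrow> \<bar>w s\<bar> \<le> 1"
    and vw: "AE \<omega> in M. v (Z (Suc n) \<omega>) = w (Z (Suc n) \<omega>)" and n: "1 \<le> n"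
  shows "AE \<omega> in M. T v (Z n \<omega>) = Tc w (Z n \<omega>)"
proof -
  interpret S: finite_measure_subalgebra M "G n"
    by (intro finite_measure_subalgebra.intro finite_measure_subalgebra_axioms.intro
      finite_measure_axioms subalgebra_G)
  have "AE \<omega> in M. T v (Z n \<omega>) = real_cond_exp M (G n) (\<lambda>\<omega>. v (Z (Suc n) \<omega>)) \<omega>"
    using T v n by (auto simp: is_T_version_def)
  moreover have "AE \<omega> in M. real_cond_exp M (G n) (\<lambda>\<omega>. v (Z (Suc n) \<omega>)) \<omega> = real_cond_exp M (G n) (\<lambda>\<omega>. w (Z (Suc n) \<omega>)) \<omega>"
    by (rule S.real_cond_exp_cong[OF vw])
       (intro measurable_compose[OF hist_meas[OF Z_measurable]] payoff_space_SM[OF v] w(1))+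
  moreover have "AE \<omega> in M. Tx w (Z n \<omega>) = real_cond_exp M (G n) (\<lambda>\<omega>. w (Z (Suc n) \<omega>)) \<omega>"
    by (rule Tx_cond_exp[OF w])
  ultimately show ?thesis
    using Z_dom[of n] by eventually_elim (simp add: Tx_Dom)
qed

text \<open>\<open>Q_op\<close> takes the maximum with the previous iterate, the recursion with the
  payoff. The iterates increase and stay above the payoff, so both give the same.\<close>

lemma val_Suc_max: "s \<in> Dom \<Longrightarrow> max (val (Rk k) (Sk k) s) (cont (Rk k) (Sk k) s) = val (Rk (Suc k)) (Sk (Suc k)) s"
proof -
  assume s: "s \<in> Dom"
  have "payoff_h s \<le> val (Rk k) (Sk k) s" by (cases k) (simp_all add: val_0 val_Suc)
  then show ?thesis using val_mono[OF s, of k] unfolding val_Suc by linarith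
qed

text \<open>Membership in the payoff space is carried along because only there is the version
  constrained.\<close>

lemma Q_iterate:
  assumes T: "is_T_version M E Z T"
  shows "(Q_op T ^^ k) payoff_h \<in> payoff_space E"
    and "1 \<le> n \<Longrightarrow> AE \<omega> in M. (Q_op T ^^ k) payoff_h (Z n \<omega>) = val (Rk k) (Sk k) (Z n \<omega>)"
proof (induction k arbitrary: n)
  case 0
  case 1 show ?case by (simp add: payoff_h_space)
  case 2 show ?case by (simp add: val_0)
next
  case (Suc k)
  case 1
  have "T ((Q_op T ^^ k) payoff_h) \<in> payoff_space E" using T Suc(1) by (auto simp: is_T_version_def)
  then show ?case using Q_op_space[OF Suc(1)] by simp
  case 2
  have a: "AE \<omega> in M. T ((Q_op T ^^ k) payoff_h) (Z n \<omega>) = Tc (val (Rk k) (Sk k)) (Z n \<omega>)"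
    by (rule T_version_AE[OF T Suc(1) val_seq(1) val_seq(2) Suc(2) 2]) simp_all
  have q: "(Q_op T ^^ Suc k) payoff_h s = max ((Q_op T ^^ k) payoff_h s) (T ((Q_op T ^^ k) payoff_h) s)" for s
    by (simp add: Q_op_def[of T "(Q_op T ^^ k) payoff_h"])
  show ?case
    using a Suc(2)[OF 2] Z_dom[of n]
    by eventually_elim (simp only: q val_Suc_max[symmetric] cont_eq_Tc)
qed

text \<open>\<open>RS k\<close> holds the pair with index k + 1, so its stopping set belongs to k
  iterations of \<open>Q_op\<close>. The two descriptions of the set can agree only along the state
  process.\<close>

lemma stop_set_Q:
  assumes T: "is_T_version M E Z T" and n: "1 \<le> n"
  shows "AE \<omega> in M. Z n \<omega> \<in> Dset (Rk k) (Sk k) \<longleftrightarrow> T ((Q_op T ^^ k) payoff_h) (Z n \<omega>) \<le> payoff_h (Z n \<omega>)"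
proof -
  have "AE \<omega> in M. T ((Q_op T ^^ k) payoff_h) (Z n \<omega>) = Tc (val (Rk k) (Sk k)) (Z n \<omega>)"
    by (rule T_version_AE[OF T Q_iterate(1)[OF T] val_seq(1) val_seq(2) Q_iterate(2)[OF T] n]) simp_all
  with Z_dom[of n] show ?thesis
    by eventually_elim (simp add: mem_stop_set cont_eq_Tc)
qed

section \<open>Optimal stopping\<close>

lemma stopping_time_le:
  assumes "\<tau> \<in> stopping_times M X"
  shows "{\<omega> \<in> space M. \<tau> \<omega> \<le> t} \<in> sets (hist M X t)"
  using assms by (auto simp: stopping_times_def stopping_time_def pred_def)

lemma stopping_time_eq_hist:
  assumes "\<tau> \<in> stopping_times M X"
  shows "{\<omega> \<in> space M. \<tau> \<omega> = t} \<in> sets (hist M X t)"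
proof -
  have "{\<omega> \<in> space M. \<tau> \<omega> = t} = {\<omega> \<in> space M. \<tau> \<omega> \<le> t} - (\<Union>s\<in>{..<t}. {\<omega> \<in> space M. \<tau> \<omega> \<le> s})"
  proof (intro equalityI subsetI)
    fix \<omega> assume w: "\<omega> \<in> {\<omega> \<in> space M. \<tau> \<omega> \<le> t} - (\<Union>s\<in>{..<t}. {\<omega> \<in> space M. \<tau> \<omega> \<le> s})"
    then have "\<not> \<tau> \<omega> < t" by auto
    with w show "\<omega> \<in> {\<omega> \<in> space M. \<tau> \<omega> = t}" by auto
  qed auto
  moreover have "(\<Union>s\<in>{..<t}. {\<omega> \<in> space M. \<tau> \<omega> \<le> s}) \<in> sets (hist M X t)"
  proof (rule sets.countable_UN')
    show "(\<lambda>s. {\<omega> \<in> space M. \<tau> \<omega> \<le> s}) ` {..<t} \<subseteq> sets (hist M X t)"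
    proof safe
      fix s assume "s < t"
      then show "{\<omega> \<in> space M. \<tau> \<omega> \<le> s} \<in> sets (hist M X t)"
        using stopping_time_le[OF assms, of s] hist_mono[of s t] by (meson less_imp_le subsetD)
    qed
  qed simp
  ultimately show ?thesis using stopping_time_le[OF assms, of t] by auto
qed

lemma stopping_time_gt_hist:
  assumes "\<tau> \<in> stopping_times M X"
  shows "{\<omega> \<in> space M. t < \<tau> \<omega>} \<in> sets (hist M X t)"
proof -
  have eq: "{\<omega> \<in> space M. t < \<tau> \<omega>} = space (hist M X t) - {\<omega> \<in> space M. \<tau> \<omega> \<le> t}" by auto
  show ?thesis unfolding eq by (rule sets.compl_sets[OF stopping_time_le[OF assms]])
qed

lemma stopping_time_measurable:
  assumes "\<tau> \<in> stopping_times M X"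
  shows "\<tau> \<in> M \<rightarrow>\<^sub>M count_space UNIV"
proof -
  have "\<tau> -` {t} \<inter> space M \<in> sets M" for t
    using hist_sets[OF stopping_time_eq_hist[OF assms, of t]] by (simp add: vimage_def Int_def conj_commute)
  then show ?thesis by (simp add: measurable_count_space_eq2_countable)
qed

lemma stopped_measurable:
  assumes "\<tau> \<in> stopping_times M X" "\<And>n. u n \<in> borel_measurable M"
  shows "(\<lambda>\<omega>. case \<tau> \<omega> of enat n \<Rightarrow> u n \<omega> | \<infinity> \<Rightarrow> (0::real)) \<in> borel_measurable M"
proof (rule measurable_compose_countable'[where f="\<lambda>t \<omega>. case t of enat n \<Rightarrow> u n \<omega> | \<infinity> \<Rightarrow> 0", OF _ stopping_time_measurable[OF assms(1)]])
  fix t show "(\<lambda>\<omega>. case t of enat n \<Rightarrow> u n \<omega> | \<infinity> \<Rightarrow> 0) \<in> borel_measurable M"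
    by (cases t) (simp_all add: assms(2))
qed simp

text \<open>Splits the expectation by the value of \<tau>. Each term lives on an event of
  \<open>F n\<close>, where conditional expectations can be substituted; the limit is
  dominated.\<close>

lemma stopped_sum:
  assumes \<tau>: "\<tau> \<in> stopping_times M X" and u: "\<And>n. u n \<in> borel_measurable M" "\<And>n. AE \<omega> in M. \<bar>u n \<omega>\<bar> \<le> (1::real)"
  shows "(\<lambda>N. \<Sum>n<N. \<integral>\<omega>\<in>{\<omega> \<in> space M. \<tau> \<omega> = enat n}. u n \<omega> \<partial>M)
    \<longlonglongrightarrow> (\<integral>\<omega>. (case \<tau> \<omega> of enat n \<Rightarrow> u n \<omega> | \<infinity> \<Rightarrow> 0) \<partial>M)"
proof -
  let ?T = "\<lambda>n. {\<omega> \<in> space M. \<tau> \<omega> = enat n}"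
  let ?s = "\<lambda>N \<omega>. \<Sum>n<N. indicator (?T n) \<omega> *\<^sub>R u n \<omega>"
  have T: "?T n \<in> sets M" for n by (rule hist_sets[OF stopping_time_eq_hist[OF \<tau>]])
  have ui: "integrable M (u n)" for n
    by (rule integrable_const_bound[OF _ u(1), where B=1]) (use u(2)[of n] in simp)
  have all: "AE \<omega> in M. \<forall>n. \<bar>u n \<omega>\<bar> \<le> 1" using u(2) by (simp add: AE_all_countable)
  have s_eq: "?s N \<omega> = (case \<tau> \<omega> of enat n \<Rightarrow> if n < N then u n \<omega> else 0 | \<infinity> \<Rightarrow> 0)" if "\<omega> \<in> space M" for N \<omega>
  proof (cases "\<tau> \<omega>")
    case (enat m)
    have "?s N \<omega> = (\<Sum>n<N. if n = m then u n \<omega> else 0)"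
      by (rule sum.cong) (use that enat in \<open>auto simp: indicator_def\<close>)
    also have "\<dots> = (if m < N then u m \<omega> else 0)" by (simp add: sum.delta)
    finally show ?thesis using enat by simp
  qed (auto simp: indicator_def)
  have "(\<lambda>N. \<integral>\<omega>. ?s N \<omega> \<partial>M) \<longlonglongrightarrow> (\<integral>\<omega>. (case \<tau> \<omega> of enat n \<Rightarrow> u n \<omega> | \<infinity> \<Rightarrow> 0) \<partial>M)"
  proof (rule integral_dominated_convergence[where w="\<lambda>_. 1"])
    show "(\<lambda>\<omega>. case \<tau> \<omega> of enat n \<Rightarrow> u n \<omega> | \<infinity> \<Rightarrow> 0) \<in> borel_measurable M"
      by (rule stopped_measurable[OF \<tau> u(1)])
    show "?s N \<in> borel_measurable M" for N
      by (intro borel_measurable_sum borel_measurable_scaleR borel_measurable_indicator T u(1))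
    show "AE \<omega> in M. (\<lambda>N. ?s N \<omega>) \<longlonglongrightarrow> (case \<tau> \<omega> of enat n \<Rightarrow> u n \<omega> | \<infinity> \<Rightarrow> 0)"
    proof (rule AE_I2)
      fix \<omega> assume w: "\<omega> \<in> space M"
      have "eventually (\<lambda>N. ?s N \<omega> = (case \<tau> \<omega> of enat n \<Rightarrow> u n \<omega> | \<infinity> \<Rightarrow> 0)) sequentially"
      proof (cases "\<tau> \<omega>")
        case (enat m)
        show ?thesis
          unfolding s_eq[OF w] using eventually_gt_at_top[of m] by eventually_elim (simp add: enat)
      qed (simp add: s_eq[OF w])
      then show "(\<lambda>N. ?s N \<omega>) \<longlonglongrightarrow> (case \<tau> \<omega> of enat n \<Rightarrow> u n \<omega> | \<infinity> \<Rightarrow> 0)"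
        by (rule tendsto_eventually)
    qed
    show "AE \<omega> in M. norm (?s N \<omega>) \<le> 1" for N
      using all AE_space
    proof eventually_elim
      case (elim \<omega>)
      then show ?case unfolding s_eq[OF elim(2)] by (auto split: enat.split)
    qed
  qed simp
  moreover have "(\<integral>\<omega>. ?s N \<omega> \<partial>M) = (\<Sum>n<N. \<integral>\<omega>\<in>?T n. u n \<omega> \<partial>M)" for N
    unfolding set_lebesgue_integral_def
    by (rule Bochner_Integration.integral_sum) (rule integrable_mult_indicator[OF T ui])
  ultimately show ?thesis by simp
qed

text \<open>The optional substitution rule: processes with equal conditional expectations given
  \<open>F n\<close>, adapted or not, have equal stopped expectations.\<close>

lemma stopped_cong:
  assumes \<tau>: "\<tau> \<in> stopping_times M X" and u: "\<And>n. u n \<in> borel_measurable M" "\<And>n. AE \<omega> in M. \<bar>u n \<omega>\<bar> \<le> (1::real)"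
    and w: "\<And>n. w n \<in> borel_measurable M" "\<And>n. AE \<omega> in M. \<bar>w n \<omega>\<bar> \<le> (1::real)"
    and eq: "\<And>n A. A \<in> sets (F n) \<Longrightarrow> (\<integral>\<omega>\<in>A. u n \<omega> \<partial>M) = (\<integral>\<omega>\<in>A. w n \<omega> \<partial>M)"
  shows "(\<integral>\<omega>. (case \<tau> \<omega> of enat n \<Rightarrow> u n \<omega> | \<infinity> \<Rightarrow> 0) \<partial>M) = (\<integral>\<omega>. (case \<tau> \<omega> of enat n \<Rightarrow> w n \<omega> | \<infinity> \<Rightarrow> 0) \<partial>M)"
  using LIMSEQ_unique[OF stopped_sum[OF \<tau> u]] stopped_sum[OF \<tau> w]
  by (simp add: eq stopping_time_eq_hist[OF \<tau>])

section \<open>Success probability as expected payoff\<close>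

abbreviation "J \<equiv> expected_payoff M Z payoff_h"

lemma hZ: "(\<lambda>\<omega>. payoff_h (Z n \<omega>)) \<in> borel_measurable M" "AE \<omega> in M. \<bar>payoff_h (Z n \<omega>)\<bar> \<le> 1"
proof -
  show "(\<lambda>\<omega>. payoff_h (Z n \<omega>)) \<in> borel_measurable M"
    by (rule measurable_compose[OF hist_meas[OF Z_measurable] payoff_h_measurable])
  show "AE \<omega> in M. \<bar>payoff_h (Z n \<omega>)\<bar> \<le> 1" using Z_dom[of n] by eventually_elim (rule payoff_h_Dom)
qed

text \<open>Stopping at n succeeds exactly on the hidden event of one change, whose conditional
  probability given \<open>F n\<close> is \<alpha> - \<beta>; \<open>stopped_cong\<close> exchanges
  the two.\<close>

lemma success_eq_J:
  assumes \<tau>: "\<tau> \<in> stopping_times M X"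
  shows "success_prob M \<theta>1 \<theta>2 \<tau> = J \<tau>"
proof -
  let ?i = "\<lambda>n. indicator (C (D1 n)) :: 'a \<Rightarrow> real"
  have i: "?i n \<in> borel_measurable M" "AE \<omega> in M. \<bar>?i n \<omega>\<bar> \<le> 1" for n
    by (auto intro!: borel_measurable_indicator simp: indicator_def)
  have eq: "(\<integral>\<omega>\<in>A. ?i n \<omega> \<partial>M) = (\<integral>\<omega>\<in>A. payoff_h (Z n \<omega>) \<partial>M)" if A: "A \<in> sets (F n)" for n A
  proof -
    note AM = hist_sets[OF A]
    have "(\<integral>\<omega>\<in>A. ?i n \<omega> \<partial>M) = prob (C (D1 n) \<inter> A)"
      by (rule set_integral_indicator_prob[OF C_sets AM])
    also have "\<dots> = prob (C {(j, k). j \<le> n} \<inter> A) - prob (C (D2 n) \<inter> A)"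
    proof -
      have "prob (C {(j, k). j \<le> n} \<inter> A) = prob (C (D2 n) \<inter> A) + prob (C (D1 n) \<inter> A)"
        by (rule prob_split[OF AM]) (use theta_le' in \<open>fastforce simp: mem_C D_defs\<close>)+
      then show ?thesis by simp
    qed
    also have "\<dots> = (\<integral>\<omega>\<in>A. 0 + 1 * fst (Pst n \<omega>) + (- 1) * fst (snd (Pst n \<omega>)) + 0 * snd (snd (Pst n \<omega>)) \<partial>M)"
      unfolding set_integral_lin[OF A] by simp
    also have "\<dots> = (\<integral>\<omega>\<in>A. payoff_h (Z n \<omega>) \<partial>M)"
      by (intro arg_cong2[where f="set_lebesgue_integral M"] refl ext) (simp add: payoff_h_alt Z_eq)
    finally show ?thesis .
  qed
  define S where "S = {\<omega> \<in> space M. \<tau> \<omega> < \<infinity> \<and> enat (\<theta>1 \<omega>) \<le> \<tau> \<omega> \<and> \<tau> \<omega> < enat (\<theta>2 \<omega>)}"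
  have "success_prob M \<theta>1 \<theta>2 \<tau> = (\<integral>\<omega>. indicator S \<omega> \<partial>M)"
    by (simp add: success_prob_def S_def Int_absorb2 Collect_mono_iff subset_iff)
  also have "\<dots> = (\<integral>\<omega>. (case \<tau> \<omega> of enat n \<Rightarrow> ?i n \<omega> | \<infinity> \<Rightarrow> 0) \<partial>M)"
  proof (rule Bochner_Integration.integral_cong[OF refl])
    fix \<omega> assume "\<omega> \<in> space M"
    then show "indicator S \<omega> = (case \<tau> \<omega> of enat n \<Rightarrow> ?i n \<omega> | \<infinity> \<Rightarrow> 0)"
      by (cases "\<tau> \<omega>") (auto simp: S_def indicator_def mem_C D_defs)
  qed
  also have "\<dots> = J \<tau>"
    unfolding expected_payoff_def by (rule stopped_cong[OF \<tau> i hZ eq])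
  finally show ?thesis .
qed

section \<open>The value function along the state process\<close>

lemma VZ_measurable: "(\<lambda>\<omega>. Vf (Z n \<omega>)) \<in> borel_measurable M"
  by (rule measurable_compose[OF hist_meas[OF Z_measurable] Vf_measurable])

lemma VZ_integrable: "integrable M (\<lambda>\<omega>. Vf (Z n \<omega>))"
  by (rule vZ_integrable[OF Vf_measurable Vf_abs])

lemma TVZ_integrable: "integrable M (\<lambda>\<omega>. Tc Vf (Z n \<omega>))"
  by (rule vZ_integrable[OF Tc_measurable[OF Vf_measurable] Tc_abs_le[OF _ Vf_measurable Vf_abs]])

lemma Vf_ge: "s \<in> Dom \<Longrightarrow> payoff_h s \<le> Vf s" "s \<in> Dom \<Longrightarrow> Tc Vf s \<le> Vf s"
  by (simp_all add: Vf_eq_max cont_lim_eq_Tc)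

lemma Vf_stop: "s \<in> Dom \<Longrightarrow> s \<in> Bst \<Longrightarrow> Vf s = payoff_h s"
  and Vf_cont: "s \<in> Dom \<Longrightarrow> s \<notin> Bst \<Longrightarrow> Vf s = Tc Vf s"
  by (simp_all add: Vf_eq_max mem_B_star cont_lim_eq_Tc)

lemma Vf_Dom: "s \<in> Dom \<Longrightarrow> 0 \<le> Vf s \<and> Vf s \<le> 1 - fst (snd (snd (snd s)))"
  using Vf_bounds by (cases s) auto

lemma theta2_tail: "(\<lambda>n. prob (space M - C (D2 n))) \<longlonglongrightarrow> 0"
proof -
  have "(\<lambda>n. prob (C (D2 n))) \<longlonglongrightarrow> prob (\<Union>n. C (D2 n))"
    by (rule finite_Lim_measure_incseq) (auto simp: incseq_def mem_C D_defs)
  also have "(\<Union>n. C (D2 n)) = space M"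
    using theta_le by (auto simp: mem_C D_defs)
  finally have "(\<lambda>n. 1 - prob (C (D2 n))) \<longlonglongrightarrow> 1 - 1"
    by (intro tendsto_intros) (simp add: prob_space)
  then show ?thesis by (simp add: prob_compl)
qed

text \<open>The bound 1 - \<beta> has expectation equal to the probability of n < \<theta>2, which
  tends to 0.\<close>

lemma VZ_tail: "(\<lambda>n. \<integral>\<omega>. Vf (Z n \<omega>) \<partial>M) \<longlonglongrightarrow> 0"
proof (rule tendsto_sandwich[OF _ _ tendsto_const theta2_tail])
  show "\<forall>\<^sub>F n in sequentially. 0 \<le> (\<integral>\<omega>. Vf (Z n \<omega>) \<partial>M)"
  proof (intro always_eventually allI)
    fix n
    have "AE \<omega> in M. 0 \<le> Vf (Z n \<omega>)" using Z_dom[of n] by eventually_elim (simp add: Vf_Dom)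
    then show "0 \<le> (\<integral>\<omega>. Vf (Z n \<omega>) \<partial>M)" by (rule integral_nonneg_AE)
  qed
  show "\<forall>\<^sub>F n in sequentially. (\<integral>\<omega>. Vf (Z n \<omega>) \<partial>M) \<le> prob (space M - C (D2 n))"
  proof (intro always_eventually allI)
    fix n
    have i: "integrable M (\<lambda>\<omega>. 1 - fst (snd (Pst n \<omega>)))"
      by (intro Bochner_Integration.integrable_diff integrable_const Pst_coords)
    have "(\<integral>\<omega>. Vf (Z n \<omega>) \<partial>M) \<le> (\<integral>\<omega>. 1 - fst (snd (Pst n \<omega>)) \<partial>M)"
    proof (rule integral_mono_AE[OF VZ_integrable i])
      show "AE \<omega> in M. Vf (Z n \<omega>) \<le> 1 - fst (snd (Pst n \<omega>))"
        using Z_dom[of n]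
      proof eventually_elim
        case (elim \<omega>)
        from Vf_Dom[OF elim] show ?case by (simp add: Z_eq)
      qed
    qed
    also have "\<dots> = 1 - (\<integral>\<omega>. fst (snd (Pst n \<omega>)) \<partial>M)"
      using Pst_coords(4)[of n] prob_space by simp
    also have "(\<integral>\<omega>. fst (snd (Pst n \<omega>)) \<partial>M) = (\<integral>\<omega>\<in>space M. fst (snd (Pst n \<omega>)) \<partial>M)"
      by (rule set_integral_space[OF Pst_coords(4), symmetric])
    also have "\<dots> = prob (C (D2 n) \<inter> space M)"
      using Pst_int(2)[of "space M" n] sets.top[of "F n"] by simp
    also have "C (D2 n) \<inter> space M = C (D2 n)" by (auto simp: mem_C)
    finally show "(\<integral>\<omega>. Vf (Z n \<omega>) \<partial>M) \<le> prob (space M - C (D2 n))" by (simp add: prob_compl)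
  qed
qed

text \<open>The value process with the payoff in place of the value once \<tau> has occurred. In
  this way its expectations lead from the value at time 1 to the expected payoff of \<tau>.\<close>

definition Yst :: "('a \<Rightarrow> enat) \<Rightarrow> nat \<Rightarrow> 'a \<Rightarrow> real" where
  "Yst \<tau> N \<omega> = (case \<tau> \<omega> of enat n \<Rightarrow> if n \<le> N then payoff_h (Z n \<omega>) else Vf (Z N \<omega>) | \<infinity> \<Rightarrow> Vf (Z N \<omega>))"

lemma all_Z_dom: "AE \<omega> in M. \<forall>n. Z n \<omega> \<in> Dom"
  using Z_dom by (simp add: AE_all_countable)

lemma Yst_integrable:
  assumes \<tau>: "\<tau> \<in> stopping_times M X"
  shows "integrable M (Yst \<tau> N)"
proof (rule integrable_const_bound[where B=1])
  show "AE \<omega> in M. norm (Yst \<tau> N \<omega>) \<le> 1"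
    using all_Z_dom by eventually_elim (auto simp: Yst_def payoff_h_Dom Vf_abs split: enat.split)
  show "Yst \<tau> N \<in> borel_measurable M"
    unfolding Yst_def
  proof (rule measurable_compose_countable'[where f="\<lambda>t \<omega>. case t of enat n \<Rightarrow> if n \<le> N then payoff_h (Z n \<omega>) else Vf (Z N \<omega>) | \<infinity> \<Rightarrow> Vf (Z N \<omega>)", OF _ stopping_time_measurable[OF \<tau>]])
    fix t show "(\<lambda>\<omega>. case t of enat n \<Rightarrow> if n \<le> N then payoff_h (Z n \<omega>) else Vf (Z N \<omega>) | \<infinity> \<Rightarrow> Vf (Z N \<omega>)) \<in> borel_measurable M"
    proof (cases t)
      case (enat n)
      then show ?thesis by (cases "n \<le> N") (simp_all add: hZ VZ_measurable)
    qed (simp add: VZ_measurable)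
  qed simp
qed

text \<open>It differs from the payoff collected by time N only where \<tau> > N, and there by
  \<open>Vf (Z N)\<close>, whose expectation vanishes in the limit. This also accounts for \<tau> =
  \<infinity>.\<close>

lemma Yst_LIMSEQ:
  assumes \<tau>: "\<tau> \<in> stopping_times M X"
  shows "(\<lambda>N. \<integral>\<omega>. Yst \<tau> N \<omega> \<partial>M) \<longlonglongrightarrow> J \<tau>"
proof -
  define g where "g N \<omega> = (case \<tau> \<omega> of enat n \<Rightarrow> if n \<le> N then payoff_h (Z n \<omega>) else 0 | \<infinity> \<Rightarrow> 0)" for N \<omega>
  have gm: "g N \<in> borel_measurable M" for N
    unfolding g_def
  proof (rule stopped_measurable[OF \<tau>])
    fix n show "(\<lambda>\<omega>. if n \<le> N then payoff_h (Z n \<omega>) else 0) \<in> borel_measurable M"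
      by (cases "n \<le> N") (simp_all add: hZ)
  qed
  have gb: "AE \<omega> in M. norm (g N \<omega>) \<le> 1" for N
    using all_Z_dom by eventually_elim (auto simp: g_def payoff_h_Dom split: enat.split)
  have gi: "integrable M (g N)" for N by (rule integrable_const_bound[OF gb gm])
  have lim: "(\<lambda>N. \<integral>\<omega>. g N \<omega> \<partial>M) \<longlonglongrightarrow> J \<tau>"
    unfolding expected_payoff_def
  proof (rule integral_dominated_convergence[where w="\<lambda>_. 1"])
    show "AE \<omega> in M. (\<lambda>N. g N \<omega>) \<longlonglongrightarrow> (case \<tau> \<omega> of enat n \<Rightarrow> payoff_h (Z n \<omega>) | \<infinity> \<Rightarrow> 0)"
    proof (rule AE_I2)
      fix \<omega>
      have "eventually (\<lambda>N. g N \<omega> = (case \<tau> \<omega> of enat n \<Rightarrow> payoff_h (Z n \<omega>) | \<infinity> \<Rightarrow> 0)) sequentially"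
      proof (cases "\<tau> \<omega>")
        case (enat m)
        show ?thesis
          unfolding g_def using eventually_ge_at_top[of m] by eventually_elim (simp add: enat)
      qed (simp add: g_def)
      then show "(\<lambda>N. g N \<omega>) \<longlonglongrightarrow> (case \<tau> \<omega> of enat n \<Rightarrow> payoff_h (Z n \<omega>) | \<infinity> \<Rightarrow> 0)"
        by (rule tendsto_eventually)
    qed
  qed (use gm gb stopped_measurable[OF \<tau> hZ(1)] in auto)
  have "(\<lambda>N. (\<integral>\<omega>. Yst \<tau> N \<omega> \<partial>M) - (\<integral>\<omega>. g N \<omega> \<partial>M)) \<longlonglongrightarrow> 0"
  proof (rule Lim_null_comparison[OF _ VZ_tail], intro always_eventually allI)
    fix N
    have "(\<integral>\<omega>. Yst \<tau> N \<omega> \<partial>M) - (\<integral>\<omega>. g N \<omega> \<partial>M) = (\<integral>\<omega>. Yst \<tau> N \<omega> - g N \<omega> \<partial>M)"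
      by (rule Bochner_Integration.integral_diff[OF Yst_integrable[OF \<tau>] gi, symmetric])
    moreover have "norm (\<integral>\<omega>. Yst \<tau> N \<omega> - g N \<omega> \<partial>M) \<le> (\<integral>\<omega>. Vf (Z N \<omega>) \<partial>M)"
    proof (rule order_trans[OF integral_norm_bound integral_mono_AE[OF _ VZ_integrable]])
      show "integrable M (\<lambda>\<omega>. norm (Yst \<tau> N \<omega> - g N \<omega>))"
        by (intro integrable_norm Bochner_Integration.integrable_diff Yst_integrable \<tau> gi)
      show "AE \<omega> in M. norm (Yst \<tau> N \<omega> - g N \<omega>) \<le> Vf (Z N \<omega>)"
        using all_Z_dom by eventually_elim (auto simp: Yst_def g_def Vf_Dom split: enat.split)
    qed
    ultimately show "norm ((\<integral>\<omega>. Yst \<tau> N \<omega> \<partial>M) - (\<integral>\<omega>. g N \<omega> \<partial>M)) \<le> (\<integral>\<omega>. Vf (Z N \<omega>) \<partial>M)" by simp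
  qed
  from tendsto_add[OF this lim] show ?thesis by simp
qed

context
  fixes \<tau> assumes \<tau>: "\<tau> \<in> stopping_times M X"
begin

text \<open>The integrand is \<open>Yst\<close> at N + 1 with the value instead of the payoff when
  \<tau> = N + 1. Since \<tau> > N is an event of \<open>F N\<close>, the Markov property replaces
  the next value by \<open>Tc Vf\<close> at N.\<close>

lemma Yst_incr:
  defines "A \<equiv> \<lambda>N. {\<omega> \<in> space M. enat N < \<tau> \<omega>}"
  shows "integrable M (\<lambda>\<omega>. Yst \<tau> N \<omega> + indicator (A N) \<omega> *\<^sub>R (Vf (Z (Suc N) \<omega>) - Vf (Z N \<omega>)))"
    and "(\<integral>\<omega>. Yst \<tau> N \<omega> + indicator (A N) \<omega> *\<^sub>R (Vf (Z (Suc N) \<omega>) - Vf (Z N \<omega>)) \<partial>M) =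
      (\<integral>\<omega>. Yst \<tau> N \<omega> \<partial>M) + (\<integral>\<omega>. indicator (A N) \<omega> *\<^sub>R (Tc Vf (Z N \<omega>) - Vf (Z N \<omega>)) \<partial>M)"
proof -
  have A: "A N \<in> sets (F N)" unfolding A_def by (rule stopping_time_gt_hist[OF \<tau>])
  note AM = hist_sets[OF A]
  have i: "integrable M (\<lambda>\<omega>. indicator (A N) \<omega> *\<^sub>R g \<omega>)" if "integrable M g" for g :: "'a \<Rightarrow> real"
    by (rule integrable_mult_indicator[OF AM that])
  show "integrable M (\<lambda>\<omega>. Yst \<tau> N \<omega> + indicator (A N) \<omega> *\<^sub>R (Vf (Z (Suc N) \<omega>) - Vf (Z N \<omega>)))"
    by (intro Bochner_Integration.integrable_add Yst_integrable[OF \<tau>] i Bochner_Integration.integrable_diff VZ_integrable)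
  have split: "(\<integral>\<omega>. indicator (A N) \<omega> *\<^sub>R (g \<omega> - g' \<omega>) \<partial>M) = (\<integral>\<omega>\<in>A N. g \<omega> \<partial>M) - (\<integral>\<omega>\<in>A N. g' \<omega> \<partial>M)"
    if "integrable M g" "integrable M g'" for g g' :: "'a \<Rightarrow> real"
    unfolding set_lebesgue_integral_def scaleR_diff_right
    by (rule Bochner_Integration.integral_diff[OF i[OF that(1)] i[OF that(2)]])
  have "(\<integral>\<omega>\<in>A N. Vf (Z (Suc N) \<omega>) \<partial>M) = (\<integral>\<omega>\<in>A N. Tc Vf (Z N \<omega>) \<partial>M)"
    by (rule Z_step[OF Vf_measurable Vf_abs A])
  then have "(\<integral>\<omega>. indicator (A N) \<omega> *\<^sub>R (Vf (Z (Suc N) \<omega>) - Vf (Z N \<omega>)) \<partial>M)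
      = (\<integral>\<omega>. indicator (A N) \<omega> *\<^sub>R (Tc Vf (Z N \<omega>) - Vf (Z N \<omega>)) \<partial>M)"
    by (simp only: split[OF VZ_integrable VZ_integrable] split[OF TVZ_integrable VZ_integrable])
  moreover have "(\<integral>\<omega>. Yst \<tau> N \<omega> + indicator (A N) \<omega> *\<^sub>R (Vf (Z (Suc N) \<omega>) - Vf (Z N \<omega>)) \<partial>M) =
      (\<integral>\<omega>. Yst \<tau> N \<omega> \<partial>M) + (\<integral>\<omega>. indicator (A N) \<omega> *\<^sub>R (Vf (Z (Suc N) \<omega>) - Vf (Z N \<omega>)) \<partial>M)"
    by (intro Bochner_Integration.integral_add Yst_integrable[OF \<tau>] i Bochner_Integration.integrable_diff VZ_integrable)
  ultimately show "(\<integral>\<omega>. Yst \<tau> N \<omega> + indicator (A N) \<omega> *\<^sub>R (Vf (Z (Suc N) \<omega>) - Vf (Z N \<omega>)) \<partial>M) =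
      (\<integral>\<omega>. Yst \<tau> N \<omega> \<partial>M) + (\<integral>\<omega>. indicator (A N) \<omega> *\<^sub>R (Tc Vf (Z N \<omega>) - Vf (Z N \<omega>)) \<partial>M)"
    by simp
qed

text \<open>Two losses are possible: stopping at N + 1 pays at most the value, and continuing from N
  yields at most the value.\<close>

lemma Yst_supermartingale: "(\<integral>\<omega>. Yst \<tau> (Suc N) \<omega> \<partial>M) \<le> (\<integral>\<omega>. Yst \<tau> N \<omega> \<partial>M)"
proof -
  let ?A = "{\<omega> \<in> space M. enat N < \<tau> \<omega>}"
  have "(\<integral>\<omega>. Yst \<tau> (Suc N) \<omega> \<partial>M) \<le>
      (\<integral>\<omega>. Yst \<tau> N \<omega> + indicator ?A \<omega> *\<^sub>R (Vf (Z (Suc N) \<omega>) - Vf (Z N \<omega>)) \<partial>M)"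
  proof (rule integral_mono_AE[OF Yst_integrable[OF \<tau>] Yst_incr(1)])
    show "AE \<omega> in M. Yst \<tau> (Suc N) \<omega> \<le> Yst \<tau> N \<omega> + indicator ?A \<omega> *\<^sub>R (Vf (Z (Suc N) \<omega>) - Vf (Z N \<omega>))"
      using all_Z_dom AE_space
      by eventually_elim (auto simp: Yst_def indicator_def le_Suc_eq intro: Vf_ge split: enat.split)
  qed
  also have "\<dots> \<le> (\<integral>\<omega>. Yst \<tau> N \<omega> \<partial>M)"
  proof -
    have "AE \<omega> in M. 0 \<le> - (indicator ?A \<omega> *\<^sub>R (Tc Vf (Z N \<omega>) - Vf (Z N \<omega>)))"
      using Z_dom[of N] by eventually_elim (auto simp: indicator_def intro: Vf_ge)
    then have "0 \<le> (\<integral>\<omega>. - (indicator ?A \<omega> *\<^sub>R (Tc Vf (Z N \<omega>) - Vf (Z N \<omega>))) \<partial>M)"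
      by (rule integral_nonneg_AE)
    then show ?thesis unfolding Yst_incr(2) by simp
  qed
  finally show ?thesis .
qed

text \<open>The expectations decrease to \<open>J \<tau>\<close>, and at N = 1 a time \<tau> \<ge> 1
  has collected either the first payoff or the first value.\<close>

lemma J_le:
  assumes "\<And>\<omega>. \<omega> \<in> space M \<Longrightarrow> 1 \<le> \<tau> \<omega>"
  shows "J \<tau> \<le> (\<integral>\<omega>. Vf (Z 1 \<omega>) \<partial>M)"
proof (rule LIMSEQ_le_const2[OF Yst_LIMSEQ[OF \<tau>]], intro exI allI impI)
  fix N :: nat assume "1 \<le> N"
  then have "(\<integral>\<omega>. Yst \<tau> N \<omega> \<partial>M) \<le> (\<integral>\<omega>. Yst \<tau> 1 \<omega> \<partial>M)"
  proof (induction N rule: dec_induct)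
    case (step N)
    then show ?case using Yst_supermartingale[of N] by simp
  qed simp
  also have "\<dots> \<le> (\<integral>\<omega>. Vf (Z 1 \<omega>) \<partial>M)"
  proof (rule integral_mono_AE[OF Yst_integrable[OF \<tau>] VZ_integrable])
    show "AE \<omega> in M. Yst \<tau> 1 \<omega> \<le> Vf (Z 1 \<omega>)"
      using all_Z_dom AE_space
    proof eventually_elim
      case (elim \<omega>)
      then show ?case
        using assms[OF elim(2)] by (cases "\<tau> \<omega>") (auto simp: Yst_def one_enat_def le_Suc_eq intro: Vf_ge)
    qed
  qed
  finally show "(\<integral>\<omega>. Yst \<tau> N \<omega> \<partial>M) \<le> (\<integral>\<omega>. Vf (Z 1 \<omega>) \<partial>M)" .
qed

text \<open>The hypotheses turn both losses into equalities: value and payoff coincide on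
  \<open>Bst\<close>, where \<tau> stops, and value and continuation value coincide off it, where
  \<tau> goes on.\<close>

lemma J_eq:
  assumes ge: "\<And>\<omega>. \<omega> \<in> space M \<Longrightarrow> 1 \<le> \<tau> \<omega>"
    and hit: "\<And>\<omega> n. \<omega> \<in> space M \<Longrightarrow> \<tau> \<omega> = enat n \<Longrightarrow> Z n \<omega> \<in> Bst"
    and before: "\<And>\<omega> n. \<omega> \<in> space M \<Longrightarrow> 1 \<le> n \<Longrightarrow> enat n < \<tau> \<omega> \<Longrightarrow> Z n \<omega> \<notin> Bst"
  shows "J \<tau> = (\<integral>\<omega>. Vf (Z 1 \<omega>) \<partial>M)"
proof (rule LIMSEQ_unique[OF Yst_LIMSEQ[OF \<tau>]])
  have "(\<integral>\<omega>. Yst \<tau> N \<omega> \<partial>M) = (\<integral>\<omega>. Vf (Z 1 \<omega>) \<partial>M)" if "1 \<le> N" for N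
    using that
  proof (induction N rule: dec_induct)
    case base
    show ?case
    proof (rule integral_cong_AE[OF borel_measurable_integrable[OF Yst_integrable[OF \<tau>]] VZ_measurable])
      show "AE \<omega> in M. Yst \<tau> 1 \<omega> = Vf (Z 1 \<omega>)"
        using all_Z_dom AE_space
      proof eventually_elim
        case (elim \<omega>)
        then show ?case
          using ge[OF elim(2)] hit[OF elim(2)]
          by (cases "\<tau> \<omega>") (auto simp: Yst_def one_enat_def le_Suc_eq Vf_stop)
      qed
    qed
  next
    case (step N)
    let ?A = "{\<omega> \<in> space M. enat N < \<tau> \<omega>}"
    have "(\<integral>\<omega>. Yst \<tau> (Suc N) \<omega> \<partial>M) =
        (\<integral>\<omega>. Yst \<tau> N \<omega> + indicator ?A \<omega> *\<^sub>R (Vf (Z (Suc N) \<omega>) - Vf (Z N \<omega>)) \<partial>M)"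
    proof (rule integral_cong_AE[OF borel_measurable_integrable[OF Yst_integrable[OF \<tau>]]
          borel_measurable_integrable[OF Yst_incr(1)]])
      show "AE \<omega> in M. Yst \<tau> (Suc N) \<omega> = Yst \<tau> N \<omega> + indicator ?A \<omega> *\<^sub>R (Vf (Z (Suc N) \<omega>) - Vf (Z N \<omega>))"
        using all_Z_dom AE_space
      proof eventually_elim
        case (elim \<omega>)
        then show ?case
          using hit[OF elim(2)]
          by (cases "\<tau> \<omega>") (auto simp: Yst_def indicator_def le_Suc_eq Vf_stop)
      qed
    qed
    also have "\<dots> = (\<integral>\<omega>. Yst \<tau> N \<omega> \<partial>M) + (\<integral>\<omega>. indicator ?A \<omega> *\<^sub>R (Tc Vf (Z N \<omega>) - Vf (Z N \<omega>)) \<partial>M)"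
      by (rule Yst_incr(2))
    also have "(\<integral>\<omega>. indicator ?A \<omega> *\<^sub>R (Tc Vf (Z N \<omega>) - Vf (Z N \<omega>)) \<partial>M) = 0"
    proof (rule integral_eq_zero_AE)
      show "AE \<omega> in M. indicator ?A \<omega> *\<^sub>R (Tc Vf (Z N \<omega>) - Vf (Z N \<omega>)) = 0"
        using Z_dom[of N]
      proof eventually_elim
        case (elim \<omega>)
        then show ?case
          using before[of \<omega> N] step(1) Vf_cont[OF elim] by (auto simp: indicator_def)
      qed
    qed
    finally show ?case using step by simp
  qed
  then show "(\<lambda>N. \<integral>\<omega>. Yst \<tau> N \<omega> \<partial>M) \<longlonglongrightarrow> (\<integral>\<omega>. Vf (Z 1 \<omega>) \<partial>M)"
    by (intro tendsto_eventually eventually_mono[OF eventually_ge_at_top[of 1]])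
qed

end

section \<open>The first entry time and its payoff\<close>

abbreviation "\<tau>0 \<equiv> first_entry Z (Bst)"

text \<open>The infimum over the empty set is \<infinity>; over a nonempty set it is attained, since
  the order is well-founded.\<close>

lemma first_entry_le_iff:
  "first_entry W B \<omega> \<le> enat m \<longleftrightarrow> (\<exists>n\<in>{1..m}. W n \<omega> \<in> B)"
proof
  assume le: "first_entry W B \<omega> \<le> enat m"
  let ?S = "enat ` {n. 1 \<le> n \<and> W n \<omega> \<in> B}"
  have "?S \<noteq> {}"
  proof
    assume "?S = {}"
    then have "first_entry W B \<omega> = Inf {}" by (simp only: first_entry_def)
    then have "first_entry W B \<omega> = \<infinity>" by (simp add: top_enat_def)
    with le show False by simp
  qed
  then have "Inf ?S \<in> ?S" by (meson ex_in_conv wellorder_InfI)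
  then show "\<exists>n\<in>{1..m}. W n \<omega> \<in> B" using le by (auto simp: first_entry_def)
next
  assume "\<exists>n\<in>{1..m}. W n \<omega> \<in> B"
  then obtain n where n: "1 \<le> n" "n \<le> m" "W n \<omega> \<in> B" by auto
  then have "first_entry W B \<omega> \<le> enat n" unfolding first_entry_def by (intro INF_lower) auto
  with n show "first_entry W B \<omega> \<le> enat m" by (meson enat_ord_simps(1) order_trans)
qed

lemma first_entry_ge_1: "1 \<le> first_entry W B \<omega>"
  unfolding first_entry_def by (rule INF_greatest) (simp add: one_enat_def)

lemma first_entry_hit: "first_entry W B \<omega> = enat n \<Longrightarrow> W n \<omega> \<in> B"
proof -
  assume e: "first_entry W B \<omega> = enat n"
  then obtain m where m: "m \<in> {1..n}" "W m \<omega> \<in> B" using first_entry_le_iff[of W B \<omega> n] by auto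
  then have "first_entry W B \<omega> \<le> enat m" unfolding first_entry_le_iff by auto
  with e m have "m = n" by simp
  with m show "W n \<omega> \<in> B" by simp
qed

lemma first_entry_before: "1 \<le> n \<Longrightarrow> enat n < first_entry W B \<omega> \<Longrightarrow> W n \<omega> \<notin> B"
  using first_entry_le_iff[of W B \<omega> n] by (auto simp: not_le[symmetric])

lemma tau0_stopping: "\<tau>0 \<in> stopping_times M X"
  unfolding stopping_times_def mem_Collect_eq
proof
  fix t
  show "Measurable.pred (hist M X t) (\<lambda>\<omega>. \<tau>0 \<omega> \<le> t)"
  proof (cases t)
    case (enat m)
    have Zm: "{\<omega> \<in> space M. Z n \<omega> \<in> Bst} \<in> sets (F m)" if "n \<le> m" for n
    proof -
      \<comment> \<open>\<open>Bst\<close> is known to be measurable only within the space of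
        \<open>SM\<close>, where the process takes its values, so it is intersected with that
        space.\<close>
      have "Z n -` {s \<in> space SM. s \<in> Bst} \<inter> space (F n) \<in> sets (F n)"
        by (rule measurable_sets[OF Z_measurable B_star_measurable])
      also have "Z n -` {s \<in> space SM. s \<in> Bst} \<inter> space (F n) = {\<omega> \<in> space M. Z n \<omega> \<in> Bst}"
        using measurable_space[OF Z_measurable, of _ n] by auto
      finally show ?thesis using hist_mono[of "enat n" "enat m"] that by auto
    qed
    have "{\<omega> \<in> space M. \<tau>0 \<omega> \<le> enat m} = (\<Union>n\<in>{1..m}. {\<omega> \<in> space M. Z n \<omega> \<in> Bst})"
      by (auto simp: first_entry_le_iff)
    also have "\<dots> \<in> sets (F m)" by (rule sets.finite_UN) (auto intro: Zm)
    finally show ?thesis by (simp add: enat pred_def)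
  next
    case infinity
    then show ?thesis by simp
  qed
qed

lemma J_tau0: "J \<tau>0 = (\<integral>\<omega>. Vf (Z 1 \<omega>) \<partial>M)"
  by (rule J_eq[OF tau0_stopping]) (rule first_entry_ge_1 first_entry_hit first_entry_before; assumption)+

text \<open>One more step of the Markov property, from time 1 back to time 0, where observation and
  posterior are almost surely constant.\<close>

lemma V0_eq: "V0 \<mu> f p1 p2 \<pi> \<rho> x = (\<integral>\<omega>. Vf (Z 1 \<omega>) \<partial>M)"
proof -
  let ?a = "(\<pi>, \<rho> * \<pi>, \<rho> * (1 - \<pi>))"
  have a: "?a \<in> posterior_domain"
  proof -
    have "\<rho> * \<pi> \<le> 1 * \<pi>" "\<rho> * (1 - \<pi>) \<le> 1 * (1 - \<pi>)"
      using pi_range rho_range by (intro mult_right_mono; simp)+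
    then show ?thesis using pi_range rho_range by (auto simp: posterior_domain_def)
  qed
  \<comment> \<open>Truncated subtraction makes \<open>X (0 - 1)\<close> equal to
    \<open>X 0\<close>, so the first coordinate of the state at time 0 is x too.\<close>
  have d: "(x, x, ?a) \<in> Dom" using a x_in_E by (simp add: Dom_def)
  have "(\<integral>\<omega>. Vf (Z 1 \<omega>) \<partial>M) = (\<integral>\<omega>\<in>space M. Vf (Z (Suc 0) \<omega>) \<partial>M)"
    using set_integral_space[OF VZ_integrable[of 1]] by simp
  also have "\<dots> = (\<integral>\<omega>\<in>space M. Tc Vf (Z 0 \<omega>) \<partial>M)"
    by (rule Z_step[OF Vf_measurable Vf_abs]) (use sets.top[of "F 0"] in simp_all)
  also have "\<dots> = (\<integral>\<omega>. Tc Vf (Z 0 \<omega>) \<partial>M)"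
    by (rule set_integral_space[OF TVZ_integrable])
  also have "\<dots> = (\<integral>\<omega>. Tc Vf (x, x, ?a) \<partial>M)"
  proof (rule integral_cong_AE[OF borel_measurable_integrable[OF TVZ_integrable] borel_measurable_const])
    show "AE \<omega> in M. Tc Vf (Z 0 \<omega>) = Tc Vf (x, x, ?a)"
      using Pst_0 X_zero by eventually_elim (simp add: Z_eq)
  qed
  also have "\<dots> = Tc Vf (x, x, ?a)" using prob_space by simp
  also have "\<dots> = cont Rl Sl (x, x, ?a)" by (rule cont_lim_eq_Tc[OF d, symmetric])
  also have "\<dots> = V0 \<mu> f p1 p2 \<pi> \<rho> x"
    unfolding cont_def V0_def Let_def prod.case by (simp add: algebra_simps)
  finally show ?thesis ..
qed

section \<open>Stopping at time 0 and the overall bound\<close>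

lemma const_stopping: "(\<lambda>_. t) \<in> stopping_times M X"
  by (simp add: stopping_times_def stopping_time_const)

lemma success_0:
  assumes "\<tau> \<in> stopping_times M X" "AE \<omega> in M. \<tau> \<omega> = 0"
  shows "success_prob M \<theta>1 \<theta>2 \<tau> = \<pi> * (1 - \<rho>)"
proof -
  let ?S = "{\<omega> \<in> space M. \<tau> \<omega> < \<infinity> \<and> enat (\<theta>1 \<omega>) \<le> \<tau> \<omega> \<and> \<tau> \<omega> < enat (\<theta>2 \<omega>)}"
  have S: "?S = (\<lambda>\<omega>. (\<tau> \<omega>, \<theta> \<omega>)) -` {(t, j, k). t < \<infinity> \<and> enat j \<le> t \<and> t < enat k} \<inter> space M"
    by (auto simp: \<theta>_def)
  have "(\<lambda>\<omega>. (\<tau> \<omega>, \<theta> \<omega>)) \<in> M \<rightarrow>\<^sub>M count_space UNIV \<Otimes>\<^sub>M count_space UNIV"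
    by (intro measurable_Pair stopping_time_measurable assms theta_pair)
  then have "?S \<in> sets M"
    unfolding S by (rule measurable_sets) (subst pair_measure_countable; simp)
  \<comment> \<open>With \<tau> = 0 almost surely, success means \<theta>1 = 0 < \<theta>2.\<close>
  then have "prob ?S = prob (C (Dt 0 0))"
    using assms(2)
    by (intro finite_measure_eq_AE) (auto elim!: eventually_mono simp: mem_C mem_D zero_enat_def)
  then show ?thesis using prob_Dt'[of 0 0] prob_Dj[of 0] by (simp add: success_prob_def)
qed

text \<open>Whether \<tau> = 0 is decided by the almost trivial \<open>F 0\<close>, so a stopping
  time cannot mix stopping at 0 with later stopping.\<close>

lemma success_le:
  assumes \<tau>: "\<tau> \<in> stopping_times M X"
  shows "success_prob M \<theta>1 \<theta>2 \<tau> \<le> max (\<pi> * (1 - \<rho>)) (V0 \<mu> f p1 p2 \<pi> \<rho> x)"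
proof -
  have "{\<omega> \<in> space M. \<tau> \<omega> = 0} \<in> sets (F 0)"
    using stopping_time_eq_hist[OF \<tau>, of 0] by (simp add: zero_enat_def)
  from hist_0[OF this] show ?thesis
  proof
    assume "AE \<omega> in M. \<omega> \<in> {\<omega> \<in> space M. \<tau> \<omega> = 0}"
    then have "AE \<omega> in M. \<tau> \<omega> = 0" by eventually_elim simp
    from success_0[OF \<tau> this] show ?thesis by simp
  next
    assume ae: "AE \<omega> in M. \<omega> \<notin> {\<omega> \<in> space M. \<tau> \<omega> = 0}"
    \<comment> \<open>\<open>J_le\<close> asks for a time \<ge> 1 at every point, but here this
      holds only almost surely; the maximum with 1 repairs the null set.\<close>
    let ?\<sigma> = "\<lambda>\<omega>. max (\<tau> \<omega>) 1"
    have \<sigma>: "?\<sigma> \<in> stopping_times M X"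
      using \<tau> const_stopping[of 1] by (auto simp: stopping_times_def intro: stopping_time_max)
    have "J \<tau> = J ?\<sigma>"
      unfolding expected_payoff_def
    proof (rule integral_cong_AE)
      show "AE \<omega> in M. (case \<tau> \<omega> of enat n \<Rightarrow> payoff_h (Z n \<omega>) | \<infinity> \<Rightarrow> 0) =
          (case ?\<sigma> \<omega> of enat n \<Rightarrow> payoff_h (Z n \<omega>) | \<infinity> \<Rightarrow> 0)"
        using ae AE_space
      proof eventually_elim
        case (elim \<omega>)
        then have "1 \<le> \<tau> \<omega>" by (simp add: ileI1[of 0, simplified] one_eSuc zero_less_iff_neq_zero)
        then have "?\<sigma> \<omega> = \<tau> \<omega>" by (simp add: max_def)
        then show ?case by simp
      qed
    qed (rule stopped_measurable[OF \<tau> hZ(1)] stopped_measurable[OF \<sigma> hZ(1)])+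
    then have "success_prob M \<theta>1 \<theta>2 \<tau> = J ?\<sigma>" by (simp add: success_eq_J[OF \<tau>])
    also have "\<dots> \<le> V0 \<mu> f p1 p2 \<pi> \<rho> x" unfolding V0_eq by (rule J_le[OF \<sigma>]) simp
    finally show ?thesis by simp
  qed
qed

end

theorem theorem4p1:
  fixes M :: "'a measure" and E :: "real set" and \<mu> :: "real measure"
    and f :: "nat \<Rightarrow> real \<Rightarrow> real \<Rightarrow> real" and \<pi> \<rho> p1 p2 x :: real
    and \<theta>1 \<theta>2 :: "'a \<Rightarrow> nat" and X :: "nat \<Rightarrow> 'a \<Rightarrow> real"
  assumes model: "switching_model M E \<mu> f \<pi> \<rho> p1 p2 x \<theta>1 \<theta>2 X"
  shows
    "let Z = \<xi> M \<theta>1 \<theta>2 X;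
         R = R_seq \<mu> f p1 p2;
         S = S_seq \<mu> f p1 p2;
         \<tau>0 = first_entry Z (B_star \<mu> f p1 p2);
         v0 = V0 \<mu> f p1 p2 \<pi> \<rho> x
     in
       (\<forall>y\<in>E. \<forall>z\<in>E. \<forall>a\<in>posterior_domain.
          convergent (\<lambda>n. R n (y, z, a)) \<and> convergent (\<lambda>n. S n (y, z, a))) \<and>
       (\<exists>T. is_T_version M E Z T) \<and>
       (\<forall>T k n. is_T_version M E Z T \<longrightarrow> 1 \<le> n \<longrightarrow>
          (AE \<omega> in M. Z n \<omega> \<in> stop_set \<mu> f p1 p2 (R k) (S k) \<longleftrightarrow>
             payoff_h (Z n \<omega>) \<ge> T ((Q_op T ^^ k) payoff_h) (Z n \<omega>))) \<and>
       is_optimal {\<tau> \<in> stopping_times M X. \<forall>\<omega>\<in>space M. 1 \<le> \<tau> \<omega>}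
         (expected_payoff M Z payoff_h) \<tau>0 \<and>
       opt_value M \<theta>1 \<theta>2 X = max (\<pi> * (1 - \<rho>)) v0 \<and>
       is_optimal (stopping_times M X) (success_prob M \<theta>1 \<theta>2)
         (\<lambda>\<omega>. if \<pi> * (1 - \<rho>) \<ge> v0 then 0 else \<tau>0 \<omega>)"
proof -
  interpret switching_model M E \<mu> f \<pi> \<rho> p1 p2 x \<theta>1 \<theta>2 X by (rule model)
  let ?v0 = "V0 \<mu> f p1 p2 \<pi> \<rho> x"
  have opt0: "is_optimal {\<tau> \<in> stopping_times M X. \<forall>\<omega>\<in>space M. 1 \<le> \<tau> \<omega>} J \<tau>0"
    unfolding is_optimal_def J_tau0
    using tau0_stopping J_le by (auto simp: first_entry_ge_1)
  \<comment> \<open>The condition does not depend on \<omega>, so this is either the constant 0 or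
    the first entry time, and it attains the bound of \<open>success_le\<close>.\<close>
  define \<tau>' where "\<tau>' = (\<lambda>\<omega>. if ?v0 \<le> \<pi> * (1 - \<rho>) then 0 else \<tau>0 \<omega>)"
  have \<tau>': "\<tau>' \<in> stopping_times M X \<and> success_prob M \<theta>1 \<theta>2 \<tau>' = max (\<pi> * (1 - \<rho>)) ?v0"
  proof (cases "?v0 \<le> \<pi> * (1 - \<rho>)")
    case True
    then have "\<tau>' = (\<lambda>_. 0)" by (simp add: \<tau>'_def)
    then show ?thesis using True const_stopping[of 0] success_0[OF const_stopping[of 0]] by simp
  next
    case False
    then have "\<tau>' = \<tau>0" by (simp add: \<tau>'_def)
    then show ?thesis using False tau0_stopping success_eq_J[OF tau0_stopping] J_tau0 V0_eq by simp
  qed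
  then have opt: "is_optimal (stopping_times M X) (success_prob M \<theta>1 \<theta>2) \<tau>'"
    unfolding is_optimal_def using success_le by auto
  have "opt_value M \<theta>1 \<theta>2 X = max (\<pi> * (1 - \<rho>)) ?v0"
    unfolding opt_value_def
  proof (rule cSup_eq_maximum)
    show "max (\<pi> * (1 - \<rho>)) ?v0 \<in> success_prob M \<theta>1 \<theta>2 ` stopping_times M X"
      using \<tau>' by (metis imageI)
  qed (use success_le in auto)
  with opt0 opt show ?thesis
    unfolding Let_def \<tau>'_def
    using seq_convergent Tx_version stop_set_Q by (auto simp: Dom_def)
qed

end
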